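(* Let $f : X \to Y$ be a (continuous) map of compacta and let $K$ be a CW-complex. Let $I=[0,1]$ and define $f_* : X_* = X \times I \to Y$ by $f_*(x,t) = f(x)$. Consider the following properties: (0) $\operatorname{e-dim} f \leq K$; (1) $\operatorname{e-dim} f_* \leq \Sigma K$; (2) there exists a $\sigma$-compact subset $A$ of $X_*$ such that $\operatorname{e-dim} A \leq K$ and $\dim f_*|_{X_* \setminus A} \leq 0$; (2') a set $A$ satisfying (2) can be chosen such that $A$ splits into compacta $A = \bigcup_{i=1}^{\infty} A_i$ such that each component of each $A_i$ admits a $0$-dimensional map into a fiber of $f$; (3) almost every map $g_* : X_* \to I$ is such that for the map $(f_*, g_* ) : X_* \to Y \times I$, $\operatorname{e-dim}(f_*,g_* ) \leq K$. Then (0)$\Rightarrow$(3)$\Rightarrow$(2')$\Rightarrow$(2)$\Rightarrow$(1).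
   Context: All topological spaces (other than CW-complexes) are assumed separable metrizable; a compactum is a compact metric space. $\dim$ is the covering dimension. For a space $Z$ and a CW-complex $K$, $\operatorname{e-dim} Z \leq K$ means that every continuous map from a closed subset of $Z$ into $K$ extends to a continuous map $Z \to K$. For a map $h : Z \to W$, $\operatorname{e-dim} h \leq K$ means that $\operatorname{e-dim} h^{-1}(w) \leq K$ for every $w \in W$, and $\dim h = \sup\{\dim h^{-1}(w) : w \in W\}$; $h$ is $0$-dimensional if $\dim h \le 0$. $\Sigma K$ is the suspension of $K$. $(f_*,g_* )$ denotes the map $z \mapsto (f_*(z),g_*(z))$. "Almost every map $g_* : X_* \to I$" means all maps in the space $C(X_*,I)$ of continuous maps (with the uniform convergence topology) except for a set of first category. *)

theory Defs
  imports "HOL-Analysis.Analysis"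
begin

abbreviation unit_interval :: "real topology"
  where "unit_interval \<equiv> top_of_set {0..1}"

definition compactum :: "'a topology \<Rightarrow> bool"
  where "compactum X \<longleftrightarrow> compact_space X \<and> metrizable_space X"

abbreviation fiber :: "'a topology \<Rightarrow> ('a \<Rightarrow> 'b) \<Rightarrow> 'b \<Rightarrow> 'a topology"
  where "fiber Z h w \<equiv> subtopology Z {z \<in> topspace Z. h z = w}"


section \<open>CW-complexes\<close>

definition unit_disk :: "nat \<Rightarrow> (nat \<Rightarrow> real) set"
  where "unit_disk n = {x \<in> topspace (Euclidean_space n). (\<Sum>i<n. (x i)\<^sup>2) \<le> 1}"

definition open_unit_disk :: "nat \<Rightarrow> (nat \<Rightarrow> real) set"
  where "open_unit_disk n = {x \<in> topspace (Euclidean_space n). (\<Sum>i<n. (x i)\<^sup>2) < 1}"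

text \<open>
  A cell structure is given by its set of characteristic maps, a pair \<open>(n, \<phi>)\<close> standing for
  an \<open>n\<close>-cell with characteristic map \<open>\<phi>\<close> from the closed \<open>n\<close>-disk. The open cells of distinct
  pairs are disjoint, so every cell carries exactly one of the maps (up to its irrelevant
  values outside the disk). The clauses are: the open cells partition the space; closure
  finiteness; the weak topology. The number of cells is arbitrary, and the empty space is
  a CW-complex.
\<close>
definition CW_structure ::
    "'k topology \<Rightarrow> (nat \<times> ((nat \<Rightarrow> real) \<Rightarrow> 'k)) set \<Rightarrow> bool"
  where "CW_structure K E \<longleftrightarrow>
    Hausdorff_space K \<and>
    (\<forall>(n, \<phi>) \<in> E.
       continuous_map (subtopology (Euclidean_space n) (unit_disk n)) K \<phi> \<and>
       homeomorphic_map (subtopology (Euclidean_space n) (open_unit_disk n))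
                        (subtopology K (\<phi> ` open_unit_disk n)) \<phi>) \<and>
    pairwise (\<lambda>(m, \<phi>) (n, \<psi>). disjnt (\<phi> ` open_unit_disk m) (\<psi> ` open_unit_disk n)) E \<and>
    (\<Union>(n, \<phi>) \<in> E. \<phi> ` open_unit_disk n) = topspace K \<and>
    (\<forall>(n, \<phi>) \<in> E. \<exists>F. finite F \<and> F \<subseteq> {(m, \<psi>) \<in> E. m < n} \<and>
       \<phi> ` (unit_disk n - open_unit_disk n) \<subseteq> (\<Union>(m, \<psi>) \<in> F. \<psi> ` open_unit_disk m)) \<and>
    (\<forall>C. C \<subseteq> topspace K \<longrightarrow> (\<forall>(n, \<phi>) \<in> E. closedin K (C \<inter> \<phi> ` unit_disk n)) \<longrightarrow> closedin K C)"

definition CW_complex :: "'k topology \<Rightarrow> bool"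
  where "CW_complex K \<longleftrightarrow> (\<exists>E. CW_structure K E)"


section \<open>Suspension\<close>

text \<open>
  The unreduced suspension: the quotient of \<open>K \<times> I\<close> collapsing \<open>K \<times> {0}\<close> and \<open>K \<times> {1}\<close> to one
  point each. For empty \<open>K\<close> the two poles are kept, so that the suspension is the
  two-point discrete space.
\<close>
datatype 'k suspension = South | North | Level 'k real

definition suspension_proj :: "'k \<times> real \<Rightarrow> 'k suspension"
  where "suspension_proj = (\<lambda>(k, t). if t = 0 then South else if t = 1 then North else Level k t)"

definition suspension_set :: "'k topology \<Rightarrow> 'k suspension set"
  where "suspension_set K =
    {South, North} \<union> {Level k t | k t. k \<in> topspace K \<and> 0 < t \<and> t < 1}"

definition suspension_space :: "'k topology \<Rightarrow> 'k suspension topology"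
  where "suspension_space K = topology (\<lambda>U. U \<subseteq> suspension_set K \<and>
    openin (prod_topology K unit_interval)
      {p \<in> topspace (prod_topology K unit_interval). suspension_proj p \<in> U})"

lemma openin_suspension_space:
  "openin (suspension_space K) U \<longleftrightarrow> U \<subseteq> suspension_set K \<and>
     openin (prod_topology K unit_interval)
       {p \<in> topspace (prod_topology K unit_interval). suspension_proj p \<in> U}"
proof -
  let ?P = "prod_topology K unit_interval"
  let ?pre = "\<lambda>U. {p \<in> topspace ?P. suspension_proj p \<in> U}"
  have "istopology (\<lambda>U. U \<subseteq> suspension_set K \<and> openin ?P (?pre U))"
    unfolding istopology_def
  proof (intro conjI allI impI)
    fix S T
    assume "S \<subseteq> suspension_set K \<and> openin ?P (?pre S)" "T \<subseteq> suspension_set K \<and> openin ?P (?pre T)"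
    moreover have "?pre (S \<inter> T) = ?pre S \<inter> ?pre T" by auto
    ultimately show "S \<inter> T \<subseteq> suspension_set K" "openin ?P (?pre (S \<inter> T))"
      by (auto simp del: topspace_prod_topology)
  next
    fix \<K>
    assume *: "\<forall>S\<in>\<K>. S \<subseteq> suspension_set K \<and> openin ?P (?pre S)"
    then show "\<Union>\<K> \<subseteq> suspension_set K" by auto
    have "?pre (\<Union>\<K>) = (\<Union>S\<in>\<K>. ?pre S)" by auto
    with * show "openin ?P (?pre (\<Union>\<K>))"
      by (simp del: topspace_prod_topology) blast
  qed
  then show ?thesis
    by (simp add: suspension_space_def topology_inverse')
qed

lemma topspace_suspension_space [simp]: "topspace (suspension_space K) = suspension_set K"
proof -
  have "{p \<in> topspace (prod_topology K unit_interval). suspension_proj p \<in> suspension_set K}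
      = topspace (prod_topology K unit_interval)"
    by (auto simp: suspension_proj_def suspension_set_def order_less_le split: if_splits)
  then have "openin (suspension_space K) (suspension_set K)"
    unfolding openin_suspension_space by (metis openin_topspace order_refl)
  then show ?thesis
    by (meson openin_suspension_space openin_subset openin_topspace subset_antisym)
qed

lemma quotient_map_suspension_proj:
  assumes "topspace K \<noteq> {}"
  shows "quotient_map (prod_topology K unit_interval) (suspension_space K) suspension_proj"
proof -
  obtain k where "k \<in> topspace K" using assms by blast
  then have "South \<in> suspension_proj ` (topspace K \<times> {0..1})"
    by (intro image_eqI[of _ _ "(k, 0)"]) (auto simp: suspension_proj_def)
  moreover have "North \<in> suspension_proj ` (topspace K \<times> {0..1})"
    using \<open>k \<in> topspace K\<close>
    by (intro image_eqI[of _ _ "(k, 1)"]) (auto simp: suspension_proj_def)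
  moreover have "Level k t \<in> suspension_proj ` (topspace K \<times> {0..1})"
    if "k \<in> topspace K" "0 < t" "t < 1" for k t
    using that by (intro image_eqI[of _ _ "(k, t)"]) (auto simp: suspension_proj_def)
  ultimately have "suspension_set K \<subseteq> suspension_proj ` (topspace K \<times> {0..1})"
    unfolding suspension_set_def by blast
  moreover have "suspension_proj ` (topspace K \<times> {0..1}) \<subseteq> suspension_set K"
    by (auto simp: suspension_set_def suspension_proj_def order_less_le)
  ultimately have "suspension_proj ` (topspace K \<times> {0..1}) = suspension_set K"
    by (rule subset_antisym[rotated])
  then show ?thesis
    unfolding quotient_map_def by (auto simp: openin_suspension_space)
qed


section \<open>Covering dimension\<close>

text \<open>
  On normal spaces, in particular on metrizable ones, covering dimension is defined by finite
  open covers. The empty space has dimension \<open>-1\<close>, and \<open>\<infinity>\<close> is the infimum of the empty set.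
\<close>
definition covering_dim_le :: "'a topology \<Rightarrow> int \<Rightarrow> bool"
  where "covering_dim_le X n \<longleftrightarrow> -1 \<le> n \<and>
    (\<forall>\<U>. finite \<U> \<and> (\<forall>U\<in>\<U>. openin X U) \<and> \<Union>\<U> = topspace X \<longrightarrow>
      (\<exists>\<V>. finite \<V> \<and> (\<forall>V\<in>\<V>. openin X V) \<and> \<Union>\<V> = topspace X \<and>
        (\<forall>V\<in>\<V>. \<exists>U\<in>\<U>. V \<subseteq> U) \<and>
        (\<forall>x\<in>topspace X. int (card {V\<in>\<V>. x \<in> V}) \<le> n + 1)))"

definition covering_dim :: "'a topology \<Rightarrow> ereal"
  where "covering_dim X = (INF n\<in>{n. covering_dim_le X n}. ereal (of_int n))"

lemma covering_dim_le_iff: "covering_dim X \<le> ereal (of_int n) \<longleftrightarrow> (\<exists>m\<le>n. covering_dim_le X m)"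
proof
  assume "covering_dim X \<le> ereal (of_int n)"
  then have "covering_dim X < ereal (of_int (n + 1))"
    by (rule order_le_less_trans) simp
  then show "\<exists>m\<le>n. covering_dim_le X m"
    unfolding covering_dim_def INF_less_iff by (auto simp del: of_int_add)
next
  assume "\<exists>m\<le>n. covering_dim_le X m"
  then show "covering_dim X \<le> ereal (of_int n)"
    unfolding covering_dim_def by (auto intro: INF_lower2)
qed

definition dim_map :: "'a topology \<Rightarrow> 'b topology \<Rightarrow> ('a \<Rightarrow> 'b) \<Rightarrow> ereal"
  where "dim_map Z W h = (SUP w\<in>topspace W. covering_dim (fiber Z h w))"

definition zero_dimensional_map :: "'a topology \<Rightarrow> 'b topology \<Rightarrow> ('a \<Rightarrow> 'b) \<Rightarrow> bool"
  where "zero_dimensional_map Z W h \<longleftrightarrow> continuous_map Z W h \<and> dim_map Z W h \<le> 0"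


section \<open>Extensional dimension\<close>

definition e_dim_le :: "'a topology \<Rightarrow> 'k topology \<Rightarrow> bool"
  where "e_dim_le Z K \<longleftrightarrow>
    (\<forall>C f. closedin Z C \<and> continuous_map (subtopology Z C) K f \<longrightarrow>
      (\<exists>g. continuous_map Z K g \<and> (\<forall>z\<in>C. g z = f z)))"

definition e_dim_map_le :: "'a topology \<Rightarrow> 'b topology \<Rightarrow> ('a \<Rightarrow> 'b) \<Rightarrow> 'k topology \<Rightarrow> bool"
  where "e_dim_map_le Z W h K \<longleftrightarrow> (\<forall>w\<in>topspace W. e_dim_le (fiber Z h w) K)"


section \<open>Sigma-compactness and Baire category\<close>

definition sigma_compact_in :: "'a topology \<Rightarrow> 'a set \<Rightarrow> bool"
  where "sigma_compact_in X A \<longleftrightarrow> (\<exists>\<C>. countable \<C> \<and> (\<forall>C\<in>\<C>. compactin X C) \<and> A = \<Union>\<C>)"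

definition nowhere_dense_in :: "'a topology \<Rightarrow> 'a set \<Rightarrow> bool"
  where "nowhere_dense_in X S \<longleftrightarrow> S \<subseteq> topspace X \<and> X interior_of (X closure_of S) = {}"

definition first_category_in :: "'a topology \<Rightarrow> 'a set \<Rightarrow> bool"
  where "first_category_in X S \<longleftrightarrow> (\<exists>\<N>. countable \<N> \<and> (\<forall>N\<in>\<N>. nowhere_dense_in X N) \<and> S = \<Union>\<N>)"

text \<open>
  \<open>C(Z, I)\<close> with the supremum metric. Its elements are extensional functions, i.e. they are
  \<open>undefined\<close> outside the topological space \<open>Z\<close>.
\<close>
definition maps_to_interval :: "'a topology \<Rightarrow> ('a \<Rightarrow> real) metric"
  where "maps_to_interval Z = cfunspace Z (submetric euclidean_metric {0..1})"

definition almost_every_map :: "'a topology \<Rightarrow> (('a \<Rightarrow> real) \<Rightarrow> bool) \<Rightarrow> bool"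
  where "almost_every_map Z P \<longleftrightarrow>
    first_category_in (mtopology_of (maps_to_interval Z)) {g \<in> mspace (maps_to_interval Z). \<not> P g}"


section \<open>The map on the product with the interval and the properties of the theorem\<close>

definition star_space :: "'a topology \<Rightarrow> ('a \<times> real) topology"
  where "star_space X = prod_topology X unit_interval"

definition star_map :: "('a \<Rightarrow> 'b) \<Rightarrow> 'a \<times> real \<Rightarrow> 'b"
  where "star_map f = (\<lambda>(x, t). f x)"

definition prop0 :: "'a topology \<Rightarrow> 'b topology \<Rightarrow> ('a \<Rightarrow> 'b) \<Rightarrow> 'k topology \<Rightarrow> bool"
  where "prop0 X Y f K \<longleftrightarrow> e_dim_map_le X Y f K"

definition prop1 :: "'a topology \<Rightarrow> 'b topology \<Rightarrow> ('a \<Rightarrow> 'b) \<Rightarrow> 'k topology \<Rightarrow> bool"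
  where "prop1 X Y f K \<longleftrightarrow> e_dim_map_le (star_space X) Y (star_map f) (suspension_space K)"

definition prop2_set ::
    "'a topology \<Rightarrow> 'b topology \<Rightarrow> ('a \<Rightarrow> 'b) \<Rightarrow> 'k topology \<Rightarrow> ('a \<times> real) set \<Rightarrow> bool"
  where "prop2_set X Y f K A \<longleftrightarrow>
    sigma_compact_in (star_space X) A \<and>
    e_dim_le (subtopology (star_space X) A) K \<and>
    dim_map (subtopology (star_space X) (topspace (star_space X) - A)) Y (star_map f) \<le> 0"

definition prop2 :: "'a topology \<Rightarrow> 'b topology \<Rightarrow> ('a \<Rightarrow> 'b) \<Rightarrow> 'k topology \<Rightarrow> bool"
  where "prop2 X Y f K \<longleftrightarrow> (\<exists>A. prop2_set X Y f K A)"

definition prop2' :: "'a topology \<Rightarrow> 'b topology \<Rightarrow> ('a \<Rightarrow> 'b) \<Rightarrow> 'k topology \<Rightarrow> bool"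
  where "prop2' X Y f K \<longleftrightarrow>
    (\<exists>A. prop2_set X Y f K A \<and>
      (\<exists>B :: nat \<Rightarrow> ('a \<times> real) set.
        A = (\<Union>i. B i) \<and>
        (\<forall>i. compactin (star_space X) (B i) \<and>
          (\<forall>C \<in> connected_components_of (subtopology (star_space X) (B i)).
            \<exists>y \<in> topspace Y. \<exists>h.
              zero_dimensional_map (subtopology (star_space X) C) (fiber X f y) h))))"

definition prop3 :: "'a topology \<Rightarrow> 'b topology \<Rightarrow> ('a \<Rightarrow> 'b) \<Rightarrow> 'k topology \<Rightarrow> bool"
  where "prop3 X Y f K \<longleftrightarrow>
    almost_every_map (star_space X)
      (\<lambda>g. e_dim_map_le (star_space X) (prod_topology Y unit_interval) (\<lambda>z. (star_map f z, g z)) K)"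

end

theory Submission
  imports Defs
begin

text \<open>
  \<^item> Maps into a CW-complex. A finite complex is a neighbourhood extensor for metrizable spaces;
  this is proved cell by cell (\<open>nbhd_extensor_attach_cell\<close>). A map from a metrizable space into an
  arbitrary CW-complex sends a neighbourhood of every compact set into a finite subcomplex, so a
  map on a closed set \<open>D\<close> extends over a neighbourhood of any compact subset of \<open>D\<close>
  (\<open>extend_near_compact\<close>). This gives the countable sum theorem for \<open>e_dim_le\<close> and the theorem on
  compacta with a map to a compact subset of the line without interior
  (\<open>e_dim_le_countable_union\<close>, \<open>e_dim_le_map_to_line\<close>).

  \<^item> From \<open>prop0\<close> to \<open>prop3\<close>. For almost every \<open>g\<close> on \<open>X \<times> I\<close>, no restriction of \<open>g\<close> to an interval
  \<open>{x} \<times> [a, b]\<close> is constant. For such a \<open>g\<close> a fiber of \<open>(f\<^sub>*, g)\<close> is a compact set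
  \<open>Z \<subseteq> F \<times> I\<close>, where \<open>F\<close> is a fiber of \<open>f\<close>, whose vertical sections have no interior. A section
  without interior can be cut into short pieces, uniformly near each point of \<open>F\<close>, so the identity
  of \<open>Z\<close> is approximated by maps that move points vertically and take values in finitely many
  graphs of functions on \<open>F\<close>. Finite unions of such graphs have extensional dimension at most \<open>K\<close>,
  hence so has \<open>Z\<close> (\<open>e_dim_le_light_over\<close>).

  \<^item> From \<open>prop3\<close> to \<open>prop2'\<close>. There is a compact set \<open>B \<subseteq> Y \<times> I\<close> that meets every \<open>{y} \<times> [1/3, 2/3]\<close> and
  projects injectively to a Cantor set in \<open>I\<close>: code points of \<open>Y\<close> by binary sequences
  (\<open>cantor_relation\<close>). For a generic \<open>g\<close> the preimage of \<open>B\<close> under \<open>(f\<^sub>*, g)\<close> is mapped by \<open>g\<close> into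
  the Cantor set with fibers that are fibers of \<open>(f\<^sub>*, g)\<close>. So its extensional dimension is at most
  \<open>K\<close>, and its components lie in single fibers of \<open>(f\<^sub>*, g)\<close> and project lightly to fibers of \<open>f\<close>.
  The set \<open>A\<close> is the union of these preimages for countably many \<open>g\<close> that separate points from
  closed sets. Off \<open>A\<close> and over a fixed \<open>y\<close>, no \<open>g\<close> takes the values \<open>t\<close> with \<open>(y, t) \<in> B\<close>, so the
  sets \<open>{g < t}\<close> are open and closed and form a base.

  \<^item> From \<open>prop2\<close> to \<open>prop1\<close>. In a fiber of \<open>f\<^sub>*\<close>, two disjoint closed sets are separated by a partition that
  misses the zero-dimensional complement of \<open>A\<close>, hence is a compact subset of \<open>A\<close>. A map into the
  suspension is extended first to the partition at middle levels and then to both sides, which map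
  into open cones (\<open>e_dim_le_suspension\<close>).
\<close>

section \<open>Pasting maps and maps into disks\<close>

lemma continuous_map_subtopology_local:
  assumes "S \<subseteq> topspace Z"
    and "\<And>z. z \<in> S \<Longrightarrow> f z \<in> topspace K"
    and "\<And>z W. \<lbrakk>z \<in> S; openin K W; f z \<in> W\<rbrakk> \<Longrightarrow> \<exists>N. openin Z N \<and> z \<in> N \<and> f ` (N \<inter> S) \<subseteq> W"
  shows "continuous_map (subtopology Z S) K f"
  unfolding continuous_map_def
proof (intro conjI allI impI)
  show "f \<in> topspace (subtopology Z S) \<rightarrow> topspace K" using assms by auto
next
  fix W assume W: "openin K W"
  show "openin (subtopology Z S) {x \<in> topspace (subtopology Z S). f x \<in> W}"
  proof (subst openin_subopen, intro ballI)
    fix z assume z: "z \<in> {x \<in> topspace (subtopology Z S). f x \<in> W}"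
    with assms(3)[of z W] W obtain N where N: "openin Z N" "z \<in> N" "f ` (N \<inter> S) \<subseteq> W" by auto
    then show "\<exists>T. openin (subtopology Z S) T \<and> z \<in> T \<and> T \<subseteq> {x \<in> topspace (subtopology Z S). f x \<in> W}"
      using z assms(1) by (intro exI[of _ "N \<inter> S"]) (auto simp: openin_subtopology_Int)
  qed
qed

lemma continuous_map_subtopology_localD:
  assumes "continuous_map (subtopology Z S) K f" "z \<in> S" "z \<in> topspace Z" "openin K W" "f z \<in> W"
  obtains N where "openin Z N" "z \<in> N" "f ` (N \<inter> S) \<subseteq> W"
proof -
  have "openin (subtopology Z S) {x \<in> topspace (subtopology Z S). f x \<in> W}"
    using assms(1,4) by (rule openin_continuous_map_preimage)
  then obtain N where "openin Z N" "{x \<in> topspace (subtopology Z S). f x \<in> W} = N \<inter> S"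
    by (auto simp: openin_subtopology)
  then show thesis using that[of N] assms openin_subset by fastforce
qed

lemma continuous_map_paste_closed:
  assumes "closedin X S" "closedin X T"
    and "continuous_map (subtopology X S) Y f" "continuous_map (subtopology X T) Y g"
    and "\<And>x. x \<in> S \<Longrightarrow> x \<in> T \<Longrightarrow> f x = g x"
  shows "continuous_map (subtopology X (S \<union> T)) Y (\<lambda>x. if x \<in> S then f x else g x)"
proof -
  have sub: "S \<subseteq> topspace X" "T \<subseteq> topspace X" using assms closedin_subset by auto
  show ?thesis
  proof (rule pasting_lemma_closed[where I="{True,False}" and T="\<lambda>b. if b then S else T" and f="\<lambda>b. if b then f else g"])
    show "closedin (subtopology X (S \<union> T)) (if i then S else T)" for i
      using assms(1,2) by (auto intro!: closedin_subset_topspace)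
    show "continuous_map (subtopology (subtopology X (S \<union> T)) (if i then S else T)) Y (if i then f else g)" for i
      using assms(3,4) by (auto simp: subtopology_subtopology Int_absorb1)
  qed (use assms(5) in \<open>auto split: if_splits\<close>)
qed

text \<open>
  Absolute neighbourhood extensors for metrizable spaces. A formula cannot quantify over types, so
  the carrier type of the spaces is a parameter.
\<close>
definition nbhd_extensor :: "'z itself \<Rightarrow> 'k topology \<Rightarrow> bool" where
  "nbhd_extensor (_ :: 'z itself) K \<longleftrightarrow>
    (\<forall>(Z :: 'z topology) D f. metrizable_space Z \<and> closedin Z D \<and> continuous_map (subtopology Z D) K f \<longrightarrow>
      (\<exists>U g. openin Z U \<and> D \<subseteq> U \<and> continuous_map (subtopology Z U) K g \<and> (\<forall>z\<in>D. g z = f z)))"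

definition disk_norm :: "nat \<Rightarrow> (nat \<Rightarrow> real) \<Rightarrow> real" where
  "disk_norm n x = L2_set x {..<n}"

text \<open>
  For \<open>b = 1\<close> this is the identity of the unit disk (and the radial retraction onto it), for
  \<open>b = 0\<close> the radial retraction of the complement of the centre onto the sphere. The parameter
  \<open>b\<close> interpolates, and the only discontinuity is at the centre with \<open>b = 0\<close>.
\<close>
definition push_out :: "nat \<Rightarrow> (nat \<Rightarrow> real) \<Rightarrow> real \<Rightarrow> nat \<Rightarrow> real" where
  "push_out n x b = (\<lambda>i. x i / max (disk_norm n x) b)"

lemma disk_norm_nonneg [simp]: "0 \<le> disk_norm n x"
  by (simp add: disk_norm_def L2_set_nonneg)

lemma unit_disk_alt: "unit_disk n = {x. (\<forall>i\<ge>n. x i = 0) \<and> disk_norm n x \<le> 1}"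
  by (auto simp: unit_disk_def topspace_Euclidean_space disk_norm_def L2_set_def)

lemma open_unit_disk_alt: "open_unit_disk n = {x. (\<forall>i\<ge>n. x i = 0) \<and> disk_norm n x < 1}"
  by (auto simp: open_unit_disk_def topspace_Euclidean_space disk_norm_def L2_set_def)

lemma open_unit_disk_subset: "open_unit_disk n \<subseteq> unit_disk n"
  by (auto simp: unit_disk_alt open_unit_disk_alt)

lemma subtopology_Euclidean_space_eq:
  assumes "S \<subseteq> topspace (Euclidean_space n)"
  shows "subtopology (Euclidean_space n) S = top_of_set S"
  using assms unfolding Euclidean_space_def
  by (simp add: euclidean_product_topology subtopology_subtopology Int_absorb1 Euclidean_space_def)

lemma subtopology_unit_disk [simp]: "subtopology (Euclidean_space n) (unit_disk n) = top_of_set (unit_disk n)"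
  by (rule subtopology_Euclidean_space_eq) (auto simp: unit_disk_def)

lemma subtopology_open_unit_disk [simp]:
  "subtopology (Euclidean_space n) (open_unit_disk n) = top_of_set (open_unit_disk n)"
  by (rule subtopology_Euclidean_space_eq) (auto simp: open_unit_disk_def)

lemma continuous_on_coordinate: "continuous_on S (\<lambda>x::nat \<Rightarrow> real. x i)"
  by (rule continuous_on_product_then_coordinatewise) (rule continuous_on_id)

lemma continuous_on_disk_norm [continuous_intros]:
  assumes "continuous_on S f" shows "continuous_on S (\<lambda>x. disk_norm n (f x))"
proof -
  have "continuous_on S (\<lambda>x. f x i)" for i
    using assms by (rule continuous_on_product_then_coordinatewise)
  then show ?thesis
    unfolding disk_norm_def L2_set_def by (intro continuous_intros)
qed

lemma disk_norm_scale: "disk_norm n (\<lambda>i. x i / c) = disk_norm n x / \<bar>c\<bar>"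
proof -
  have "(\<Sum>i<n. (x i / c)\<^sup>2) = (\<Sum>i<n. (x i)\<^sup>2) / c\<^sup>2"
    unfolding power_divide by (rule sum_divide_distrib[symmetric])
  then show ?thesis
    unfolding disk_norm_def L2_set_def by (simp only: real_sqrt_divide real_sqrt_abs)
qed

lemma compact_unit_disk: "compact (unit_disk n)"
proof -
  have "compactin (product_topology (\<lambda>_. euclidean) UNIV) (PiE UNIV (\<lambda>i. {-1..1::real}))"
    by (subst compactin_PiE) auto
  then have "compact (PiE UNIV (\<lambda>i::nat. {-1..1::real}))"
    by (simp add: euclidean_product_topology)
  moreover have "closed (unit_disk n)"
  proof -
    have "unit_disk n = (\<Inter>i\<in>{n..}. {x. x i = 0}) \<inter> {x. disk_norm n x \<le> 1}"
      by (auto simp: unit_disk_alt)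
    moreover have "closed {x::nat \<Rightarrow> real. x i = 0}" for i
      by (intro closed_Collect_eq continuous_on_coordinate continuous_intros)
    moreover have "closed {x. disk_norm n x \<le> 1}"
      by (intro closed_Collect_le continuous_intros)
    ultimately show ?thesis by (auto intro!: closed_Int closed_INT)
  qed
  moreover have "unit_disk n \<subseteq> PiE UNIV (\<lambda>i::nat. {-1..1::real})"
  proof
    fix x assume x: "x \<in> unit_disk n"
    have "\<bar>x i\<bar> \<le> 1" for i
    proof (cases "i < n")
      case True
      then have "\<bar>x i\<bar> \<le> L2_set (\<lambda>i. \<bar>x i\<bar>) {..<n}" by (intro member_le_L2_set) auto
      also have "\<dots> = disk_norm n x" by (simp add: disk_norm_def L2_set_def)
      finally show ?thesis using x by (auto simp: unit_disk_alt)
    qed (use x in \<open>auto simp: unit_disk_alt\<close>)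
    then show "x \<in> PiE UNIV (\<lambda>i::nat. {-1..1::real})" by (force simp: abs_le_iff)
  qed
  ultimately show ?thesis by (metis compact_Int_closed inf.absorb_iff2)
qed

lemma continuous_on_push_out:
  "continuous_on {(x, b). 0 < max (disk_norm n x) b} (\<lambda>(x, b). push_out n x b)"
proof -
  have "continuous_on {p. 0 < max (disk_norm n (fst p)) (snd p)} (\<lambda>p. push_out n (fst p) (snd p))"
    unfolding push_out_def
  proof (rule continuous_on_coordinatewise_then_product)
    fix i
    let ?S = "{p. 0 < max (disk_norm n (fst p)) (snd p)}"
    have "continuous_on ?S (\<lambda>p. fst p i)"
      by (rule continuous_on_product_then_coordinatewise[OF continuous_on_fst]) (rule continuous_on_id)
    then show "continuous_on ?S (\<lambda>p. fst p i / max (disk_norm n (fst p)) (snd p))"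
      by (intro continuous_on_divide continuous_on_max continuous_on_disk_norm
          continuous_on_fst continuous_on_snd continuous_on_id) auto
  qed
  then show ?thesis by (simp add: case_prod_unfold)
qed

lemma disk_norm_push_out:
  assumes "0 < max (disk_norm n x) b"
  shows "disk_norm n (push_out n x b) = disk_norm n x / max (disk_norm n x) b"
  unfolding push_out_def disk_norm_scale using assms by (simp only: abs_of_pos)

lemma push_out_in_unit_disk:
  assumes "\<And>i. n \<le> i \<Longrightarrow> x i = 0" "0 < max (disk_norm n x) b"
  shows "push_out n x b \<in> unit_disk n"
proof -
  have "disk_norm n (push_out n x b) \<le> 1"
    using assms(2) by (simp add: disk_norm_push_out)
  then show ?thesis using assms(1) by (simp add: unit_disk_alt push_out_def)
qed

lemma push_out_one:
  assumes "x \<in> unit_disk n" shows "push_out n x 1 = x"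
proof -
  have "max (disk_norm n x) 1 = 1" using assms by (simp add: unit_disk_alt max_absorb2)
  then show ?thesis by (simp add: push_out_def)
qed

lemma disk_norm_push_out_zero:
  assumes "0 < disk_norm n x" shows "disk_norm n (push_out n x 0) = 1"
  using assms by (simp add: disk_norm_push_out max_absorb1)

text \<open>
  The Tietze theorem extends the coordinates; \<open>push_out\<close> at \<open>1\<close> brings the result back into the
  disk.
\<close>
lemma unit_disk_extension:
  assumes Z: "normal_space Z" and D: "closedin Z D"
    and x: "continuous_map (subtopology Z D) (top_of_set (unit_disk n)) x"
  obtains y where "continuous_map Z (top_of_set (unit_disk n)) y" "\<And>z. z \<in> D \<Longrightarrow> y z = x z"
proof -
  have xd: "x z \<in> unit_disk n" if "z \<in> D" for z
    using x that closedin_subset[OF D] by (auto simp: continuous_map_in_subtopology)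
  have "\<exists>g. continuous_map Z euclideanreal g \<and> (\<forall>z\<in>D. g z = x z i)" for i
  proof -
    have "continuous_map (subtopology Z D) (product_topology (\<lambda>_. euclidean) UNIV) x"
      using x by (simp add: continuous_map_in_subtopology euclidean_product_topology)
    then have "continuous_map (subtopology Z D) euclideanreal (\<lambda>z. x z i)"
      by (simp add: continuous_map_componentwise_UNIV)
    from Tietze_extension_realinterval[OF Z D _ _ this, of UNIV] show ?thesis
      by (metis empty_not_UNIV is_interval_univ subset_UNIV)
  qed
  then obtain g where g: "\<And>i. continuous_map Z euclideanreal (g i)" "\<And>i z. z \<in> D \<Longrightarrow> g i z = x z i"
    by metis
  define h where "h z = (\<lambda>i. if i < n then g i z else 0)" for z
  have "continuous_map Z (product_topology (\<lambda>_. euclidean) UNIV) h"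
    unfolding continuous_map_componentwise_UNIV h_def using g(1) by auto
  then have h: "continuous_map Z euclidean h" by (simp add: euclidean_product_topology)
  define y where "y = (\<lambda>z. push_out n (h z) 1)"
  have "continuous_on UNIV (\<lambda>x. push_out n x 1)"
  proof -
    have "continuous_on UNIV (\<lambda>x::nat \<Rightarrow> real. (x, 1::real))"
      by (intro continuous_on_Pair continuous_on_id continuous_on_const)
    moreover have "range (\<lambda>x. (x, 1)) \<subseteq> {(x, b). 0 < max (disk_norm n x) b}"
      by (auto simp: less_max_iff_disj)
    ultimately show ?thesis
      using continuous_on_compose2[OF continuous_on_push_out[of n], of UNIV "\<lambda>x. (x,1)"] by simp
  qed
  with h have "continuous_map Z euclidean y"
    unfolding y_def using continuous_map_compose[OF h, of euclidean "\<lambda>x. push_out n x 1"]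
    by (auto simp: o_def continuous_map_iff_continuous)
  moreover have "y z \<in> unit_disk n" for z
    unfolding y_def by (rule push_out_in_unit_disk) (auto simp: h_def less_max_iff_disj)
  moreover have "y z = x z" if "z \<in> D" for z
  proof -
    have "h z = x z" using that xd[OF that] g(2)[OF that] by (auto simp: h_def unit_disk_alt)
    then show ?thesis using push_out_one[OF xd[OF that]] by (simp add: y_def)
  qed
  ultimately show thesis using that[of y] by (auto simp: continuous_map_in_subtopology)
qed

text \<open>
  The function \<open>s\<close> is the distance to \<open>T\<close> measured in the graph of \<open>x\<close>. It is \<open>1\<close>-Lipschitz for the
  metric \<open>d z w + dist (x z) (x w)\<close>, which induces the topology because \<open>x\<close> is continuous. For
  constant \<open>x\<close> it is the ordinary distance to a set.
\<close>
lemma (in Metric_space) graph_distance: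
  fixes x :: "'a \<Rightarrow> 'm::metric_space"
  assumes S: "S \<subseteq> M" and T: "T \<subseteq> S" "T \<noteq> {}" and x: "continuous_map (subtopology mtopology S) euclidean x"
  obtains s where "continuous_map (subtopology mtopology S) euclideanreal s" "\<And>z. z \<in> S \<Longrightarrow> 0 \<le> s z"
    "\<And>z c. z \<in> S \<Longrightarrow> s z < c \<Longrightarrow> \<exists>p\<in>T. d z p + dist (x z) (x p) < c"
    "\<And>z p. z \<in> S \<Longrightarrow> p \<in> T \<Longrightarrow> s z \<le> d z p + dist (x z) (x p)"
proof -
  define s where "s z = Inf ((\<lambda>p. d z p + dist (x z) (x p)) ` T)" for z
  have bdd: "bdd_below ((\<lambda>p. d z p + dist (x z) (x p)) ` T)" for z
    by (rule bdd_belowI2[of _ 0]) auto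
  have le: "s z \<le> d z p + dist (x z) (x p)" if "p \<in> T" for z p
    unfolding s_def using that by (intro cInf_lower bdd) auto
  have ex: "\<exists>p\<in>T. d z p + dist (x z) (x p) < c" if "s z < c" for z c
    using that T bdd unfolding s_def by (subst (asm) cInf_less_iff) auto
  have nn: "0 \<le> s z" for z
    unfolding s_def using T by (intro cInf_greatest) auto
  have lip: "s z \<le> s w + (d z w + dist (x z) (x w))" if "z \<in> S" "w \<in> S" for z w
  proof (rule field_le_epsilon)
    fix e :: real assume "e > 0"
    then obtain p where p: "p \<in> T" "d w p + dist (x w) (x p) < s w + e" using ex[of w "s w + e"] by auto
    have "d z p \<le> d z w + d w p" using that p S T by (intro triangle) auto
    moreover have "dist (x z) (x p) \<le> dist (x z) (x w) + dist (x w) (x p)" by (rule dist_triangle)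
    ultimately show "s z \<le> s w + (d z w + dist (x z) (x w)) + e" using le[OF p(1), of z] p(2) by linarith
  qed
  have "continuous_map (subtopology mtopology S) euclideanreal s"
  proof (rule continuous_map_subtopology_local)
    show "S \<subseteq> topspace mtopology" using S by simp
    fix z W assume z: "z \<in> S" and W: "openin euclideanreal W" "s z \<in> W"
    then obtain e where e: "e > 0" "ball (s z) e \<subseteq> W" by (auto simp: open_contains_ball)
    obtain N where N: "openin mtopology N" "z \<in> N" "x ` (N \<inter> S) \<subseteq> ball (x z) (e/2)"
      using continuous_map_subtopology_localD[OF x z, of "ball (x z) (e/2)"] z S e by auto
    show "\<exists>N. openin mtopology N \<and> z \<in> N \<and> s ` (N \<inter> S) \<subseteq> W"
    proof (intro exI conjI)
      show "openin mtopology (N \<inter> mball z (e/2))" using N by auto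
      show "z \<in> N \<inter> mball z (e/2)" using N e z S by auto
      have "s w \<in> W" if "w \<in> N" "w \<in> mball z (e/2)" "w \<in> S" for w
      proof -
        have "dist (x z) (x w) < e/2" "d z w < e/2" using that N by auto
        then have "\<bar>s z - s w\<bar> < e" using lip[OF z that(3)] lip[OF that(3) z]
          by (simp add: commute dist_commute abs_if)
        then show ?thesis using e by (auto simp: dist_real_def)
      qed
      then show "s ` (N \<inter> mball z (e/2) \<inter> S) \<subseteq> W" by blast
    qed
  qed auto
  then show thesis using that[of s] nn le ex by blast
qed

section \<open>Attaching a cell to a neighbourhood extensor\<close>

lemma push_out_unit_disk:
  assumes "x \<in> unit_disk n" "0 < max (disk_norm n x) b"
  shows "push_out n x b \<in> unit_disk n"
  using assms by (intro push_out_in_unit_disk) (auto simp: unit_disk_alt)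

text \<open>
  If \<open>\<phi> x\<close> is close to \<open>k\<close>, then \<open>x\<close> is close to the compact fiber of \<open>k\<close>, which lies in the
  sphere since \<open>k\<close> is not in the open cell. Pushing a point of the sphere outwards does not move it,
  so points near the fiber are sent close to \<open>k\<close> even after a push, uniformly in the parameter.
\<close>
lemma push_out_near_boundary:
  fixes \<phi> :: "(nat \<Rightarrow> real) \<Rightarrow> 'k"
  assumes K: "Hausdorff_space K"
    and \<phi>: "continuous_map (top_of_set (unit_disk n)) K \<phi>"
    and k: "openin K W" "k \<in> W" "k \<notin> \<phi> ` open_unit_disk n"
  obtains e V where "e > 0" "openin K V" "k \<in> V"
    "\<And>x v b. \<lbrakk>x \<in> unit_disk n; \<phi> x \<in> V; v \<in> unit_disk n; dist x v < e; 0 \<le> b; b \<le> 1\<rbrakk>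
       \<Longrightarrow> disk_norm n v > 1/2 \<and> \<phi> (push_out n v b) \<in> W"
proof -
  let ?D = "unit_disk n"
  have ktop: "k \<in> topspace K" using k openin_subset by blast
  define P where "P = {x \<in> ?D. \<phi> x = k}"
  have "closedin (top_of_set ?D) {x \<in> topspace (top_of_set ?D). \<phi> x \<in> {k}}"
    using closedin_continuous_map_preimage[OF \<phi>] closedin_Hausdorff_singleton[OF K] ktop by blast
  then have "closedin (top_of_set ?D) P" by (simp add: P_def)
  then have P: "compact P" using closedin_compact compact_unit_disk by blast
  have P1: "disk_norm n x = 1" if "x \<in> P" for x
    using that k(3) by (force simp: P_def unit_disk_alt open_unit_disk_alt)
  let ?B = "?D \<times> {0..1::real}"
  define S :: "((nat \<Rightarrow> real) \<times> real) set" where "S = {(v, b). v \<in> ?D \<and> b \<in> {0..1} \<and> disk_norm n v > 1/2}"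
  have Spos: "0 < max (disk_norm n v) b" if "(v,b) \<in> S" for v and b :: real
    using that by (auto simp: S_def less_max_iff_disj)
  have "continuous_on S (\<lambda>(v, b). push_out n v b)"
    by (rule continuous_on_subset[OF continuous_on_push_out]) (use Spos in auto)
  moreover have "(\<lambda>(v, b). push_out n v b) ` S \<subseteq> ?D"
  proof clarify
    fix v and b :: real assume "(v, b) \<in> S"
    then show "push_out n v b \<in> ?D" using Spos[of v b] by (intro push_out_unit_disk) (auto simp: S_def)
  qed
  ultimately have "continuous_map (top_of_set S) (top_of_set ?D) (\<lambda>(v, b). push_out n v b)"
    by (auto simp: continuous_map_in_subtopology)
  from continuous_map_compose[OF this \<phi>]
  have c: "continuous_map (top_of_set S) K (\<lambda>(v, b). \<phi> (push_out n v b))"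
    by (simp add: o_def case_prod_unfold)
  define G where "G = {p \<in> S. (\<lambda>(v, b). \<phi> (push_out n v b)) p \<in> W}"
  have "openin (top_of_set S) G"
    using openin_continuous_map_preimage[OF c k(1)] by (simp add: G_def)
  moreover have "openin (top_of_set ?B) S"
  proof -
    have "S = ?B \<inter> {p. 1/2 < disk_norm n (fst p)}" by (auto simp: S_def)
    moreover have "open {p::(nat \<Rightarrow> real) \<times> real. 1/2 < disk_norm n (fst p)}"
      by (intro open_Collect_less continuous_on_disk_norm continuous_on_fst continuous_on_id continuous_on_const)
    ultimately show ?thesis by (auto simp: openin_open)
  qed
  ultimately have "openin (top_of_set ?B) G" using openin_trans by blast
  then have "closedin (top_of_set ?B) (?B - G)" using closedin_diff[OF closedin_topspace, of "top_of_set ?B" G] by simp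
  moreover have "compact ?B" by (intro compact_Times compact_unit_disk) auto
  ultimately have "compact (?B - G)" using closedin_compact by blast
  then have Q: "compact (fst ` (?B - G))" by (intro compact_continuous_image continuous_intros)
  have "P \<inter> fst ` (?B - G) = {}"
  proof -
    have "(p, b) \<in> G" if "p \<in> P" "b \<in> {0..1}" for p b
    proof -
      have "push_out n p b = p" using P1[OF that(1)] that(2) by (simp add: push_out_def max_absorb1)
      then show ?thesis using P1[OF that(1)] that k by (auto simp: G_def S_def P_def)
    qed
    then show ?thesis by fastforce
  qed
  obtain d where d: "d > 0" "\<And>x y. x \<in> P \<Longrightarrow> y \<in> fst ` (?B - G) \<Longrightarrow> d \<le> dist x y"
  proof -
    have disj: "P \<inter> fst ` (?B - G) = {}" by fact
    have o: "open (- fst ` (?B - G))" using compact_imp_closed[OF Q] by (rule open_Compl)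
    obtain d where d: "d > 0" "(\<Union>x\<in>P. ball x d) \<subseteq> - fst ` (?B - G)"
      using compact_subset_open_imp_ball_epsilon_subset[OF P o] disj by (metis disjoint_eq_subset_Compl)
    show thesis
    proof (rule that[of d])
      fix p q assume pq: "p \<in> P" "q \<in> fst ` (?B - G)"
      then have "q \<notin> ball p d" using d(2) by (meson ComplD UN_I subsetD)
      then show "d \<le> dist p q" by simp
    qed (rule d)
  qed
  define T where "T = ?D \<inter> (\<Inter>p\<in>P. {x. d/2 \<le> dist x p})"
  have "closed (\<Inter>p\<in>P. {x. d/2 \<le> dist x p})"
    by (intro closed_INT ballI closed_Collect_le continuous_intros)
  then have T: "compact T" unfolding T_def by (rule compact_Int_closed[OF compact_unit_disk])
  have "compactin (top_of_set ?D) T" using T by (auto simp: compactin_subtopology T_def)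
  then have "compactin K (\<phi> ` T)" using \<phi> by (rule image_compactin)
  then have cl: "closedin K (\<phi> ` T)" by (rule compactin_imp_closedin[OF K])
  show thesis
  proof (rule that[of "d/2" "topspace K - \<phi> ` T"])
    show "0 < d/2" using d by simp
    show "openin K (topspace K - \<phi> ` T)" using cl by (rule openin_diff[OF openin_topspace])
    have "k \<notin> \<phi> ` T"
    proof
      assume "k \<in> \<phi> ` T"
      then obtain x where x: "x \<in> T" "\<phi> x = k" by blast
      then have "x \<in> P" by (auto simp: P_def T_def)
      then have "d/2 \<le> dist x x" using x by (auto simp: T_def)
      then show False using d by simp
    qed
    then show "k \<in> topspace K - \<phi> ` T" using ktop by blast
    fix x v and b :: real
    assume *: "x \<in> ?D" "\<phi> x \<in> topspace K - \<phi> ` T" "v \<in> ?D" "dist x v < d/2" "0 \<le> b" "b \<le> 1"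
    then have "x \<notin> T" by blast
    then obtain p where p: "p \<in> P" "dist x p < d/2" using * by (auto simp: T_def not_le)
    then have "dist p v < d" using * by (metis dist_commute dist_triangle_half_l)
    then have "v \<notin> fst ` (?B - G)" using d(2)[OF p(1)] by force
    then have "(v,b) \<in> G" using * by force
    then show "disk_norm n v > 1/2 \<and> \<phi> (push_out n v b) \<in> W" by (auto simp: G_def S_def)
  qed
qed

lemma continuous_map_to_subtopologyI:
  "continuous_map X K f \<Longrightarrow> f ` topspace X \<subseteq> S \<Longrightarrow> continuous_map X (subtopology K S) f"
  by (auto simp: continuous_map_in_subtopology)

text \<open>
  Let \<open>D0\<close> be the part of \<open>D\<close> that is sent to \<open>K0\<close>. On the rest of \<open>D\<close> the map is \<open>\<phi> \<circ> y\<close> for a map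
  \<open>y\<close> into the disk, which extends to the complement of \<open>D0\<close>; but near \<open>D0\<close> this extension is
  uncontrolled. The function \<open>\<tau>\<close> measures the distance to the graph of \<open>y\<close> over \<open>D - D0\<close>, relative to
  the distance to \<open>D0\<close>. Where \<open>\<tau> z \<le> 1\<close>, some point of \<open>D - D0\<close> is close to \<open>z\<close> and has almost the
  same value of \<open>y\<close>, with an error that tends to \<open>0\<close> towards \<open>D0\<close>; there \<open>\<phi> \<circ> y\<close> is controlled by
  the given map.
\<close>
lemma cell_collar:
  fixes \<phi> :: "(nat \<Rightarrow> real) \<Rightarrow> 'k" and Z :: "'z topology"
  assumes K: "Hausdorff_space K"
    and \<phi>: "continuous_map (top_of_set (unit_disk n)) K \<phi>"
    and hom: "homeomorphic_map (top_of_set (open_unit_disk n)) (subtopology K (\<phi> ` open_unit_disk n)) \<phi>"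
    and K0: "closedin K K0" "K0 \<inter> \<phi> ` open_unit_disk n = {}"
    and Zm: "metrizable_space Z" and D: "closedin Z D" and f: "continuous_map (subtopology Z D) K f"
    and fim: "\<And>z. z \<in> D \<Longrightarrow> f z \<in> K0 \<union> \<phi> ` open_unit_disk n"
    and D0_eq: "D0 = {z \<in> D. f z \<in> K0}" and ne: "D0 \<noteq> D"
  obtains y \<tau> where
    "continuous_map (subtopology Z (topspace Z - D0)) (top_of_set (unit_disk n)) y"
    "continuous_map (subtopology Z (topspace Z - D0)) euclideanreal \<tau>"
    "\<And>z. z \<in> topspace Z - D0 \<Longrightarrow> 0 \<le> \<tau> z"
    "\<And>z. z \<in> D - D0 \<Longrightarrow> \<tau> z = 0" "\<And>z. z \<in> D - D0 \<Longrightarrow> \<phi> (y z) = f z"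
    "\<And>z0 W. \<lbrakk>z0 \<in> D0; openin K W; f z0 \<in> W\<rbrakk> \<Longrightarrow>
       \<exists>N. openin Z N \<and> z0 \<in> N \<and> (\<forall>z\<in>N - D0. \<tau> z \<le> 1 \<longrightarrow> 1/2 < disk_norm n (y z) \<and>
         (\<forall>b\<in>{0..1}. \<phi> (push_out n (y z) b) \<in> W))"
proof -
  let ?e = "\<phi> ` open_unit_disk n"
  let ?D = "unit_disk n"
  obtain M d where Md: "Metric_space M d" "Z = Metric_space.mtopology M d"
    using Zm by (auto simp: metrizable_space_def)
  interpret Metric_space M d by (rule Md)
  have Z: "Z = mtopology" by (rule Md)
  have topZ: "topspace Z = M" by (simp add: Z)
  have DM: "D \<subseteq> M" using D closedin_subset topZ by blast
  define D1 where "D1 = D - D0"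
  note D0_def = D0_eq
  have D0: "closedin Z D0"
  proof -
    have "closedin (subtopology Z D) {z \<in> topspace (subtopology Z D). f z \<in> K0}"
      by (rule closedin_continuous_map_preimage[OF f K0(1)])
    then have "closedin (subtopology Z D) D0" using DM by (simp add: D0_def topZ Int_absorb1 Collect_conj_eq) 
    then show ?thesis using D closedin_trans_full by blast
  qed
  have neD1: "D1 \<noteq> {}" using ne D0_eq by (auto simp: D1_def)
  let ?R = "M - D0"
  have oR: "openin Z ?R" using D0 topZ by (metis openin_diff openin_topspace)
  have D1R: "D1 \<subseteq> ?R" using DM by (auto simp: D1_def)
  obtain xi where xi: "homeomorphic_maps (top_of_set (open_unit_disk n)) (subtopology K ?e) \<phi> xi"
    using hom by (auto simp: homeomorphic_map_maps)
  have xi1: "continuous_map (subtopology K ?e) (top_of_set (open_unit_disk n)) xi"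
    and xi2: "\<And>k. k \<in> ?e \<Longrightarrow> k \<in> topspace K \<Longrightarrow> \<phi> (xi k) = k"
    using xi by (auto simp: homeomorphic_maps_def)
  have eK: "?e \<subseteq> topspace K"
    using \<phi> open_unit_disk_subset[of n] by (auto simp: continuous_map_def)
  have fe: "f z \<in> ?e" if "z \<in> D1" for z using fim[of z] that by (auto simp: D1_def D0_def)
  have "continuous_map (subtopology Z D1) (subtopology K ?e) f"
    using f DM fe by (intro continuous_map_to_subtopologyI continuous_map_from_subtopology_mono[OF f]) (auto simp: D1_def)
  from continuous_map_compose[OF this xi1]
  have x_open: "continuous_map (subtopology Z D1) (top_of_set (open_unit_disk n)) (\<lambda>z. xi (f z))" by (simp add: o_def)
  have xio: "xi (f z) \<in> open_unit_disk n" if "z \<in> D1" for z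
    using x_open that DM D1R by (auto simp: continuous_map_in_subtopology topZ)
  have "continuous_map (subtopology (subtopology Z ?R) D1) (top_of_set ?D) (\<lambda>z. xi (f z))"
    using x_open open_unit_disk_subset[of n] D1R
    by (auto simp: continuous_map_in_subtopology subtopology_subtopology Int_absorb1)
  moreover have "closedin (subtopology Z ?R) D1"
    using D DM by (auto simp: closedin_subtopology D1_def intro!: exI[of _ D])
  moreover have "normal_space (subtopology Z ?R)"
    using Zm metrizable_imp_normal_space metrizable_space_subtopology by blast
  ultimately obtain y where y: "continuous_map (subtopology Z ?R) (top_of_set ?D) y"
    "\<And>z. z \<in> D1 \<Longrightarrow> y z = xi (f z)" using unit_disk_extension by metis
  have yD: "y z \<in> ?D" if "z \<in> ?R" for z using y(1) that by (auto simp: continuous_map_in_subtopology topZ)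
  have y_eu: "continuous_map (subtopology Z ?R) euclidean y" using y(1) by (simp add: continuous_map_in_subtopology)
  obtain s where s: "continuous_map (subtopology Z ?R) euclideanreal s" "\<And>z. z \<in> ?R \<Longrightarrow> 0 \<le> s z"
    "\<And>z c. z \<in> ?R \<Longrightarrow> s z < c \<Longrightarrow> \<exists>p\<in>D1. d z p + dist (y z) (y p) < c"
    "\<And>z p. z \<in> ?R \<Longrightarrow> p \<in> D1 \<Longrightarrow> s z \<le> d z p + dist (y z) (y p)"
    using graph_distance[of ?R D1 y] D1R neD1 y_eu unfolding Z by auto
  obtain \<delta> where \<delta>: "continuous_map (subtopology Z ?R) euclideanreal \<delta>" "\<And>z. z \<in> ?R \<Longrightarrow> 0 < \<delta> z"
    "\<And>z z0. z \<in> ?R \<Longrightarrow> z0 \<in> D0 \<Longrightarrow> \<delta> z \<le> d z z0"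
  proof (cases "D0 = {}")
    case True
    then show thesis using that[of "\<lambda>_. 1"] by simp
  next
    case False
    have D0M: "D0 \<subseteq> M" using D0 closedin_subset topZ by blast
    obtain t where t: "continuous_map (subtopology Z M) euclideanreal t" "\<And>z. z \<in> M \<Longrightarrow> 0 \<le> t z"
      "\<And>z c. z \<in> M \<Longrightarrow> t z < c \<Longrightarrow> \<exists>p\<in>D0. d z p < c"
      "\<And>z p. z \<in> M \<Longrightarrow> p \<in> D0 \<Longrightarrow> t z \<le> d z p"
      using graph_distance[of M D0 "\<lambda>_. 0::real"] D0M False unfolding Z by auto
    show thesis
    proof (rule that[of t])
      show "continuous_map (subtopology Z ?R) euclideanreal t"
        by (rule continuous_map_from_subtopology_mono[OF t(1)]) auto
      fix z assume z: "z \<in> ?R"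
      obtain r where r: "r > 0" "mball z r \<subseteq> ?R" using oR z unfolding Z openin_mtopology by blast
      show "0 < t z"
      proof (rule ccontr)
        assume "\<not> 0 < t z"
        then obtain p where "p \<in> D0" "d z p < r" using t(3)[of z r] z r by auto
        then have "p \<in> mball z r" using z D0M by (auto simp: in_mball)
        then show False using r \<open>p \<in> D0\<close> by blast
      qed
    qed (use t in auto)
  qed
  \<comment> \<open>The factor \<open>2\<close> turns \<open>\<tau> z \<le> 1\<close> into the strict inequality \<open>s z < \<delta> z\<close>, which yields a witness in \<open>D1\<close>.\<close>
  define \<tau> where "\<tau> z = 2 * s z / \<delta> z" for z
  have \<tau>: "continuous_map (subtopology Z ?R) euclideanreal \<tau>"
    unfolding \<tau>_def using s(1) \<delta>(1,2) by (intro continuous_intros) (auto simp: topZ less_imp_neq[symmetric] dest: \<delta>(2))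
  have \<tau>0: "0 \<le> \<tau> z" if "z \<in> ?R" for z using s(2) \<delta>(2) that by (auto simp: \<tau>_def less_imp_le)
  have \<tau>D: "\<tau> z = 0" if "z \<in> D1" for z
  proof -
    have "s z \<le> 0" using s(4)[of z z] that D1R by auto
    then show ?thesis using s(2)[of z] that D1R by (force simp: \<tau>_def)
  qed
  have KC: "\<exists>N. openin Z N \<and> z0 \<in> N \<and> (\<forall>z\<in>N - D0. \<tau> z \<le> 1 \<longrightarrow> 1/2 < disk_norm n (y z) \<and>
      (\<forall>b\<in>{0..1}. \<phi> (push_out n (y z) b) \<in> W))"
    if z0: "z0 \<in> D0" and W: "openin K W" "f z0 \<in> W" for z0 W
  proof -
    have "f z0 \<notin> ?e" using z0 K0(2) by (auto simp: D0_def)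
    then obtain e V where eV: "e > 0" "openin K V" "f z0 \<in> V"
      "\<And>x v b. \<lbrakk>x \<in> unit_disk n; \<phi> x \<in> V; v \<in> unit_disk n; dist x v < e; 0 \<le> b; b \<le> 1\<rbrakk>
       \<Longrightarrow> disk_norm n v > 1/2 \<and> \<phi> (push_out n v b) \<in> W"
      using push_out_near_boundary[OF K \<phi> W] by metis
    obtain N where N: "openin Z N" "z0 \<in> N" "f ` (N \<inter> D) \<subseteq> V"
      using continuous_map_subtopology_localD[OF f _ _ eV(2,3)] z0 DM by (auto simp: topZ D0_def)
    obtain r where r: "r > 0" "mball z0 r \<subseteq> N" using N unfolding Z openin_mtopology by blast
    define \<rho> where "\<rho> = min (r/2) e"
    have z0M: "z0 \<in> M" using z0 DM by (auto simp: D0_def)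
    show ?thesis
    proof (intro exI conjI ballI impI)
      show "openin Z (mball z0 \<rho>)" by (simp add: Z)
      show "z0 \<in> mball z0 \<rho>" using r eV z0M by (simp add: \<rho>_def)
      fix z assume z: "z \<in> mball z0 \<rho> - D0" and \<tau>z: "\<tau> z \<le> 1"
      then have zR: "z \<in> ?R" by auto
      have "\<delta> z \<le> d z z0" by (rule \<delta>(3)[OF zR z0])
      then have dz: "\<delta> z < \<rho>" using z by (auto simp: commute)
      have "s z < \<delta> z" using \<tau>z \<delta>(2)[OF zR] s(2)[OF zR] by (auto simp: \<tau>_def divide_le_eq)
      then obtain p where p: "p \<in> D1" "d z p + dist (y z) (y p) < \<delta> z" using s(3)[OF zR] by blast
      have pp: "d z p < \<rho>" "dist (y p) (y z) < \<rho>"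
        using p(2) dz nonneg[of z p] zero_le_dist[of "y z" "y p"] unfolding dist_commute[of "y p"] by linarith+
      have "d z0 p \<le> d z0 z + d z p" using z0M zR p D1R by (intro triangle) auto
      then have "d z0 p < r" using pp z by (auto simp: \<rho>_def)
      then have "p \<in> mball z0 r" using p(1) D1R z0M by (auto simp: in_mball)
      then have "p \<in> N" using r by blast
      then have "f p \<in> V" using N p by (auto simp: D1_def)
      moreover have "\<phi> (y p) = f p" using y(2)[OF p(1)] xi2[OF fe[OF p(1)]] fe[OF p(1)] eK by auto
      ultimately have V: "\<phi> (y p) \<in> V" by simp
      have *: "disk_norm n (y z) > 1/2 \<and> \<phi> (push_out n (y z) b) \<in> W" if "0 \<le> b" "b \<le> 1" for b
        using eV(4)[OF yD V yD] p D1R zR pp that by (auto simp: \<rho>_def)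
      show "1/2 < disk_norm n (y z)" using *[of 0] by simp
      show "\<phi> (push_out n (y z) b) \<in> W" if "b \<in> {0..1}" for b using *[of b] that by auto
    qed
  qed
  have \<phi>y: "\<phi> (y z) = f z" if "z \<in> D1" for z
    using y(2)[OF that] xi2[OF fe[OF that]] fe[OF that] eK by auto
  show thesis
  proof (rule that[of y \<tau>])
    show "continuous_map (subtopology Z (topspace Z - D0)) (top_of_set ?D) y"
      "continuous_map (subtopology Z (topspace Z - D0)) euclideanreal \<tau>"
      using y(1) \<tau> by (simp_all add: topZ)
    show "0 \<le> \<tau> z" if "z \<in> topspace Z - D0" for z using that \<tau>0 topZ by simp
    show "\<tau> z = 0" "\<phi> (y z) = f z" if "z \<in> D - D0" for z using that \<tau>D \<phi>y by (simp_all add: D1_def)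
  qed (rule KC)
qed

text \<open>
  Take \<open>y\<close> and \<open>\<tau>\<close> from \<open>cell_collar\<close>. On the thin set \<open>\<tau> \<le> 1\<close> the extension is \<open>\<phi>\<close> of \<open>y\<close> pushed out
  with parameter \<open>1 - \<tau>\<close>: on \<open>D\<close> this is the given map, and where \<open>\<tau> = 1\<close> the values are on the
  boundary of the cell, hence in \<open>K0\<close>. These values, together with the given ones on \<open>D0\<close>, form a map
  into \<open>K0\<close> on a closed set, and the extension property of \<open>K0\<close> continues it over a neighbourhood in
  the set \<open>\<tau> \<ge> 1\<close>.
\<close>
lemma nbhd_extensor_attach_cell:
  fixes \<phi> :: "(nat \<Rightarrow> real) \<Rightarrow> 'k"
  assumes K: "Hausdorff_space K"
    and \<phi>: "continuous_map (top_of_set (unit_disk n)) K \<phi>"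
    and hom: "homeomorphic_map (top_of_set (open_unit_disk n)) (subtopology K (\<phi> ` open_unit_disk n)) \<phi>"
    and K0: "closedin K K0" "K0 \<inter> \<phi> ` open_unit_disk n = {}"
    and bd: "\<phi> ` (unit_disk n - open_unit_disk n) \<subseteq> K0"
    and NE: "nbhd_extensor TYPE('z) (subtopology K K0)"
  shows "nbhd_extensor TYPE('z) (subtopology K (K0 \<union> \<phi> ` open_unit_disk n))"
  unfolding nbhd_extensor_def
proof (intro allI impI)
  fix Z :: "'z topology" and D and f
  let ?e = "\<phi> ` open_unit_disk n"
  let ?D = "unit_disk n"
  let ?K1 = "subtopology K (K0 \<union> ?e)"
  assume asm: "metrizable_space Z \<and> closedin Z D \<and> continuous_map (subtopology Z D) ?K1 f"
  then have Zm: "metrizable_space Z" and D: "closedin Z D" and f1: "continuous_map (subtopology Z D) ?K1 f" by auto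
  define M where "M = topspace Z"
  have topZ: "topspace Z = M" by (simp add: M_def)
  have DM: "D \<subseteq> M" using D closedin_subset topZ by blast
  have f: "continuous_map (subtopology Z D) K f" and fim: "\<And>z. z \<in> D \<Longrightarrow> f z \<in> K0 \<union> ?e"
    using f1 DM by (auto simp: continuous_map_in_subtopology topZ)
  define D0 where "D0 = {z \<in> D. f z \<in> K0}"
  define D1 where "D1 = D - D0"
  have D0: "closedin Z D0"
  proof -
    have "closedin (subtopology Z D) {z \<in> topspace (subtopology Z D). f z \<in> K0}"
      by (rule closedin_continuous_map_preimage[OF f K0(1)])
    then have "closedin (subtopology Z D) D0" using DM by (simp add: D0_def topZ Int_absorb1 Collect_conj_eq) 
    then show ?thesis using D closedin_trans_full by blast
  qed
  have D01: "D = D0 \<union> D1" "D0 \<inter> D1 = {}" by (auto simp: D0_def D1_def)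
  show "\<exists>U g. openin Z U \<and> D \<subseteq> U \<and> continuous_map (subtopology Z U) ?K1 g \<and> (\<forall>z\<in>D. g z = f z)"
  proof (cases "D1 = {}")
    case True
    then have "continuous_map (subtopology Z D) (subtopology K K0) f"
      using f DM by (intro continuous_map_to_subtopologyI) (auto simp: D0_def D1_def)
    then obtain U g where "openin Z U" "D \<subseteq> U" "continuous_map (subtopology Z U) (subtopology K K0) g" "\<forall>z\<in>D. g z = f z"
      using NE Zm D unfolding nbhd_extensor_def by metis
    then show ?thesis by (intro exI[of _ U] exI[of _ g]) (auto simp: continuous_map_in_subtopology)
  next
    case False
    let ?R = "M - D0"
    have ne: "D0 \<noteq> D" using False by (auto simp: D1_def)
    obtain y \<tau> where yt: "continuous_map (subtopology Z (topspace Z - D0)) (top_of_set ?D) y"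
      "continuous_map (subtopology Z (topspace Z - D0)) euclideanreal \<tau>"
      "\<And>z. z \<in> topspace Z - D0 \<Longrightarrow> 0 \<le> \<tau> z"
      "\<And>z. z \<in> D - D0 \<Longrightarrow> \<tau> z = 0" "\<And>z. z \<in> D - D0 \<Longrightarrow> \<phi> (y z) = f z"
      "\<And>z0 W. \<lbrakk>z0 \<in> D0; openin K W; f z0 \<in> W\<rbrakk> \<Longrightarrow>
         \<exists>N. openin Z N \<and> z0 \<in> N \<and> (\<forall>z\<in>N - D0. \<tau> z \<le> 1 \<longrightarrow> 1/2 < disk_norm n (y z) \<and>
           (\<forall>b\<in>{0..1}. \<phi> (push_out n (y z) b) \<in> W))"
      by (rule cell_collar[OF K \<phi> hom K0 Zm D f fim D0_def ne]) (assumption | rule that; assumption)+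
    note y = yt(1)[unfolded topZ] and \<tau> = yt(2)[unfolded topZ] and \<tau>0 = yt(3)[unfolded topZ]
      and \<tau>D = yt(4)[folded D1_def] and KC = yt(6)
    have oR: "openin Z ?R" using D0 topZ by (metis openin_diff openin_topspace)
    have D1R: "D1 \<subseteq> ?R" using DM by (auto simp: D1_def)
    have yD: "y z \<in> ?D" if "z \<in> ?R" for z using y that by (auto simp: continuous_map_in_subtopology topZ)
    have y_eu: "continuous_map (subtopology Z ?R) euclidean y" using y by (simp add: continuous_map_in_subtopology)
    \<comment> \<open>\<open>G\<close> is the thin set and \<open>Z2\<close> the rest; they meet where \<open>\<tau> = 1\<close>. Points of the common part that are near
      the centre of the disk form \<open>H\<close>, which is removed: there, pushing out with parameter \<open>0\<close> is discontinuous.\<close>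
    define G where "G = D0 \<union> {z \<in> ?R. \<tau> z \<le> 1}"
    define Z2 where "Z2 = D0 \<union> {z \<in> ?R. 1 \<le> \<tau> z}"
    define H where "H = {z \<in> ?R. \<tau> z = 1 \<and> disk_norm n (y z) \<le> 1/2}"
    define E where "E = D0 \<union> {z \<in> ?R. \<tau> z = 1 \<and> 1/2 \<le> disk_norm n (y z)}"
    define G1 where "G1 = D0 \<union> {z \<in> ?R. \<tau> z \<le> 1 \<and> 0 < max (disk_norm n (y z)) (1 - \<tau> z)}"
    define f1 where "f1 z = (if z \<in> D0 then f z else \<phi> (push_out n (y z) (1 - \<tau> z)))" for z
    have D0M: "D0 \<subseteq> M" using D0 closedin_subset topZ by blast
    have yn: "continuous_map (subtopology Z ?R) euclideanreal (\<lambda>z. disk_norm n (y z))"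
      using continuous_map_compose[OF y_eu, of euclidean "disk_norm n"]
      by (auto simp: o_def continuous_on_disk_norm[OF continuous_on_id])
    have opR: "openin Z {z \<in> ?R. P z}" if "openin (subtopology Z ?R) {z \<in> topspace (subtopology Z ?R). P z}" for P
    proof -
      have "openin Z {z \<in> topspace (subtopology Z ?R). P z}" using that oR openin_trans_full by blast
      then show ?thesis by (simp add: topZ Int_absorb1 Diff_subset)
    qed
    have clo: "closedin Z (D0 \<union> {z \<in> ?R. P z})" if "openin (subtopology Z ?R) {z \<in> topspace (subtopology Z ?R). \<not> P z}" for P
    proof -
      have "D0 \<union> {z \<in> ?R. P z} = topspace Z - {z \<in> ?R. \<not> P z}" using D0M by (auto simp: topZ)
      then show ?thesis using opR[OF that] by (simp add: openin_closedin_eq)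
    qed
    have op1: "openin (subtopology Z ?R) {z \<in> topspace (subtopology Z ?R). (\<tau> z, disk_norm n (y z)) \<in> A}" if "open A" for A
    proof -
      have "continuous_map (subtopology Z ?R) euclidean (\<lambda>z. (\<tau> z, disk_norm n (y z)))"
        using continuous_map_pairedI[OF \<tau> yn] by simp
      from openin_continuous_map_preimage[OF this, of A] that show ?thesis by simp
    qed
    have half: "open {p::real\<times>real. P p}" if "closed {p. \<not> P p}" for P
      using that by (simp add: closed_def Collect_neg_eq)
    have clG: "closedin Z G" unfolding G_def
    proof (rule clo)
      have "open {p::real\<times>real. 1 < fst p}" by (intro open_Collect_less continuous_intros)
      from op1[OF this] show "openin (subtopology Z ?R) {z \<in> topspace (subtopology Z ?R). \<not> \<tau> z \<le> 1}"
        by (simp add: not_le)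
    qed
    have clZ2: "closedin Z Z2" unfolding Z2_def
    proof (rule clo)
      have "open {p::real\<times>real. fst p < 1}" by (intro open_Collect_less continuous_intros)
      from op1[OF this] show "openin (subtopology Z ?R) {z \<in> topspace (subtopology Z ?R). \<not> 1 \<le> \<tau> z}"
        by (simp add: not_le)
    qed
    have clE: "closedin Z E" unfolding E_def
    proof (rule clo)
      have "closed {p::real\<times>real. fst p = 1 \<and> 1/2 \<le> snd p}"
        by (intro closed_Collect_conj closed_Collect_eq closed_Collect_le continuous_intros)
      then have "open {p::real\<times>real. \<not> (fst p = 1 \<and> 1/2 \<le> snd p)}" by (intro half) (simp only: not_not)
      from op1[OF this] show "openin (subtopology Z ?R) {z \<in> topspace (subtopology Z ?R). \<not> (\<tau> z = 1 \<and> 1/2 \<le> disk_norm n (y z))}"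
        by simp
    qed
    have clH: "closedin Z H"
    proof -
      have 1: "openin Z {z \<in> ?R. \<not> (\<tau> z = 1 \<and> disk_norm n (y z) \<le> 1/2)}"
      proof (rule opR)
        have "closed {p::real\<times>real. fst p = 1 \<and> snd p \<le> 1/2}"
          by (intro closed_Collect_conj closed_Collect_eq closed_Collect_le continuous_intros)
        then have "open {p::real\<times>real. \<not> (fst p = 1 \<and> snd p \<le> 1/2)}" by (intro half) (simp only: not_not)
        from op1[OF this] show "openin (subtopology Z ?R) {z \<in> topspace (subtopology Z ?R). \<not> (\<tau> z = 1 \<and> disk_norm n (y z) \<le> 1/2)}"
          by simp
      qed
      have "openin Z (topspace Z - H)"
      proof (subst openin_subopen, intro ballI)
        fix z assume z: "z \<in> topspace Z - H"
        show "\<exists>T. openin Z T \<and> z \<in> T \<and> T \<subseteq> topspace Z - H"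
        proof (cases "z \<in> D0")
          case True
          then have "f z \<in> topspace K" using K0(1) closedin_subset by (auto simp: D0_def)
          from KC[OF True openin_topspace this] obtain N where "openin Z N" "z \<in> N"
            "\<forall>z\<in>N - D0. \<tau> z \<le> 1 \<longrightarrow> 1/2 < disk_norm n (y z)" by blast
          then show ?thesis using openin_subset[of Z N] by (intro exI[of _ N]) (force simp: H_def)
        next
          case False
          then show ?thesis using z 1 by (intro exI[of _ "{z \<in> ?R. \<not> (\<tau> z = 1 \<and> disk_norm n (y z) \<le> 1/2)}"]) (auto simp: H_def topZ)
        qed
      qed
      moreover have "H \<subseteq> topspace Z" by (auto simp: H_def topZ)
      ultimately show ?thesis by (simp add: closedin_def)
    qed
    have f1cell: "\<phi> (push_out n (y z) (1 - \<tau> z)) \<in> \<phi> ` ?D" if "z \<in> G1 - D0" for z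
      using that yD[of z] by (intro imageI push_out_unit_disk) (auto simp: G1_def)
    have \<phi>D: "\<phi> ` ?D \<subseteq> K0 \<union> ?e" "\<phi> ` ?D \<subseteq> topspace K"
      using bd \<phi> by (auto simp: continuous_map_def)
    have f1c: "continuous_map (subtopology Z G1) K f1"
    proof (rule continuous_map_subtopology_local)
      show "G1 \<subseteq> topspace Z" using D0M by (auto simp: G1_def topZ)
      show "f1 z \<in> topspace K" if "z \<in> G1" for z
      proof (cases "z \<in> D0")
        case True
        then show ?thesis using closedin_subset[OF K0(1)] by (auto simp: f1_def D0_def)
      next
        case False
        then show ?thesis using that f1cell[of z] \<phi>D(2) unfolding f1_def by auto
      qed
      fix z W assume zW: "z \<in> G1" "openin K W" "f1 z \<in> W"
      show "\<exists>N. openin Z N \<and> z \<in> N \<and> f1 ` (N \<inter> G1) \<subseteq> W"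
      proof (cases "z \<in> D0")
        case True
        then have fz: "f z \<in> W" using zW by (simp add: f1_def)
        obtain N where N: "openin Z N" "z \<in> N" "\<forall>z\<in>N - D0. \<tau> z \<le> 1 \<longrightarrow> 1/2 < disk_norm n (y z) \<and>
            (\<forall>b\<in>{0..1}. \<phi> (push_out n (y z) b) \<in> W)" using KC[OF True zW(2) fz] by blast
        obtain N' where N': "openin Z N'" "z \<in> N'" "f ` (N' \<inter> D) \<subseteq> W"
          using continuous_map_subtopology_localD[OF f _ _ zW(2) fz] True DM by (auto simp: topZ D0_def)
        have "f1 w \<in> W" if w: "w \<in> N" "w \<in> N'" "w \<in> G1" for w
        proof (cases "w \<in> D0")
          case True
          then show ?thesis using w N' by (auto simp: f1_def D0_def)
        next
          case False
          then have "w \<in> ?R" "\<tau> w \<le> 1" using w by (auto simp: G1_def)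
          then have "1 - \<tau> w \<in> {0..1}" using \<tau>0[of w] by auto
          then show ?thesis using N False w \<open>\<tau> w \<le> 1\<close> by (auto simp: f1_def)
        qed
        then show ?thesis using N N' by (intro exI[of _ "N \<inter> N'"]) auto
      next
        case False
        let ?S = "G1 - D0"
        have SR: "?S \<subseteq> ?R" by (auto simp: G1_def)
        have "continuous_map (subtopology Z ?S) euclidean (\<lambda>z. (y z, 1 - \<tau> z))"
        proof -
          have "continuous_map (subtopology Z ?S) euclidean y" "continuous_map (subtopology Z ?S) euclideanreal \<tau>"
            using continuous_map_from_subtopology_mono[OF y_eu SR] continuous_map_from_subtopology_mono[OF \<tau> SR] by auto
          then have "continuous_map (subtopology Z ?S) (prod_topology euclidean euclideanreal) (\<lambda>z. (y z, 1 - \<tau> z))"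
            by (intro continuous_map_pairedI continuous_intros)
          then show ?thesis by simp
        qed
        then have "continuous_map (subtopology Z ?S) (top_of_set {(x, b). 0 < max (disk_norm n x) b}) (\<lambda>z. (y z, 1 - \<tau> z))"
          by (rule continuous_map_to_subtopologyI) (auto simp: G1_def)
        from continuous_map_compose[OF this, of euclidean "\<lambda>(x, b). push_out n x b"] continuous_on_push_out[of n]
        have "continuous_map (subtopology Z ?S) euclidean (\<lambda>z. push_out n (y z) (1 - \<tau> z))"
          by (simp add: o_def)
        then have "continuous_map (subtopology Z ?S) (top_of_set ?D) (\<lambda>z. push_out n (y z) (1 - \<tau> z))"
        proof (rule continuous_map_to_subtopologyI)
          show "(\<lambda>z. push_out n (y z) (1 - \<tau> z)) ` topspace (subtopology Z ?S) \<subseteq> ?D"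
            using yD SR by (auto simp: G1_def intro!: push_out_unit_disk)
        qed
        from continuous_map_compose[OF this \<phi>]
        have c: "continuous_map (subtopology Z ?S) K (\<lambda>z. \<phi> (push_out n (y z) (1 - \<tau> z)))" by (simp add: o_def)
        have "\<phi> (push_out n (y z) (1 - \<tau> z)) \<in> W" using zW False by (simp add: f1_def)
        then obtain N where N: "openin Z N" "z \<in> N" "(\<lambda>z. \<phi> (push_out n (y z) (1 - \<tau> z))) ` (N \<inter> ?S) \<subseteq> W"
          using continuous_map_subtopology_localD[OF c _ _ zW(2)] zW(1) False SR topZ by blast
        then show ?thesis using oR zW(1) False SR by (intro exI[of _ "N \<inter> ?R"]) (auto simp: f1_def)
      qed
    qed
    have EG1: "E \<subseteq> G1" by (auto simp: E_def G1_def)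
    have EZ2: "E \<subseteq> Z2" by (auto simp: E_def Z2_def)
    have f1E: "f1 z \<in> K0" if "z \<in> E" for z
    proof (cases "z \<in> D0")
      case False
      then have z: "z \<in> ?R" "\<tau> z = 1" "1/2 \<le> disk_norm n (y z)" using that by (auto simp: E_def)
      then have "disk_norm n (push_out n (y z) 0) = 1" by (intro disk_norm_push_out_zero) auto
      moreover have "push_out n (y z) 0 \<in> ?D"
        using z yD[of z] by (intro push_out_unit_disk) (auto simp: less_max_iff_disj)
      ultimately have "push_out n (y z) 0 \<in> ?D - open_unit_disk n" by (auto simp: open_unit_disk_alt)
      then show ?thesis using z bd False by (auto simp: f1_def)
    qed (auto simp: f1_def D0_def)
    have "continuous_map (subtopology (subtopology Z Z2) E) (subtopology K K0) f1"
    proof (rule continuous_map_to_subtopologyI)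
      show "continuous_map (subtopology (subtopology Z Z2) E) K f1"
        using continuous_map_from_subtopology_mono[OF f1c EG1] EZ2 by (simp add: subtopology_subtopology Int_absorb1)
    qed (use f1E in auto)
    moreover have "closedin (subtopology Z Z2) E" using clE EZ2 closedin_subset_topspace by blast
    moreover have "metrizable_space (subtopology Z Z2)" using Zm metrizable_space_subtopology by blast
    ultimately obtain O2 g2 where g2: "openin (subtopology Z Z2) O2" "E \<subseteq> O2"
      "continuous_map (subtopology (subtopology Z Z2) O2) (subtopology K K0) g2" "\<forall>z\<in>E. g2 z = f1 z"
      using NE unfolding nbhd_extensor_def by metis
    have O2Z2: "O2 \<subseteq> Z2" using openin_subset[OF g2(1)] by auto
    define N where "N = topspace Z - (Z2 - O2) - H"
    have "closedin Z (Z2 - O2)"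
    proof -
      have "closedin (subtopology Z Z2) (topspace (subtopology Z Z2) - O2)" using g2(1) by blast
      moreover have "topspace (subtopology Z Z2) = Z2" using closedin_subset[OF clZ2] by auto
      ultimately show ?thesis using clZ2 closedin_trans_full by metis
    qed
    then have oN: "openin Z N" unfolding N_def using clH by blast
    have DN: "D \<subseteq> N"
    proof
      fix z assume z: "z \<in> D"
      show "z \<in> N"
      proof (cases "z \<in> D0")
        case True
        then show ?thesis using g2(2) DM z by (auto simp: N_def topZ E_def H_def)
      next
        case False
        then have "z \<in> D1" using z by (simp add: D1_def)
        then show ?thesis using \<tau>D[of z] z DM D01 by (auto simp: N_def topZ H_def Z2_def)
      qed
    qed
    define g where "g z = (if z \<in> N \<inter> G then f1 z else g2 z)" for z
    have NG1: "N \<inter> G \<subseteq> G1"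
      by (auto simp: N_def G_def G1_def H_def less_max_iff_disj not_le)
    have NZ2: "N \<inter> Z2 \<subseteq> O2" by (auto simp: N_def)
    have "continuous_map (subtopology (subtopology Z N) ((N \<inter> G) \<union> (N \<inter> Z2))) K g"
      unfolding g_def
    proof (rule continuous_map_paste_closed)
      show "closedin (subtopology Z N) (N \<inter> G)" "closedin (subtopology Z N) (N \<inter> Z2)"
        using clG clZ2 by (auto simp: closedin_subtopology)
      show "continuous_map (subtopology (subtopology Z N) (N \<inter> G)) K f1"
        using continuous_map_from_subtopology_mono[OF f1c NG1] by (simp add: subtopology_subtopology Int_absorb1)
      have "continuous_map (subtopology Z O2) K g2"
        using g2(3) O2Z2 by (simp add: continuous_map_in_subtopology subtopology_subtopology Int_absorb1)
      from continuous_map_from_subtopology_mono[OF this NZ2]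
      show "continuous_map (subtopology (subtopology Z N) (N \<inter> Z2)) K g2"
        by (simp add: subtopology_subtopology Int_absorb1)
      fix z assume "z \<in> N \<inter> G" "z \<in> N \<inter> Z2"
      then have "z \<in> E" by (auto simp: N_def G_def Z2_def E_def H_def)
      then show "f1 z = g2 z" using g2(4) by simp
    qed
    moreover have cov: "(N \<inter> G) \<union> (N \<inter> Z2) = N" by (auto simp: G_def Z2_def N_def topZ)
    ultimately have gc: "continuous_map (subtopology Z N) K g"
      by (simp add: subtopology_subtopology)
    have gim: "g z \<in> K0 \<union> ?e" if "z \<in> N" for z
    proof (cases "z \<in> G")
      case True
      then have "z \<in> G1" using that NG1 by blast
      then show ?thesis using True that f1cell[of z] \<phi>D(1) by (auto simp: g_def f1_def D0_def)
    next
      case False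
      then have "z \<in> O2" using that cov NZ2 by blast
      then have "g2 z \<in> K0" using g2(3) O2Z2 closedin_subset[OF clZ2] by (auto simp: continuous_map_in_subtopology)
      then show ?thesis using False by (simp add: g_def)
    qed
    have "g z = f z" if z: "z \<in> D" for z
    proof (cases "z \<in> D0")
      case True
      then show ?thesis using DN z by (auto simp: g_def G_def f1_def)
    next
      case False
      then have z1: "z \<in> D1" using z by (simp add: D1_def)
      then have "z \<in> N \<inter> G" using DN z \<tau>D[OF z1] D1R by (auto simp: G_def)
      moreover have "y z \<in> ?D" using yD z1 D1R by blast
      ultimately show ?thesis using False \<tau>D[OF z1] push_out_one yt(5)[folded D1_def, OF z1]
        by (auto simp: g_def f1_def)
    qed
    moreover have "continuous_map (subtopology Z N) ?K1 g"
      using gim by (intro continuous_map_to_subtopologyI[OF gc]) auto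
    ultimately show ?thesis using oN DN by blast
  qed
qed

section \<open>Finite subcomplexes and extension near compact sets\<close>

abbreviation open_cell :: "nat \<times> ((nat \<Rightarrow> real) \<Rightarrow> 'k) \<Rightarrow> 'k set" where
  "open_cell c \<equiv> snd c ` open_unit_disk (fst c)"

abbreviation closed_cell :: "nat \<times> ((nat \<Rightarrow> real) \<Rightarrow> 'k) \<Rightarrow> 'k set" where
  "closed_cell c \<equiv> snd c ` unit_disk (fst c)"

text \<open>
  The boundary condition refers to open cells of lower dimension in the subcomplex itself, so that
  removing a cell of top dimension leaves a subcomplex.
\<close>
definition finite_subcomplex ::
    "(nat \<times> ((nat \<Rightarrow> real) \<Rightarrow> 'k)) set \<Rightarrow> (nat \<times> ((nat \<Rightarrow> real) \<Rightarrow> 'k)) set \<Rightarrow> bool" where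
  "finite_subcomplex E E0 \<longleftrightarrow> finite E0 \<and> E0 \<subseteq> E \<and>
     (\<forall>c\<in>E0. snd c ` (unit_disk (fst c) - open_unit_disk (fst c)) \<subseteq>
        (\<Union>c'\<in>{c'\<in>E0. fst c' < fst c}. open_cell c'))"

lemma nbhd_extensorE:
  fixes Z :: "'z topology"
  assumes "nbhd_extensor TYPE('z) K" "metrizable_space Z" "closedin Z D" "continuous_map (subtopology Z D) K f"
  obtains U g where "openin Z U" "D \<subseteq> U" "continuous_map (subtopology Z U) K g" "\<And>z. z \<in> D \<Longrightarrow> g z = f z"
proof -
  have "\<exists>U g. openin Z U \<and> D \<subseteq> U \<and> continuous_map (subtopology Z U) K g \<and> (\<forall>z\<in>D. g z = f z)"
    using assms(1)[unfolded nbhd_extensor_def, rule_format, of Z D f] assms(2-4) by simp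
  then show thesis using that by blast
qed

lemma CW_structureD:
  assumes "CW_structure K E"
  shows "Hausdorff_space K"
    "\<And>c. c \<in> E \<Longrightarrow> continuous_map (top_of_set (unit_disk (fst c))) K (snd c)"
    "\<And>c. c \<in> E \<Longrightarrow> homeomorphic_map (top_of_set (open_unit_disk (fst c))) (subtopology K (open_cell c)) (snd c)"
    "\<And>c c'. c \<in> E \<Longrightarrow> c' \<in> E \<Longrightarrow> c \<noteq> c' \<Longrightarrow> open_cell c \<inter> open_cell c' = {}"
    "(\<Union>c\<in>E. open_cell c) = topspace K"
    "\<And>c. c \<in> E \<Longrightarrow> \<exists>F. finite F \<and> F \<subseteq> {c'\<in>E. fst c' < fst c} \<and>
        snd c ` (unit_disk (fst c) - open_unit_disk (fst c)) \<subseteq> (\<Union>c'\<in>F. open_cell c')"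
    "\<And>C. C \<subseteq> topspace K \<Longrightarrow> (\<And>c. c \<in> E \<Longrightarrow> closedin K (C \<inter> closed_cell c)) \<Longrightarrow> closedin K C"
proof -
  note H = assms[unfolded CW_structure_def case_prod_unfold subtopology_unit_disk
      subtopology_open_unit_disk pairwise_def disjnt_def prod.collapse]
  note A = H[THEN conjunct1] H[THEN conjunct2, THEN conjunct1]
    H[THEN conjunct2, THEN conjunct2, THEN conjunct1]
    H[THEN conjunct2, THEN conjunct2, THEN conjunct2, THEN conjunct1]
    H[THEN conjunct2, THEN conjunct2, THEN conjunct2, THEN conjunct2, THEN conjunct1]
    H[THEN conjunct2, THEN conjunct2, THEN conjunct2, THEN conjunct2, THEN conjunct2]
  show "Hausdorff_space K" by (rule A)
  show "(\<Union>c\<in>E. open_cell c) = topspace K" by (rule A)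
  show "continuous_map (top_of_set (unit_disk (fst c))) K (snd c)" if "c \<in> E" for c
    using A(2) that by simp
  show "homeomorphic_map (top_of_set (open_unit_disk (fst c))) (subtopology K (open_cell c)) (snd c)" if "c \<in> E" for c
    using A(2) that by simp
  show "open_cell c \<inter> open_cell c' = {}" if "c \<in> E" "c' \<in> E" "c \<noteq> c'" for c c'
    using A(3) that by simp
  show "\<exists>F. finite F \<and> F \<subseteq> {c'\<in>E. fst c' < fst c} \<and>
        snd c ` (unit_disk (fst c) - open_unit_disk (fst c)) \<subseteq> (\<Union>c'\<in>F. open_cell c')" if "c \<in> E" for c
    by (rule bspec[OF A(5) that])
  show "closedin K C" if "C \<subseteq> topspace K" "\<And>c. c \<in> E \<Longrightarrow> closedin K (C \<inter> closed_cell c)" for C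
    using A(6) that by simp
qed

context
  fixes K :: "'k topology" and E
  assumes CW: "CW_structure K E"
begin

lemma closed_cell_compact: "c \<in> E \<Longrightarrow> compactin K (closed_cell c)"
  by (rule image_compactin[OF _ CW_structureD(2)[OF CW]]) (simp_all add: compactin_subtopology compact_unit_disk)

lemma closed_cell_finite_cover:
  assumes "c \<in> E"
  obtains F where "finite F" "F \<subseteq> E" "closed_cell c \<subseteq> (\<Union>c'\<in>F. open_cell c')"
proof -
  obtain F where F: "finite F" "F \<subseteq> {c'\<in>E. fst c' < fst c}"
    "snd c ` (unit_disk (fst c) - open_unit_disk (fst c)) \<subseteq> (\<Union>c'\<in>F. open_cell c')"
    using CW_structureD(6)[OF CW assms] by blast
  show thesis
    by (rule that[of "insert c F"]) (use F assms in auto)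
qed

text \<open>
  The trace on a closed cell is finite by closure finiteness, and the topology is the weak one.
\<close>
lemma closedin_one_point_per_cell:
  assumes "T \<subseteq> topspace K" "\<And>c. c \<in> E \<Longrightarrow> finite (T \<inter> open_cell c)"
  shows "closedin K T"
proof (rule CW_structureD(7)[OF CW assms(1)])
  fix c assume "c \<in> E"
  then obtain F where F: "finite F" "F \<subseteq> E" "closed_cell c \<subseteq> (\<Union>c'\<in>F. open_cell c')"
    using closed_cell_finite_cover by blast
  have "finite (\<Union>c'\<in>F. T \<inter> open_cell c')" using F assms(2) by blast
  then have "finite (T \<inter> closed_cell c)" by (rule finite_subset[rotated]) (use F in auto)
  moreover have "T \<inter> closed_cell c \<subseteq> topspace K" using assms(1) by blast
  ultimately show "closedin K (T \<inter> closed_cell c)"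
    using CW_structureD(1)[OF CW] compactin_imp_closedin finite_imp_compactin by metis
qed

lemma finite_subcomplex_Union:
  assumes "finite A" "\<And>a. a \<in> A \<Longrightarrow> finite_subcomplex E (h a)"
  shows "finite_subcomplex E (\<Union>a\<in>A. h a)"
  unfolding finite_subcomplex_def
proof (intro conjI ballI)
  show "finite (\<Union>a\<in>A. h a)" "(\<Union>a\<in>A. h a) \<subseteq> E"
    using assms by (auto simp: finite_subcomplex_def)
  fix c assume "c \<in> (\<Union>a\<in>A. h a)"
  then obtain a where a: "a \<in> A" "c \<in> h a" by blast
  then have "snd c ` (unit_disk (fst c) - open_unit_disk (fst c)) \<subseteq> (\<Union>c'\<in>{c'\<in>h a. fst c' < fst c}. open_cell c')"
    using assms(2)[OF a(1)] unfolding finite_subcomplex_def by blast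
  also have "\<dots> \<subseteq> (\<Union>c'\<in>{c'\<in>(\<Union>a\<in>A. h a). fst c' < fst c}. open_cell c')" using a by blast
  finally show "snd c ` (unit_disk (fst c) - open_unit_disk (fst c)) \<subseteq> (\<Union>c'\<in>{c'\<in>(\<Union>a\<in>A. h a). fst c' < fst c}. open_cell c')" .
qed

text \<open>
  Induction on the dimension, by closure finiteness.
\<close>
lemma cell_in_finite_subcomplex:
  "c \<in> E \<Longrightarrow> \<exists>E0. finite_subcomplex E E0 \<and> c \<in> E0"
proof (induction "fst c" arbitrary: c rule: less_induct)
  case less
  obtain F where F: "finite F" "F \<subseteq> {c'\<in>E. fst c' < fst c}"
    "snd c ` (unit_disk (fst c) - open_unit_disk (fst c)) \<subseteq> (\<Union>c'\<in>F. open_cell c')"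
    using CW_structureD(6)[OF CW less.prems] by blast
  then have "\<forall>c'\<in>F. \<exists>E0. finite_subcomplex E E0 \<and> c' \<in> E0" using less.hyps by blast
  then obtain h where h: "\<And>c'. c' \<in> F \<Longrightarrow> finite_subcomplex E (h c')" "\<And>c'. c' \<in> F \<Longrightarrow> c' \<in> h c'" by metis
  have S: "finite_subcomplex E (\<Union>c'\<in>F. h c')" by (rule finite_subcomplex_Union[OF F(1) h(1)])
  let ?S = "\<Union>c'\<in>F. h c'"
  have "finite_subcomplex E (insert c ?S)"
    unfolding finite_subcomplex_def
  proof (intro conjI ballI)
    show "finite (insert c ?S)" "insert c ?S \<subseteq> E" using S less.prems by (auto simp: finite_subcomplex_def)
    fix c' assume c': "c' \<in> insert c ?S"
    show "snd c' ` (unit_disk (fst c') - open_unit_disk (fst c')) \<subseteq> (\<Union>c''\<in>{c''\<in>insert c ?S. fst c'' < fst c'}. open_cell c'')"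
    proof (cases "c' \<in> ?S")
      case True
      then have "snd c' ` (unit_disk (fst c') - open_unit_disk (fst c')) \<subseteq> (\<Union>c''\<in>{c''\<in>?S. fst c'' < fst c'}. open_cell c'')"
        using S unfolding finite_subcomplex_def by blast
      then show ?thesis by blast
    next
      case False
      then have "c' = c" using c' by simp
      moreover have "F \<subseteq> {c''\<in>insert c ?S. fst c'' < fst c}" using F h by blast
      ultimately show ?thesis using F(3) by (meson UN_mono order_refl order_trans)
    qed
  qed
  then show ?case by blast
qed

lemma cells_in_finite_subcomplex:
  assumes "finite F" "F \<subseteq> E"
  obtains E0 where "finite_subcomplex E E0" "F \<subseteq> E0"
proof -
  obtain h where "\<And>c'. c' \<in> F \<Longrightarrow> finite_subcomplex E (h c')" "\<And>c'. c' \<in> F \<Longrightarrow> c' \<in> h c'"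
    using cell_in_finite_subcomplex assms(2) by (metis subsetD)
  then show thesis using finite_subcomplex_Union[OF assms(1)] that by blast
qed

lemma subcomplex_compact:
  assumes "finite_subcomplex E E0"
  shows "compactin K (\<Union>c\<in>E0. open_cell c)"
proof -
  have "(\<Union>c\<in>E0. open_cell c) = (\<Union>c\<in>E0. closed_cell c)"
  proof
    show "(\<Union>c\<in>E0. open_cell c) \<subseteq> (\<Union>c\<in>E0. closed_cell c)" using open_unit_disk_subset by blast
    show "(\<Union>c\<in>E0. closed_cell c) \<subseteq> (\<Union>c\<in>E0. open_cell c)"
    proof
      fix k assume "k \<in> (\<Union>c\<in>E0. closed_cell c)"
      then obtain c x where c: "c \<in> E0" "x \<in> unit_disk (fst c)" "k = snd c x" by blast
      show "k \<in> (\<Union>c\<in>E0. open_cell c)"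
      proof (cases "x \<in> open_unit_disk (fst c)")
        case True
        then show ?thesis using c by blast
      next
        case False
        then have "k \<in> snd c ` (unit_disk (fst c) - open_unit_disk (fst c))" using c by blast
        then have "k \<in> (\<Union>c'\<in>{c'\<in>E0. fst c' < fst c}. open_cell c')"
          using c(1) assms unfolding finite_subcomplex_def by (meson subsetD)
        then show ?thesis by blast
      qed
    qed
  qed
  then show ?thesis
  proof (simp only:, intro compactin_Union)
    show "finite (closed_cell ` E0)" using assms by (simp add: finite_subcomplex_def)
    show "compactin K S" if "S \<in> closed_cell ` E0" for S
      using that assms closed_cell_compact unfolding finite_subcomplex_def by blast
  qed
qed

lemma subcomplex_closed:
  "finite_subcomplex E E0 \<Longrightarrow> closedin K (\<Union>c\<in>E0. open_cell c)"
  by (rule compactin_imp_closedin[OF CW_structureD(1)[OF CW] subcomplex_compact])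

text \<open>
  Induction on the number of cells, removing a cell of top dimension.
\<close>
lemma subcomplex_nbhd_extensor:
  "finite_subcomplex E E0 \<Longrightarrow> nbhd_extensor TYPE('z) (subtopology K (\<Union>c\<in>E0. open_cell c))"
proof (induction "card E0" arbitrary: E0)
  case 0
  then have "E0 = {}" by (simp add: finite_subcomplex_def)
  then show ?case
    by (auto simp: nbhd_extensor_def continuous_map_def Pi_iff dest: closedin_subset intro!: exI[of _ "{}"])
next
  case (Suc m)
  then have fin: "finite E0" "E0 \<noteq> {}" by (auto simp: finite_subcomplex_def)
  define n where "n = Max (fst ` E0)"
  have "n \<in> fst ` E0" unfolding n_def using fin by simp
  then obtain c where c: "c \<in> E0" "fst c = n" by blast
  have max: "fst c' \<le> n" if "c' \<in> E0" for c' unfolding n_def using fin that by simp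
  let ?E = "E0 - {c}"
  have sc: "finite_subcomplex E ?E"
    unfolding finite_subcomplex_def
  proof (intro conjI ballI)
    show "finite ?E" "?E \<subseteq> E" using Suc.prems by (auto simp: finite_subcomplex_def)
    fix c' assume c': "c' \<in> ?E"
    have "x \<noteq> c" if "fst x < fst c'" for x using max[of c'] c(2) c' that by auto
    then have "{c''\<in>E0. fst c'' < fst c'} \<subseteq> {c''\<in>?E. fst c'' < fst c'}" by blast
    moreover have "snd c' ` (unit_disk (fst c') - open_unit_disk (fst c')) \<subseteq> (\<Union>c''\<in>{c''\<in>E0. fst c'' < fst c'}. open_cell c'')"
      using c' Suc.prems unfolding finite_subcomplex_def by blast
    ultimately show "snd c' ` (unit_disk (fst c') - open_unit_disk (fst c')) \<subseteq> (\<Union>c''\<in>{c''\<in>?E. fst c'' < fst c'}. open_cell c'')"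
      by (meson UN_mono order_refl order_trans)
  qed
  have cE: "c \<in> E" using c Suc.prems by (auto simp: finite_subcomplex_def)
  have "m = card ?E" using Suc.hyps(2) c fin by (simp add: card_Diff_singleton)
  then have NE: "nbhd_extensor TYPE('z) (subtopology K (\<Union>c\<in>?E. open_cell c))" using Suc.hyps(1) sc by blast
  have "(\<Union>c\<in>?E. open_cell c) \<inter> open_cell c = {}"
    using CW_structureD(4)[OF CW] cE Suc.prems unfolding finite_subcomplex_def by blast
  moreover have "snd c ` (unit_disk (fst c) - open_unit_disk (fst c)) \<subseteq> (\<Union>c\<in>?E. open_cell c)"
  proof -
    have "snd c ` (unit_disk (fst c) - open_unit_disk (fst c)) \<subseteq> (\<Union>c'\<in>{c'\<in>E0. fst c' < fst c}. open_cell c')"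
      using c Suc.prems unfolding finite_subcomplex_def by blast
    also have "\<dots> \<subseteq> (\<Union>c\<in>?E. open_cell c)" by auto
    finally show ?thesis .
  qed
  ultimately have "nbhd_extensor TYPE('z) (subtopology K ((\<Union>c\<in>?E. open_cell c) \<union> open_cell c))"
    by (intro nbhd_extensor_attach_cell[OF CW_structureD(1)[OF CW] CW_structureD(2)[OF CW cE]
          CW_structureD(3)[OF CW cE] subcomplex_closed[OF sc] _ _ NE])
  moreover have "(\<Union>c\<in>?E. open_cell c) \<union> open_cell c = (\<Union>c\<in>E0. open_cell c)" using c by auto
  ultimately show ?case by simp
qed

text \<open>
  Choosing one point in every cell that meets \<open>S\<close> gives a set all of whose subsets are closed. So a
  set without infinite closed discrete subsets meets only finitely many cells.
\<close>
lemma in_finite_subcomplex: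
  assumes S: "S \<subseteq> topspace K"
    and fin: "\<And>T. \<lbrakk>T \<subseteq> S; \<And>T'. T' \<subseteq> T \<Longrightarrow> closedin K T'\<rbrakk> \<Longrightarrow> finite T"
  obtains E0 where "finite_subcomplex E E0" "S \<subseteq> (\<Union>c\<in>E0. open_cell c)"
proof -
  define F where "F = {c \<in> E. S \<inter> open_cell c \<noteq> {}}"
  define p where "p c = (SOME x. x \<in> S \<inter> open_cell c)" for c
  have p: "p c \<in> S \<inter> open_cell c" if "c \<in> F" for c
    using that unfolding F_def p_def by (metis (mono_tags, lifting) ex_in_conv mem_Collect_eq someI_ex)
  have F: "F \<subseteq> E" by (auto simp: F_def)
  have dis: "c = c'" if "c \<in> F" "c' \<in> E" "p c \<in> open_cell c'" for c c'
    using CW_structureD(4)[OF CW] p[OF that(1)] that F by blast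
  have "finite (p ` F)"
  proof (rule fin)
    show "p ` F \<subseteq> S" using p by blast
    fix T' assume T': "T' \<subseteq> p ` F"
    show "closedin K T'"
    proof (rule closedin_one_point_per_cell)
      show "T' \<subseteq> topspace K" using T' p S by blast
      fix c assume "c \<in> E"
      have "T' \<inter> open_cell c \<subseteq> {p c}"
      proof
        fix x assume x: "x \<in> T' \<inter> open_cell c"
        then obtain c' where c': "c' \<in> F" "x = p c'" using T' by blast
        then have "c' = c" using dis[OF c'(1) \<open>c \<in> E\<close>] x by simp
        then show "x \<in> {p c}" using c' by simp
      qed
      then show "finite (T' \<inter> open_cell c)" by (rule finite_subset) simp
    qed
  qed
  moreover have "inj_on p F"
    by (rule inj_onI) (metis F IntD2 dis p subsetD)
  ultimately have "finite F" by (simp add: finite_image_iff)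
  then obtain E0 where E0: "finite_subcomplex E E0" "F \<subseteq> E0" using cells_in_finite_subcomplex F by blast
  have "S \<subseteq> (\<Union>c\<in>F. open_cell c)"
  proof
    fix x assume x: "x \<in> S"
    then have "x \<in> (\<Union>c\<in>E. open_cell c)" using S CW_structureD(5)[OF CW] by (metis subsetD)
    then obtain c where "c \<in> E" "x \<in> open_cell c" by blast
    then show "x \<in> (\<Union>c\<in>F. open_cell c)" using x unfolding F_def by blast
  qed
  also have "\<dots> \<subseteq> (\<Union>c\<in>E0. open_cell c)" by (rule UN_mono[OF E0(2)]) simp
  finally show thesis by (rule that[OF E0(1)])
qed

text \<open>
  Otherwise some sequence converges to \<open>z\<close> while its images lie in pairwise distinct cells. The set of
  these images other than \<open>f z\<close> is closed, so by continuity almost all images equal \<open>f z\<close>, a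
  contradiction.
\<close>
lemma locally_in_finite_subcomplex:
  assumes Z: "metrizable_space Z" and f: "continuous_map Z K f" and z: "z \<in> topspace Z"
  obtains U E0 where "openin Z U" "z \<in> U" "finite_subcomplex E E0" "f ` U \<subseteq> (\<Union>c\<in>E0. open_cell c)"
proof (rule ccontr)
  note found = that
  assume neg: "\<not> thesis"
  obtain M d where Md: "Metric_space M d" "Z = Metric_space.mtopology M d"
    using Z by (auto simp: metrizable_space_def)
  interpret Metric_space M d by (rule Md)
  have zM: "z \<in> M" using z Md by simp
  have fK: "f w \<in> topspace K" if "w \<in> M" for w using f that Md by (auto simp: continuous_map_def)
  define U where "U n = mball z (inverse (real (Suc n)))" for n
  have "\<exists>w\<in>U n. \<forall>v\<in>set vs. \<forall>c\<in>E. \<not> (f v \<in> open_cell c \<and> f w \<in> open_cell c)" if "set vs \<subseteq> M" for n and vs :: "_ list"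
  proof -
    have "\<forall>v\<in>set vs. \<exists>c\<in>E. f v \<in> open_cell c" using fK that CW_structureD(5)[OF CW] by blast
    then obtain ce where ce: "\<And>v. v \<in> set vs \<Longrightarrow> ce v \<in> E \<and> f v \<in> open_cell (ce v)" by metis
    obtain E0 where E0: "finite_subcomplex E E0" "ce ` set vs \<subseteq> E0"
      using cells_in_finite_subcomplex[of "ce ` set vs"] ce by blast
    have "openin Z (U n)" "z \<in> U n" using zM by (auto simp: U_def Md)
    then have "\<not> f ` U n \<subseteq> (\<Union>c\<in>E0. open_cell c)" using neg found[OF _ _ E0(1)] by metis
    then obtain w where w: "w \<in> U n" "f w \<notin> (\<Union>c\<in>E0. open_cell c)" by blast
    have "\<not> (f v \<in> open_cell c \<and> f w \<in> open_cell c)" if "v \<in> set vs" "c \<in> E" for v c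
    proof
      assume *: "f v \<in> open_cell c \<and> f w \<in> open_cell c"
      then have "c = ce v" using CW_structureD(4)[OF CW] ce[OF that(1)] that by blast
      then show False using * w E0 that by blast
    qed
    then show ?thesis using w by blast
  qed
  note ex = this
  \<comment> \<open>A point of \<open>U n\<close> whose image shares no cell with the images of the earlier points \<open>vs\<close>.\<close>
  define nxt where "nxt n vs = (SOME w. w \<in> U n \<and>
      (\<forall>v\<in>set vs. \<forall>c\<in>E. \<not> (f v \<in> open_cell c \<and> f w \<in> open_cell c)))" for n vs
  have nx: "nxt n vs \<in> U n \<and>
      (\<forall>v\<in>set vs. \<forall>c\<in>E. \<not> (f v \<in> open_cell c \<and> f (nxt n vs) \<in> open_cell c))" if "set vs \<subseteq> M" for n vs
    unfolding nxt_def by (rule someI_ex) (use ex[OF that, of n] in blast)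
  define vs where "vs = rec_nat [] (\<lambda>n vs. nxt n vs # vs)"
  have vs0: "vs 0 = []" and vsS: "vs (Suc n) = nxt n (vs n) # vs n" for n by (auto simp: vs_def)
  have vsM: "set (vs n) \<subseteq> M" for n
  proof (induction n)
    case (Suc n)
    then have "nxt n (vs n) \<in> U n" using nx by blast
    then show ?case using Suc by (auto simp: vsS U_def)
  qed (simp add: vs0)
  define w where "w n = nxt n (vs n)" for n
  have wU: "w n \<in> U n" for n using nx[OF vsM] by (simp add: w_def)
  have wM: "w n \<in> M" for n using wU by (auto simp: U_def)
  have wvs: "m < n \<Longrightarrow> w m \<in> set (vs n)" for m n
    by (induction n) (auto simp: vsS w_def less_Suc_eq)
  have dist_lt: "\<not> (f (w m) \<in> open_cell c \<and> f (w n) \<in> open_cell c)" if "m < n" "c \<in> E" for m n c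
    using nx[OF vsM] wvs[OF that(1)] that(2) unfolding w_def by blast
  then have dist: "m = n" if "c \<in> E" "f (w m) \<in> open_cell c" "f (w n) \<in> open_cell c" for m n c
    using that by (metis linorder_neqE_nat)
  define T where "T = f ` range w - {f z}"
  have "closedin K T"
  proof (rule closedin_one_point_per_cell)
    show "T \<subseteq> topspace K" using fK wM by (auto simp: T_def)
    fix c assume c: "c \<in> E"
    show "finite (T \<inter> open_cell c)"
    proof (cases "\<exists>n. f (w n) \<in> open_cell c")
      case True
      then obtain n where n: "f (w n) \<in> open_cell c" by blast
      have "T \<inter> open_cell c \<subseteq> {f (w n)}"
      proof
        fix x assume "x \<in> T \<inter> open_cell c"
        then obtain m where m: "x = f (w m)" "f (w m) \<in> open_cell c" by (auto simp: T_def)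
        then have "m = n" using dist[OF c] n by blast
        then show "x \<in> {f (w n)}" using m by simp
      qed
      then show ?thesis by (rule finite_subset) simp
    next
      case False
      then have "T \<inter> open_cell c = {}" unfolding T_def by blast
      then show ?thesis by simp
    qed
  qed
  then have "openin Z {x \<in> topspace Z. f x \<in> topspace K - T}"
    by (intro openin_continuous_map_preimage[OF f] openin_diff openin_topspace)
  moreover have "z \<in> {x \<in> topspace Z. f x \<in> topspace K - T}" using z zM fK by (auto simp: T_def)
  ultimately obtain r where r: "r > 0" "mball z r \<subseteq> {x \<in> topspace Z. f x \<in> topspace K - T}"
    unfolding Md(2) openin_mtopology by blast
  obtain N where N: "inverse (real (Suc N)) < r" using r(1) reals_Archimedean by blast
  have eq: "f (w n) = f z" if "n \<ge> N" for n
  proof -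
    have "inverse (real (Suc n)) \<le> inverse (real (Suc N))" using that by (simp add: field_simps)
    moreover have "d z (w n) < inverse (real (Suc n))" using wU[of n] by (simp add: U_def del: of_nat_Suc)
    ultimately have "d z (w n) < r" using N by linarith
    then have "w n \<in> mball z r" using zM wM[of n] by simp
    then show ?thesis using r(2) by (auto simp: T_def)
  qed
  obtain c where "c \<in> E" "f z \<in> open_cell c" using fK[OF zM] CW_structureD(5)[OF CW] by blast
  then show False using dist_lt[of N "Suc N" c] eq[of N] eq[of "Suc N"] by simp
qed

lemma compact_locally_in_finite_subcomplex:
  assumes Z: "metrizable_space Z" and f: "continuous_map Z K f" and Q: "compactin Z Q"
  obtains U E0 where "openin Z U" "Q \<subseteq> U" "finite_subcomplex E E0" "f ` U \<subseteq> (\<Union>c\<in>E0. open_cell c)"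
proof -
  have "\<forall>z\<in>Q. \<exists>U E0. openin Z U \<and> z \<in> U \<and> finite_subcomplex E E0 \<and> f ` U \<subseteq> (\<Union>c\<in>E0. open_cell c)"
  proof
    fix z assume "z \<in> Q"
    then have "z \<in> topspace Z" using compactin_subset_topspace[OF Q] by blast
    then obtain U E0 where "openin Z U" "z \<in> U" "finite_subcomplex E E0" "f ` U \<subseteq> (\<Union>c\<in>E0. open_cell c)"
      by (rule locally_in_finite_subcomplex[OF Z f])
    then show "\<exists>U E0. openin Z U \<and> z \<in> U \<and> finite_subcomplex E E0 \<and> f ` U \<subseteq> (\<Union>c\<in>E0. open_cell c)" by blast
  qed
  from bchoice[OF this] obtain U where
    "\<forall>z\<in>Q. \<exists>E0. openin Z (U z) \<and> z \<in> U z \<and> finite_subcomplex E E0 \<and> f ` U z \<subseteq> (\<Union>c\<in>E0. open_cell c)" ..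
  from bchoice[OF this] obtain h where
    "\<forall>z\<in>Q. openin Z (U z) \<and> z \<in> U z \<and> finite_subcomplex E (h z) \<and> f ` U z \<subseteq> (\<Union>c\<in>h z. open_cell c)" ..
  then have U: "\<And>z. z \<in> Q \<Longrightarrow> openin Z (U z)" "\<And>z. z \<in> Q \<Longrightarrow> z \<in> U z"
    "\<And>z. z \<in> Q \<Longrightarrow> finite_subcomplex E (h z)" "\<And>z. z \<in> Q \<Longrightarrow> f ` U z \<subseteq> (\<Union>c\<in>h z. open_cell c)"
    by simp_all
  have "\<exists>\<F>. finite \<F> \<and> \<F> \<subseteq> U ` Q \<and> Q \<subseteq> \<Union>\<F>"
    by (rule compactinD[OF Q]) (use U(1,2) in auto)
  then obtain A where A: "finite A" "A \<subseteq> Q" "Q \<subseteq> (\<Union>z\<in>A. U z)" by (metis finite_subset_image)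
  show thesis
  proof (rule that[of "\<Union>z\<in>A. U z" "\<Union>z\<in>A. h z"])
    show "finite_subcomplex E (\<Union>z\<in>A. h z)" using A U by (intro finite_subcomplex_Union) auto
    show "openin Z (\<Union>z\<in>A. U z)" using A U by auto
    show "f ` (\<Union>z\<in>A. U z) \<subseteq> (\<Union>c\<in>(\<Union>z\<in>A. h z). open_cell c)"
    proof
      fix k assume "k \<in> f ` (\<Union>z\<in>A. U z)"
      then obtain z where z: "z \<in> A" "k \<in> f ` U z" by blast
      then have "k \<in> (\<Union>c\<in>h z. open_cell c)" using U(4)[of z] A(2) by (meson subsetD)
      then show "k \<in> (\<Union>c\<in>(\<Union>z\<in>A. h z). open_cell c)" using z(1) by blast
    qed
  qed (rule A)
qed

text \<open>
  Near a compact set only a finite subcomplex matters, and that is a neighbourhood extensor. The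
  result is defined on all of \<open>D\<close> and on a closed neighbourhood of \<open>Q\<close>, which makes the lemma
  suitable for iteration.
\<close>
lemma extend_near_compact:
  fixes Z :: "'z topology"
  assumes Z: "metrizable_space Z" and D: "closedin Z D" and f: "continuous_map (subtopology Z D) K f"
    and Q: "compactin Z Q" "Q \<subseteq> D"
  obtains V W g where "openin Z V" "closedin Z W" "Q \<subseteq> V" "V \<subseteq> W"
    "continuous_map (subtopology Z (D \<union> W)) K g" "\<And>z. z \<in> D \<Longrightarrow> g z = f z"
proof -
  have Zsub: "metrizable_space (subtopology Z S)" for S using Z metrizable_space_subtopology by blast
  have "compactin (subtopology Z D) Q" using Q by (simp add: compactin_subtopology)
  then obtain U E0 where U: "openin (subtopology Z D) U" "Q \<subseteq> U" "finite_subcomplex E E0" "f ` U \<subseteq> (\<Union>c\<in>E0. open_cell c)"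
    by (rule compact_locally_in_finite_subcomplex[OF Zsub f])
  let ?K0 = "subtopology K (\<Union>c\<in>E0. open_cell c)"
  obtain U0 where U0: "openin Z U0" "U = D \<inter> U0" using U(1) by (auto simp: openin_subtopology)
  have U0Z: "U0 \<subseteq> topspace Z" using U0 openin_subset by blast
  have "continuous_map (subtopology (subtopology Z U0) (D \<inter> U0)) ?K0 f"
  proof (rule continuous_map_to_subtopologyI)
    show "continuous_map (subtopology (subtopology Z U0) (D \<inter> U0)) K f"
      unfolding subtopology_subtopology by (rule continuous_map_from_subtopology_mono[OF f]) auto
  qed (use U U0 in auto)
  moreover have "closedin (subtopology Z U0) (D \<inter> U0)" using D by (auto simp: closedin_subtopology)
  ultimately obtain U1 g where g: "openin (subtopology Z U0) U1" "D \<inter> U0 \<subseteq> U1"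
    "continuous_map (subtopology (subtopology Z U0) U1) ?K0 g" "\<forall>z\<in>D \<inter> U0. g z = f z"
    using nbhd_extensorE[OF subcomplex_nbhd_extensor[OF U(3)] Zsub[of U0], of "D \<inter> U0" f thesis] by blast
  have U1: "openin Z U1" "U1 \<subseteq> U0" using openin_trans_full[OF g(1) U0(1)] openin_subset[OF g(1)] by auto
  have "closedin Z Q" using compactin_imp_closedin Q(1) Z metrizable_imp_Hausdorff_space by blast
  obtain V where V: "openin Z V" "Q \<subseteq> V" "Z closure_of V \<subseteq> U1"
  proof -
    have "Q \<subseteq> U1" using g(2) U(2) U0(2) by blast
    then show thesis
      using normal_space_alt[THEN iffD1, OF metrizable_imp_normal_space[OF Z], rule_format, of Q U1]
        \<open>closedin Z Q\<close> U1(1) that by blast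
  qed
  let ?W = "Z closure_of V"
  have gc: "continuous_map (subtopology Z ?W) K g"
  proof -
    have "continuous_map (subtopology Z U1) K g" using g(3) U1 by (simp add: continuous_map_in_subtopology subtopology_subtopology Int_absorb1)
    then show ?thesis by (rule continuous_map_from_subtopology_mono) (rule V)
  qed
  show thesis
  proof (rule that[of V ?W "\<lambda>z. if z \<in> D then f z else g z"])
    show "continuous_map (subtopology Z (D \<union> ?W)) K (\<lambda>z. if z \<in> D then f z else g z)"
      by (rule continuous_map_paste_closed[OF D _ f gc]) (use V U1 g(4) in auto)
    show "V \<subseteq> ?W" using V(1) by (simp add: closure_of_subset openin_subset)
    show "openin Z V" "Q \<subseteq> V" by (fact V)+
    show "closedin Z ?W" by simp
    show "(if z \<in> D then f z else g z) = f z" if "z \<in> D" for z using that by simp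
  qed
qed

end

section \<open>Extensional dimension of unions and of maps to the line\<close>

lemma e_dim_leE:
  assumes "e_dim_le Z K" "closedin Z C" "continuous_map (subtopology Z C) K f"
  obtains g where "continuous_map Z K g" "\<And>z. z \<in> C \<Longrightarrow> g z = f z"
  using assms(1)[unfolded e_dim_le_def, rule_format, of C f] assms(2,3) that by blast

lemma e_dim_le_closed_subset:
  assumes "e_dim_le Z K" "closedin Z C"
  shows "e_dim_le (subtopology Z C) K"
  unfolding e_dim_le_def
proof (intro allI impI, elim conjE)
  fix C' f assume C': "closedin (subtopology Z C) C'"
    and f: "continuous_map (subtopology (subtopology Z C) C') K f"
  have sub: "C' \<subseteq> C" using closedin_subset[OF C'] by auto
  have "continuous_map (subtopology Z C') K f"
    using f sub by (simp add: subtopology_subtopology Int_absorb1)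
  then obtain g where "continuous_map Z K g" "\<And>z. z \<in> C' \<Longrightarrow> g z = f z"
    using e_dim_leE[OF assms(1) closedin_trans_full[OF C' assms(2)]] by blast
  then show "\<exists>g. continuous_map (subtopology Z C) K g \<and> (\<forall>z\<in>C'. g z = f z)"
    using continuous_map_from_subtopology by blast
qed

text \<open>
  A partial map on \<open>Y\<close> is extended by pulling it back along \<open>p\<close>, extending, and restricting along
  the section \<open>q\<close>.
\<close>
lemma e_dim_le_retract:
  assumes X: "e_dim_le X K" and p: "continuous_map X Y p" and q: "continuous_map Y X q"
    and pq: "\<And>y. y \<in> topspace Y \<Longrightarrow> p (q y) = y"
  shows "e_dim_le Y K"
  unfolding e_dim_le_def
proof (intro allI impI, elim conjE)
  fix C f assume C: "closedin Y C" and f: "continuous_map (subtopology Y C) K f"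
  let ?C = "{x \<in> topspace X. p x \<in> C}"
  have "continuous_map (subtopology X ?C) (subtopology Y C) p"
    by (rule continuous_map_to_subtopologyI[OF continuous_map_from_subtopology[OF p]]) auto
  from continuous_map_compose[OF this f]
  obtain g where g: "continuous_map X K g" "\<And>x. x \<in> ?C \<Longrightarrow> g x = (f \<circ> p) x"
    using e_dim_leE[OF X closedin_continuous_map_preimage[OF p C], of "f \<circ> p"] by blast
  have "(g \<circ> q) y = f y" if "y \<in> C" for y
  proof -
    have "y \<in> topspace Y" using that C closedin_subset by blast
    then show ?thesis using g(2)[of "q y"] pq[of y] q that by (auto simp: continuous_map_def Pi_iff)
  qed
  then show "\<exists>g. continuous_map Y K g \<and> (\<forall>z\<in>C. g z = f z)"
    using continuous_map_compose[OF q g(1)] by blast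
qed

text \<open>
  The inductive step of the sum theorem: a partial map extends over \<open>Q\<close> since the extensional dimension
  of \<open>Q\<close> is bounded, and then over a neighbourhood of \<open>Q\<close>.
\<close>
lemma extend_over_compact_nbhd:
  assumes CW: "CW_structure K E" and Z: "metrizable_space Z"
    and D: "closedin Z D" and g: "continuous_map (subtopology Z D) K g"
    and Q: "compactin Z Q" "e_dim_le (subtopology Z Q) K"
  obtains D' g' V where "closedin Z D'" "D \<subseteq> D'" "continuous_map (subtopology Z D') K g'"
    "\<And>z. z \<in> D \<Longrightarrow> g' z = g z" "openin Z V" "Q \<subseteq> V" "V \<subseteq> D'"
proof -
  have clQ: "closedin Z Q" by (rule compactin_imp_closedin[OF metrizable_imp_Hausdorff_space[OF Z] Q(1)])
  have "closedin (subtopology Z Q) (D \<inter> Q)" using D by (auto simp: closedin_subtopology)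
  moreover have "continuous_map (subtopology (subtopology Z Q) (D \<inter> Q)) K g"
    unfolding subtopology_subtopology by (rule continuous_map_from_subtopology_mono[OF g]) auto
  ultimately obtain h where h: "continuous_map (subtopology Z Q) K h" "\<And>z. z \<in> D \<inter> Q \<Longrightarrow> h z = g z"
    using e_dim_leE[OF Q(2)] by blast
  let ?k = "\<lambda>z. if z \<in> D then g z else h z"
  have k: "continuous_map (subtopology Z (D \<union> Q)) K ?k"
    by (rule continuous_map_paste_closed[OF D clQ g h(1)]) (simp add: h(2))
  obtain V W g' where V: "openin Z V" "closedin Z W" "Q \<subseteq> V" "V \<subseteq> W"
    "continuous_map (subtopology Z (D \<union> Q \<union> W)) K g'" "\<And>z. z \<in> D \<union> Q \<Longrightarrow> g' z = ?k z"
    by (rule extend_near_compact[OF CW Z closedin_Un[OF D clQ] k Q(1)]) auto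
  show thesis
  proof (rule that[of "D \<union> Q \<union> W" g' V])
    show "closedin Z (D \<union> Q \<union> W)" using D clQ V(2) by blast
    show "V \<subseteq> D \<union> Q \<union> W" using V(4) by blast
    show "g' z = g z" if "z \<in> D" for z using V(6)[of z] that by simp
  qed (use V in blast)+
qed

text \<open>
  The compact pieces are absorbed one by one, each with a neighbourhood. The neighbourhoods make the
  union of the partial extensions continuous.
\<close>
lemma e_dim_le_countable_union:
  fixes A :: "nat \<Rightarrow> 'z set"
  assumes CW: "CW_structure K E" and Z: "metrizable_space Z"
    and A: "topspace Z \<subseteq> (\<Union>i. A i)" "\<And>i. compactin Z (A i)" "\<And>i. e_dim_le (subtopology Z (A i)) K"
  shows "e_dim_le Z K"
  unfolding e_dim_le_def
proof (intro allI impI, elim conjE)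
  fix C f assume C: "closedin Z C" and f: "continuous_map (subtopology Z C) K f"
  let ?P = "\<lambda>(D, g). closedin Z D \<and> continuous_map (subtopology Z D) K g \<and> C \<subseteq> D \<and> (\<forall>z\<in>C. g z = f z)"
  let ?Q = "\<lambda>n (D, g) (D', g'). D \<subseteq> D' \<and> (\<forall>z\<in>D. g' z = g z) \<and> (\<exists>V. openin Z V \<and> A n \<subseteq> V \<and> V \<subseteq> D')"
  have "\<exists>F. \<forall>n::nat. ?P (F n) \<and> ?Q n (F n) (F (Suc n))"
  proof (rule dependent_nat_choice)
    show "\<exists>x. ?P x" using C f by (intro exI[of _ "(C, f)"]) simp
    fix x n assume x: "?P x"
    obtain D g where Dg: "x = (D, g)" by fastforce
    obtain D' g' V where "closedin Z D'" "D \<subseteq> D'" "continuous_map (subtopology Z D') K g'"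
      "\<And>z. z \<in> D \<Longrightarrow> g' z = g z" "openin Z V" "A n \<subseteq> V" "V \<subseteq> D'"
      by (rule extend_over_compact_nbhd[OF CW Z _ _ A(2,3)]) (use x Dg in auto)
    then show "\<exists>y. ?P y \<and> ?Q n x y"
      using x Dg by (intro exI[of _ "(D', g')"]) (auto dest: subsetD)
  qed
  then obtain F where F0: "\<forall>n::nat. ?P (F n) \<and> ?Q n (F n) (F (Suc n))" ..
  note F = F0[rule_format, THEN conjunct1] F0[rule_format, THEN conjunct2]
  define D where "D n = fst (F n)" for n
  define g where "g n = snd (F n)" for n
  have P: "closedin Z (D n)" "continuous_map (subtopology Z (D n)) K (g n)" "C \<subseteq> D n" "\<And>z. z \<in> C \<Longrightarrow> g n z = f z" for n
    using F(1)[of n] by (auto simp: D_def g_def split: prod.splits)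
  have Q: "D n \<subseteq> D (Suc n)" "\<And>z. z \<in> D n \<Longrightarrow> g (Suc n) z = g n z" "\<exists>V. openin Z V \<and> A n \<subseteq> V \<and> V \<subseteq> D (Suc n)" for n
    using F(2)[of n] by (auto simp: D_def g_def split: prod.splits)
  obtain V where V: "\<And>n. openin Z (V n)" "\<And>n. A n \<subseteq> V n" "\<And>n. V n \<subseteq> D (Suc n)" using Q(3) by metis
  have mono: "m \<le> n \<Longrightarrow> D m \<subseteq> D n \<and> (\<forall>z\<in>D m. g n z = g m z)" for m n
  proof (induction n rule: dec_induct)
    case (step n)
    have "g (Suc n) z = g m z" if "z \<in> D m" for z
    proof -
      have "z \<in> D n" using step.IH that by blast
      from Q(2)[OF this] show ?thesis using step.IH that by simp
    qed
    then show ?case using step.IH Q(1)[of n] by blast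
  qed auto
  have agree: "g m z = g n z" if "z \<in> D m" "z \<in> D n" for m n z
    using mono[of m n] mono[of n m] that by (metis nat_le_linear)
  obtain h where h: "continuous_map Z K h" "\<And>z n. z \<in> topspace Z \<inter> V n \<Longrightarrow> h z = g (Suc n) z"
  proof (rule pasting_lemma_exists[where X=Z and Y=K and I=UNIV and T=V and f="\<lambda>n. g (Suc n)"])
    show "topspace Z \<subseteq> \<Union> (range V)" using A(1) V(2) by blast
    show "continuous_map (subtopology Z (V i)) K (g (Suc i))" for i
      by (rule continuous_map_from_subtopology_mono[OF P(2) V(3)])
    show "g (Suc i) x = g (Suc j) x" if "x \<in> topspace Z \<inter> V i \<inter> V j" for i j x
      using that V(3) agree by blast
  qed (use V that in auto)
  have "h z = f z" if "z \<in> C" for z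
  proof -
    have z: "z \<in> topspace Z" using that closedin_subset[OF C] by blast
    then obtain n where "z \<in> V n" using A(1) V(2) by blast
    then have "h z = g (Suc n) z" using h(2) z by blast
    then show ?thesis using P(4)[OF that] by simp
  qed
  then show "\<exists>g. continuous_map Z K g \<and> (\<forall>z\<in>C. g z = f z)" using h(1) by blast
qed

text \<open>
  An extension over a fiber of \<open>p\<close> extends over a neighbourhood of it, and, the space being compact, over
  the preimage of an open interval. Its ends can be chosen off the image of \<open>p\<close>, so the preimage is also
  closed. Finitely many such preimages cover, and can be made disjoint.
\<close>
lemma e_dim_le_map_to_line:
  fixes p :: "'z \<Rightarrow> real"
  assumes CW: "CW_structure K E" and Z: "metrizable_space Z" "compact_space Z"
    and p: "continuous_map Z euclideanreal p"
    and gaps: "\<And>a b. a < b \<Longrightarrow> \<exists>c. a < c \<and> c < b \<and> c \<notin> p ` topspace Z"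
    and fib: "\<And>c. c \<in> p ` topspace Z \<Longrightarrow> e_dim_le (subtopology Z {z \<in> topspace Z. p z = c}) K"
  shows "e_dim_le Z K"
  unfolding e_dim_le_def
proof (intro allI impI, elim conjE)
  fix C f assume C: "closedin Z C" and f: "continuous_map (subtopology Z C) K f"
  have pre: "openin Z {z \<in> topspace Z. p z \<in> S}" if "open S" for S
    using openin_continuous_map_preimage[OF p, of S] that by simp
  have "\<exists>r s g. r < c \<and> c < s \<and> r \<notin> p ` topspace Z \<and> s \<notin> p ` topspace Z \<and>
      continuous_map (subtopology Z {z \<in> topspace Z. p z \<in> {r<..<s}}) K g \<and>
      (\<forall>z\<in>C. p z \<in> {r<..<s} \<longrightarrow> g z = f z)" if c: "c \<in> p ` topspace Z" for c
  proof -
    let ?Q = "{z \<in> topspace Z. p z = c}"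
    have "closedin Z {z \<in> topspace Z. p z \<in> {c}}" by (rule closedin_continuous_map_preimage[OF p]) simp
    then have "compactin Z ?Q" using Z(2) by (simp add: closedin_compact_space)
    then obtain D g V where g: "closedin Z D" "C \<subseteq> D" "continuous_map (subtopology Z D) K g"
      "\<And>z. z \<in> C \<Longrightarrow> g z = f z" "openin Z V" "?Q \<subseteq> V" "V \<subseteq> D"
      by (rule extend_over_compact_nbhd[OF CW Z(1) C f _ fib[OF c]]) (rule that; assumption)
    have "compactin Z (topspace Z - V)" using Z(2) g(5) by (simp add: closedin_compact_space closedin_diff)
    then have "compact (p ` (topspace Z - V))" using image_compactin[OF _ p] by fastforce
    then have "open (- p ` (topspace Z - V))" using compact_imp_closed by blast
    moreover have "c \<in> - p ` (topspace Z - V)" using g(6) by auto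
    ultimately obtain e where e: "e > 0" "ball c e \<subseteq> - p ` (topspace Z - V)" by (metis open_contains_ball)
    obtain r where r: "c - e < r" "r < c" "r \<notin> p ` topspace Z" using gaps[of "c - e" c] e by auto
    obtain s where s: "c < s" "s < c + e" "s \<notin> p ` topspace Z" using gaps[of c "c + e"] e by auto
    have "{z \<in> topspace Z. p z \<in> {r<..<s}} \<subseteq> D"
    proof
      fix z assume z: "z \<in> {z \<in> topspace Z. p z \<in> {r<..<s}}"
      then have "p z \<in> ball c e" using r s by (auto simp: dist_real_def)
      then have "z \<in> V" using e(2) z by blast
      then show "z \<in> D" using g(7) by blast
    qed
    then have "continuous_map (subtopology Z {z \<in> topspace Z. p z \<in> {r<..<s}}) K g"
      by (rule continuous_map_from_subtopology_mono[OF g(3)])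
    then show ?thesis using r s g(4) by blast
  qed
  then have "\<forall>c\<in>p ` topspace Z. \<exists>r s g. r < c \<and> c < s \<and> r \<notin> p ` topspace Z \<and> s \<notin> p ` topspace Z \<and>
      continuous_map (subtopology Z {z \<in> topspace Z. p z \<in> {r<..<s}}) K g \<and>
      (\<forall>z\<in>C. p z \<in> {r<..<s} \<longrightarrow> g z = f z)" by blast
  from bchoice[OF this] obtain r where "\<forall>c\<in>p ` topspace Z. \<exists>s g. r c < c \<and> c < s \<and> r c \<notin> p ` topspace Z \<and> s \<notin> p ` topspace Z \<and>
      continuous_map (subtopology Z {z \<in> topspace Z. p z \<in> {r c<..<s}}) K g \<and>
      (\<forall>z\<in>C. p z \<in> {r c<..<s} \<longrightarrow> g z = f z)" ..
  from bchoice[OF this] obtain s where "\<forall>c\<in>p ` topspace Z. \<exists>g. r c < c \<and> c < s c \<and> r c \<notin> p ` topspace Z \<and> s c \<notin> p ` topspace Z \<and>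
      continuous_map (subtopology Z {z \<in> topspace Z. p z \<in> {r c<..<s c}}) K g \<and>
      (\<forall>z\<in>C. p z \<in> {r c<..<s c} \<longrightarrow> g z = f z)" ..
  from bchoice[OF this] obtain g where g: "\<forall>c\<in>p ` topspace Z. r c < c \<and> c < s c \<and> r c \<notin> p ` topspace Z \<and> s c \<notin> p ` topspace Z \<and>
      continuous_map (subtopology Z {z \<in> topspace Z. p z \<in> {r c<..<s c}}) K (g c) \<and>
      (\<forall>z\<in>C. p z \<in> {r c<..<s c} \<longrightarrow> g c z = f z)" ..
  have "compact (p ` topspace Z)" using Z(2) image_compactin[OF _ p] by (fastforce simp: compact_space_def)
  moreover have "\<And>c. c \<in> p ` topspace Z \<Longrightarrow> open {r c<..<s c}" by simp
  moreover have "p ` topspace Z \<subseteq> (\<Union>c\<in>p ` topspace Z. {r c<..<s c})" using g by fastforce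
  ultimately obtain A where A: "A \<subseteq> p ` topspace Z" "finite A" "p ` topspace Z \<subseteq> (\<Union>c\<in>A. {r c<..<s c})"
    by (rule compactE_image)
  define W where "W c = {z \<in> topspace Z. p z \<in> {r c<..<s c}}" for c
  define T where "T c = W c - (\<Union>c'\<in>{c'\<in>A. c' < c}. W c')" for c
  have Wo: "openin Z (W c)" for c unfolding W_def by (rule pre) simp
  have Wc: "closedin Z (W c)" if "c \<in> A" for c
  proof -
    have "W c = {z \<in> topspace Z. p z \<in> {r c..s c}}"
    proof -
      have "c \<in> p ` topspace Z" using that A(1) by blast
      then have "r c \<notin> p ` topspace Z" "s c \<notin> p ` topspace Z" using g by auto
      then have ne: "p z \<noteq> r c \<and> p z \<noteq> s c" if "z \<in> topspace Z" for z
        using that by (metis imageI)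
      have "p z \<in> {r c<..<s c} \<longleftrightarrow> p z \<in> {r c..s c}" if "z \<in> topspace Z" for z
        using ne[OF that] by (auto simp: order_less_le)
      then show ?thesis unfolding W_def by blast
    qed
    then show ?thesis using closedin_continuous_map_preimage[OF p, of "{r c..s c}"] by simp
  qed
  have least: "\<exists>c\<in>A. z \<in> T c" if z: "z \<in> topspace Z" for z
  proof -
    define B where "B = {c \<in> A. z \<in> W c}"
    have "p z \<in> (\<Union>c\<in>A. {r c<..<s c})" using A(3) z by blast
    then have B: "finite B" "B \<noteq> {}" using A(2) z unfolding B_def W_def by auto
    obtain c where c: "c \<in> B" "\<And>c'. c' \<in> B \<Longrightarrow> c \<le> c'"
      using Min_in[OF B] Min_le[OF B(1)] by blast
    have "z \<notin> W c'" if "c' \<in> A" "c' < c" for c'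
      using c(2)[of c'] that unfolding B_def by force
    then have "z \<in> T c" using c(1) unfolding T_def B_def by blast
    then show ?thesis using c(1) unfolding B_def by blast
  qed
  obtain h where h: "continuous_map Z K h" "\<And>z c. c \<in> A \<Longrightarrow> z \<in> topspace Z \<inter> T c \<Longrightarrow> h z = g c z"
  proof (rule pasting_lemma_exists[where X=Z and Y=K and I=A and T=T and f=g])
    show "topspace Z \<subseteq> \<Union> (T ` A)" using least by blast
    show "openin Z (T c)" if "c \<in> A" for c
      unfolding T_def using A(2) Wc by (intro openin_diff Wo closedin_Union) auto
    show "continuous_map (subtopology Z (T c)) K (g c)" if "c \<in> A" for c
    proof (rule continuous_map_from_subtopology_mono)
      show "continuous_map (subtopology Z (W c)) K (g c)" using g that A(1) unfolding W_def by (metis subsetD)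
    qed (auto simp: T_def)
    show "g c z = g c' z" if "c \<in> A" "c' \<in> A" "z \<in> topspace Z \<inter> T c \<inter> T c'" for c c' z
    proof -
      have "\<not> c < c'" "\<not> c' < c" using that unfolding T_def by blast+
      then have "c = c'" by simp
      then show ?thesis by simp
    qed
  qed (use that in blast)+
  have "h z = f z" if "z \<in> C" for z
  proof -
    have z: "z \<in> topspace Z" using that closedin_subset[OF C] by blast
    obtain c where c: "c \<in> A" "z \<in> T c" using least[OF z] by blast
    then have "h z = g c z" using h(2) z by blast
    moreover have "p z \<in> {r c<..<s c}" using c(2) unfolding T_def W_def by blast
    moreover have "c \<in> p ` topspace Z" using c(1) A(1) by blast
    ultimately show ?thesis using bspec[OF g, of c] that by simp
  qed
  then show "\<exists>g. continuous_map Z K g \<and> (\<forall>z\<in>C. g z = f z)" using h(1) by blast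
qed

section \<open>Compacta projecting with zero-dimensional fibers\<close>

text \<open>
  Compactness: the height difference has a positive minimum on the compact set of pairs of
  points with the same base, one in \<open>C\<close> and the other outside \<open>V\<close>.
\<close>
lemma vertical_room:
  assumes F: "compact_space F" 
    and C: "closedin (prod_topology F unit_interval) C" and V: "openin (prod_topology F unit_interval) V" "C \<subseteq> V"
  obtains e where "e > 0" "\<And>x s s'. \<lbrakk>(x, s) \<in> C; s' \<in> {0..1}; \<bar>s - s'\<bar> < e\<rbrakk> \<Longrightarrow> (x, s') \<in> V"
proof -
  let ?P = "prod_topology F unit_interval"
  let ?Q = "prod_topology ?P unit_interval"
  have cI: "compact_space unit_interval" by (simp add: compact_space_subtopology)
  have cP: "compact_space ?P" using F cI by (simp add: compact_space_prod_topology)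
  have cQ: "compact_space ?Q" using cP cI by (simp add: compact_space_prod_topology)
  have c1: "continuous_map ?Q ?P (\<lambda>q. (fst (fst q), snd q))"
    using continuous_map_compose[OF continuous_map_fst continuous_map_fst, of F unit_interval unit_interval]
    by (intro continuous_map_pairedI continuous_map_snd) (simp add: o_def)
  have c2: "continuous_map ?Q ?P fst" by (rule continuous_map_fst)
  define B where "B = {q \<in> topspace ?Q. fst q \<in> C} \<inter> {q \<in> topspace ?Q. (fst (fst q), snd q) \<in> topspace ?P - V}"
  have "closedin ?Q B" unfolding B_def
    by (intro closedin_Int closedin_continuous_map_preimage[OF c2] closedin_continuous_map_preimage[OF c1] C)
       (use V in blast)
  then have B: "compactin ?Q B" using cQ closedin_compact_space by blast
  have "continuous_map ?Q euclideanreal (\<lambda>q. \<bar>snd (fst q) - snd q\<bar>)"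
  proof -
    have "continuous_map ?Q unit_interval (\<lambda>q. snd (fst q))" "continuous_map ?Q unit_interval snd"
      using continuous_map_compose[OF continuous_map_fst continuous_map_snd, of F unit_interval unit_interval]
      by (auto simp: o_def continuous_map_snd)
    then have "continuous_map ?Q euclideanreal (\<lambda>q. snd (fst q))" "continuous_map ?Q euclideanreal snd"
      by (auto simp: continuous_map_in_subtopology)
    then show ?thesis by (intro continuous_intros)
  qed
  from image_compactin[OF B this] have "compact ((\<lambda>q. \<bar>snd (fst q) - snd q\<bar>) ` B)" by simp
  then have "open (- (\<lambda>q. \<bar>snd (fst q) - snd q\<bar>) ` B)" using compact_imp_closed by blast
  moreover have "0 \<in> - (\<lambda>q. \<bar>snd (fst q) - snd q\<bar>) ` B"
  proof
    assume "0 \<in> (\<lambda>q. \<bar>snd (fst q) - snd q\<bar>) ` B"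
    then obtain x s s' where q: "((x, s), s') \<in> B" "s = s'" by force
    then have "(x, s) \<in> C" "(x, s') \<notin> V" unfolding B_def by auto
    then show False using q(2) V(2) by blast
  qed
  ultimately obtain e where e: "e > 0" "ball 0 e \<subseteq> - (\<lambda>q. \<bar>snd (fst q) - snd q\<bar>) ` B"
    by (metis open_contains_ball)
  show thesis
  proof (rule that[OF e(1)])
    fix x s s' assume *: "(x, s) \<in> C" "s' \<in> {0..1}" "\<bar>s - s'\<bar> < e"
    show "(x, s') \<in> V"
    proof (rule ccontr)
      assume "(x, s') \<notin> V"
      moreover have "(x, s) \<in> topspace ?P" using * closedin_subset[OF C] by blast
      ultimately have "((x, s), s') \<in> B" using * unfolding B_def by auto
      then have "\<bar>s - s'\<bar> \<in> (\<lambda>q. \<bar>snd (fst q) - snd q\<bar>) ` B" by force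
      moreover have "\<bar>s - s'\<bar> \<in> ball 0 e" using * by simp
      ultimately show False using e(2) by blast
    qed
  qed
qed

text \<open>
  With one cutting point in each of the \<open>N\<close> intervals of length \<open>1/N\<close>, the number of cutting points
  below \<open>s\<close> is \<open>N * s\<close> up to \<open>1\<close>.
\<close>
lemma count_below_close:
  fixes r :: "nat \<Rightarrow> real"
  assumes N: "N > 0" and r: "\<And>j. j < N \<Longrightarrow> real j / real N < r j \<and> r j < real (Suc j) / real N"
    and s: "0 \<le> s" "s \<le> 1"
  shows "\<bar>real (card {j. j < N \<and> r j < s}) / real N - s\<bar> \<le> 1 / real N"
proof -
  have mono: "r i < r j" if "i < j" "j < N" for i j
  proof -
    have "r i < real (Suc i) / real N" using r that by auto
    also have "\<dots> \<le> real j / real N" using that by (intro divide_right_mono) auto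
    also have "\<dots> < r j" using r that by auto
    finally show ?thesis .
  qed
  let ?S = "{j. j < N \<and> r j < s}"
  define m where "m = card ?S"
  have fin: "finite ?S" by simp
  have down: "i \<in> ?S" if "j \<in> ?S" "i \<le> j" for i j
    using that mono[of i j] by (cases "i = j") auto
  have S: "?S = {..<m}"
  proof -
    have "\<exists>k. ?S = {..<k}"
    proof (cases "?S = {}")
      case True
      then show ?thesis by (intro exI[of _ 0]) simp
    next
      case False
      have "?S = {..<Suc (Max ?S)}"
      proof
        show "?S \<subseteq> {..<Suc (Max ?S)}" using Max_ge[OF fin] by (auto simp: less_Suc_eq_le)
        show "{..<Suc (Max ?S)} \<subseteq> ?S"
        proof
          fix i assume "i \<in> {..<Suc (Max ?S)}"
          then have "i \<le> Max ?S" by simp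
          then show "i \<in> ?S" by (rule down[OF Max_in[OF fin False]])
        qed
      qed
      then show ?thesis by blast
    qed
    then obtain k where k: "?S = {..<k}" ..
    then have "m = k" unfolding m_def by simp
    then show ?thesis using k by simp
  qed
  have Npos: "real N > 0" using N by simp
  have "m \<le> N" using card_mono[of "{..<N}" ?S] unfolding m_def by auto
  have lo: "real m - 1 \<le> s * N"
  proof (cases m)
    case (Suc k)
    then have "k \<in> ?S" using S by auto
    then have "real k / real N < s" using r[of k] by auto
    then show ?thesis using Suc Npos by (simp add: field_simps)
  next
    case 0
    have "0 \<le> s * real N" using s by simp
    then show ?thesis using 0 by simp
  qed
  have hi: "s * N \<le> real m + 1"
  proof (cases "m < N")
    case True
    then have "m \<notin> ?S" using S by auto
    then have "s \<le> r m" using True by auto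
    also have "\<dots> < real (Suc m) / real N" using r True by auto
    finally show ?thesis using Npos by (simp add: field_simps)
  next
    case False
    then have "m = N" using \<open>m \<le> N\<close> by simp
    moreover have "s * real N \<le> 1 * real N" using s Npos by (intro mult_right_mono) auto
    ultimately show ?thesis by simp
  qed
  have "real m / real N - s = (real m - s * N) / N" using Npos by (simp add: field_simps)
  moreover have "\<bar>(real m - s * N) / N\<bar> \<le> 1 / N"
    using lo hi Npos by (simp add: abs_divide divide_right_mono abs_le_iff)
  ultimately show ?thesis by (simp add: m_def)
qed

text \<open>
  Near each point of \<open>F\<close> there are cutting heights, one in each interval of length \<open>1/N\<close>, that miss the
  sections of \<open>Z\<close>. Counting the cutting heights below a point of \<open>Z\<close> is locally constant, and
  approximates the height by \<open>count_below_close\<close>. Averaging these step functions with a partition of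
  unity on \<open>F\<close> gives \<open>q2\<close>. Since the counts take finitely many values, so do the possible averages, as
  functions on \<open>F\<close>.
\<close>
lemma step_approximation:
  assumes F: "compact_space F" "metrizable_space F"
    and Z: "closedin (prod_topology F unit_interval) Z"
    and light: "\<And>x a b. x \<in> topspace F \<Longrightarrow> a < b \<Longrightarrow> \<exists>s. a < s \<and> s < b \<and> (x, s) \<notin> Z"
    and N: "(N::nat) > 0"
  obtains \<Phi> q2 where "finite \<Phi>" "\<Phi> \<noteq> {}" "\<And>\<phi>. \<phi> \<in> \<Phi> \<Longrightarrow> continuous_map F unit_interval \<phi>"
    "continuous_map (subtopology (prod_topology F unit_interval) Z) euclideanreal q2"
    "\<And>z. z \<in> Z \<Longrightarrow> \<bar>q2 z - snd z\<bar> \<le> 1 / real N"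
    "\<And>z. z \<in> Z \<Longrightarrow> \<exists>\<phi>\<in>\<Phi>. q2 z = \<phi> (fst z)"
proof -
  let ?P = "prod_topology F unit_interval"
  have ZP: "Z \<subseteq> topspace ?P" using closedin_subset[OF Z] .
  have sndP: "continuous_map ?P euclideanreal snd"
    using continuous_map_snd[of F unit_interval] by (simp add: continuous_map_in_subtopology)
  have "\<exists>r. real j / real N < r \<and> r < real (Suc j) / real N \<and> (x, r) \<notin> Z" if "x \<in> topspace F" for x j
    by (rule light[OF that]) (use N in \<open>simp add: divide_strict_right_mono\<close>)
  then obtain \<rho> where \<rho>: "\<And>x j. x \<in> topspace F \<Longrightarrow> real j / real N < \<rho> x j"
    "\<And>x j. x \<in> topspace F \<Longrightarrow> \<rho> x j < real (Suc j) / real N" "\<And>x j. x \<in> topspace F \<Longrightarrow> (x, \<rho> x j) \<notin> Z"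
    by metis
  have \<rho>I: "\<rho> x j \<in> {0..1}" if "x \<in> topspace F" "j < N" for x j
  proof -
    have "0 \<le> real j / real N" by simp
    moreover have "real (Suc j) / real N \<le> 1" using that(2) N by (simp add: field_simps)
    ultimately show ?thesis using \<rho>(1)[OF that(1), of j] \<rho>(2)[OF that(1), of j] unfolding atLeastAtMost_iff by linarith
  qed
  define Ob where "Ob x = {x' \<in> topspace F. \<forall>j<N. (x', \<rho> x j) \<notin> Z}" for x
  have Oo: "openin F (Ob x)" if x: "x \<in> topspace F" for x
  proof -
    have "openin F {x' \<in> topspace F. (x', \<rho> x j) \<in> topspace ?P - Z}" if "j < N" for j
    proof (rule openin_continuous_map_preimage)
      show "continuous_map F ?P (\<lambda>x'. (x', \<rho> x j))"
        using \<rho>I[OF x that] by (intro continuous_map_pairedI) auto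
      show "openin ?P (topspace ?P - Z)" using Z by blast
    qed
    then have "openin F (\<Inter>j\<in>{..<N}. {x' \<in> topspace F. (x', \<rho> x j) \<in> topspace ?P - Z})"
      using N by (intro openin_INT2) auto
    moreover have "(\<Inter>j\<in>{..<N}. {x' \<in> topspace F. (x', \<rho> x j) \<in> topspace ?P - Z}) = Ob x"
      using N \<rho>I[OF x] unfolding Ob_def by auto
    ultimately show ?thesis by simp
  qed
  have "\<exists>u. continuous_map F euclideanreal u \<and> u x = 1 \<and> (\<forall>x'\<in>topspace F - Ob x. u x' = 0)" if x: "x \<in> topspace F" for x
  proof -
    have "x \<in> Ob x" using x \<rho>(3) by (simp add: Ob_def)
    then have "closedin F (topspace F - Ob x)" "x \<in> topspace F - (topspace F - Ob x)" using Oo[OF x] x by auto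
    then obtain h where h: "continuous_map F (top_of_set {0..1::real}) h" "h x = 0" "h ` (topspace F - Ob x) \<subseteq> {1}"
      using metrizable_imp_completely_regular_space[OF F(2)] unfolding completely_regular_space_def by metis
    have "continuous_map F euclideanreal h" using h(1) by (simp add: continuous_map_in_subtopology)
    then have "continuous_map F euclideanreal (\<lambda>x. 1 - h x)" by (intro continuous_intros)
    then show ?thesis using h by (intro exI[of _ "\<lambda>x. 1 - h x"]) auto
  qed
  then obtain u where u: "\<And>x. x \<in> topspace F \<Longrightarrow> continuous_map F euclideanreal (u x)" "\<And>x. x \<in> topspace F \<Longrightarrow> u x x = 1"
    "\<And>x x'. x \<in> topspace F \<Longrightarrow> x' \<in> topspace F \<Longrightarrow> x' \<notin> Ob x \<Longrightarrow> u x x' = 0" by (metis DiffI)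
  have uo: "openin F {x' \<in> topspace F. u x x' \<in> {1/2<..}}" if "x \<in> topspace F" for x
    by (rule openin_continuous_map_preimage[OF u(1)[OF that]]) simp
  have "compactin F (topspace F)" using F(1) by (simp add: compact_space_def)
  then have "\<exists>\<F>. finite \<F> \<and> \<F> \<subseteq> (\<lambda>x. {x' \<in> topspace F. u x x' \<in> {1/2<..}}) ` topspace F \<and> topspace F \<subseteq> \<Union>\<F>"
    by (rule compactinD) (use uo u(2) in auto)
  then obtain \<F> where \<F>: "finite \<F>" "\<F> \<subseteq> (\<lambda>x. {x' \<in> topspace F. u x x' \<in> {1/2<..}}) ` topspace F" "topspace F \<subseteq> \<Union>\<F>"
    by blast
  obtain A where A0: "A \<subseteq> topspace F" "finite A" "\<F> = (\<lambda>x. {x' \<in> topspace F. u x x' \<in> {1/2<..}}) ` A"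
    using finite_subset_image[OF \<F>(1,2)] by blast
  have A: "finite A" "A \<subseteq> topspace F" "topspace F \<subseteq> (\<Union>x\<in>A. {x' \<in> topspace F. u x x' \<in> {1/2<..}})"
    using A0 \<F>(3) by simp_all
  \<comment> \<open>Where \<open>v a\<close> does not vanish, \<open>u a \<ge> 1/4\<close>; this closed condition keeps the points inside \<open>Ob a\<close>, on which
    the heights cut by \<open>\<rho> a\<close> avoid \<open>Z\<close>.\<close>
  define v where "v a x = max 0 (u a x - 1/4)" for a x
  define tot where "tot x = (\<Sum>a\<in>A. v a x)" for x
  have v0: "0 \<le> v a x" for a x by (simp add: v_def)
  have vc: "continuous_map F euclideanreal (v a)" if "a \<in> A" for a
    unfolding v_def using u(1)[of a] that A(2) by (intro continuous_intros) auto
  have totc: "continuous_map F euclideanreal tot" unfolding tot_def using vc A(1) by (intro continuous_map_sum) auto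
  have tot0: "0 < tot x" if xF: "x \<in> topspace F" for x
  proof -
    obtain a where a: "a \<in> A" "u a x > 1/2" using subsetD[OF A(3) xF] by auto
    then have "0 < v a x" by (simp add: v_def)
    also have "v a x \<le> tot x" unfolding tot_def using A(1) a(1) v0 by (intro member_le_sum) auto
    finally show ?thesis .
  qed
  define \<phi> where "\<phi> J x = (\<Sum>a\<in>A. v a x * (real (J a) / real N)) / tot x" for J x
  define \<J> where "\<J> = PiE A (\<lambda>_. {..N})"
  have J: "finite \<J>" "\<J> \<noteq> {}" using A(1) by (auto simp: \<J>_def finite_PiE PiE_eq_empty_iff)
  have \<phi>I: "\<phi> J x \<in> {0..1}" if "J \<in> \<J>" "x \<in> topspace F" for J x
  proof -
    have Ja: "real (J a) / real N \<le> 1" "0 \<le> real (J a) / real N" if "a \<in> A" for a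
      using \<open>J \<in> \<J>\<close> that N by (auto simp: \<J>_def PiE_iff)
    have "(\<Sum>a\<in>A. v a x * (real (J a) / real N)) \<le> tot x"
      unfolding tot_def using Ja v0 by (intro sum_mono mult_left_le) auto
    moreover have "0 \<le> (\<Sum>a\<in>A. v a x * (real (J a) / real N))"
      using Ja v0 by (intro sum_nonneg mult_nonneg_nonneg) auto
    ultimately show ?thesis using tot0[OF that(2)] by (simp add: \<phi>_def)
  qed
  have \<phi>c: "continuous_map F unit_interval (\<phi> J)" if "J \<in> \<J>" for J
  proof (rule continuous_map_to_subtopologyI)
    show "continuous_map F euclideanreal (\<phi> J)" unfolding \<phi>_def
    proof (intro continuous_map_real_divide totc)
      show "continuous_map F euclideanreal (\<lambda>x. \<Sum>a\<in>A. v a x * (real (J a) / real N))"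
        using vc A(1) by (intro continuous_map_sum continuous_map_real_mult) auto
    qed (use tot0 in force)
  qed (use \<phi>I[OF that] in auto)
  define \<kappa> where "\<kappa> a s = card {j. j < N \<and> \<rho> a j < s}" for a s
  define q2 where "q2 z = (\<Sum>a\<in>A. if 1/4 \<le> u a (fst z) then v a (fst z) * (real (\<kappa> a (snd z)) / real N) else 0) / tot (fst z)" for z
  have q2eq: "q2 z = (\<Sum>a\<in>A. v a (fst z) * (real (\<kappa> a (snd z)) / real N)) / tot (fst z)" for z
    unfolding q2_def by (intro arg_cong2[where f="(/)"] sum.cong) (auto simp: v_def)
  have ZF: "fst z \<in> topspace F" "snd z \<in> {0..1}" if "z \<in> Z" for z using that ZP by auto
  have fstZ: "continuous_map (subtopology ?P Z) F fst" by (intro continuous_map_from_subtopology continuous_map_fst)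
  have sndZ: "continuous_map (subtopology ?P Z) euclideanreal snd" by (rule continuous_map_from_subtopology[OF sndP])
  have comp: "continuous_map (subtopology ?P Z) euclideanreal (\<lambda>z. h (fst z))" if "continuous_map F euclideanreal h" for h
    using continuous_map_compose[OF fstZ that] by (simp add: o_def)
  have q2c: "continuous_map (subtopology ?P Z) euclideanreal q2"
    unfolding q2_def
  proof (intro continuous_map_real_divide comp[OF totc] continuous_map_sum A(1))
    show "tot (fst z) \<noteq> 0" if "z \<in> topspace (subtopology ?P Z)" for z
      using tot0[of "fst z"] ZF[of z] that by auto
    fix a assume a: "a \<in> A"
    then have aF: "a \<in> topspace F" using A(2) by blast
    show "continuous_map (subtopology ?P Z) euclideanreal
        (\<lambda>z. if 1/4 \<le> u a (fst z) then v a (fst z) * (real (\<kappa> a (snd z)) / real N) else 0)"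
    proof (rule continuous_map_cases_le[where p="\<lambda>_. 1/4" and q="\<lambda>z. u a (fst z)"])
      show "continuous_map (subtopology ?P Z) euclideanreal (\<lambda>z. u a (fst z))" by (rule comp[OF u(1)[OF aF]])
      let ?S = "{z \<in> topspace (subtopology ?P Z). 1/4 \<le> u a (fst z)}"
      let ?T = "subtopology (subtopology ?P Z) ?S"
      have ind: "continuous_map ?T euclideanreal (\<lambda>z. if \<rho> a j < snd z then 1 else 0)" if j: "j < N" for j
      proof (rule continuous_map_cases_lt[where p="\<lambda>_. \<rho> a j" and q=snd])
        show "continuous_map ?T euclideanreal snd" by (rule continuous_map_from_subtopology[OF sndZ])
        fix z assume z: "z \<in> topspace ?T" "\<rho> a j = snd z"
        then have zZ: "z \<in> Z" "1/4 \<le> u a (fst z)" by auto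
        then have "fst z \<in> Ob a" using u(3)[OF aF, of "fst z"] ZF(1)[of z] by force
        then have "(fst z, \<rho> a j) \<notin> Z" using j by (simp add: Ob_def)
        then show "1 = (0::real)" using z(2) zZ(1) by simp
      qed auto
      have "real (\<kappa> a s) = (\<Sum>j<N. if \<rho> a j < s then 1 else 0)" for s
      proof -
        have "{j. j < N \<and> \<rho> a j < s} = {..<N} \<inter> {j. \<rho> a j < s}" by auto
        then show ?thesis by (simp add: \<kappa>_def sum.If_cases)
      qed
      moreover have "continuous_map ?T euclideanreal (\<lambda>z. \<Sum>j<N. if \<rho> a j < snd z then 1 else 0)"
        by (intro continuous_map_sum ind) auto
      ultimately have kc: "continuous_map ?T euclideanreal (\<lambda>z. real (\<kappa> a (snd z)))" by simp
      show "continuous_map ?T euclideanreal (\<lambda>z. v a (fst z) * (real (\<kappa> a (snd z)) / real N))"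
        using N by (intro continuous_map_real_mult continuous_map_real_divide kc
            continuous_map_from_subtopology[OF comp[OF vc[OF a]]]) auto
      show "v a (fst z) * (real (\<kappa> a (snd z)) / real N) = 0" if "1/4 = u a (fst z)" for z
        using that by (simp add: v_def)
    qed auto
  qed
  have near: "\<bar>q2 z - snd z\<bar> \<le> 1 / real N" if z: "z \<in> Z" for z
  proof -
    let ?x = "fst z" and ?s = "snd z"
    have t: "0 < tot ?x" using tot0 ZF(1)[OF z] by blast
    have k: "\<bar>real (\<kappa> a ?s) / real N - ?s\<bar> \<le> 1 / real N" if "a \<in> A" for a
      unfolding \<kappa>_def using that A(2) \<rho>(1,2) ZF(2)[OF z] by (intro count_below_close[OF N]) auto
    have "q2 z - ?s = (\<Sum>a\<in>A. v a ?x * (real (\<kappa> a ?s) / real N - ?s)) / tot ?x"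
    proof -
      have "(\<Sum>a\<in>A. v a ?x * (real (\<kappa> a ?s) / real N - ?s)) = (\<Sum>a\<in>A. v a ?x * (real (\<kappa> a ?s) / real N)) - tot ?x * ?s"
        unfolding tot_def by (simp add: right_diff_distrib sum_subtractf sum_distrib_right)
      then show ?thesis using t by (simp add: q2eq diff_divide_distrib)
    qed
    moreover have "\<bar>\<Sum>a\<in>A. v a ?x * (real (\<kappa> a ?s) / real N - ?s)\<bar> \<le> (\<Sum>a\<in>A. v a ?x * (1 / real N))"
    proof (rule order_trans[OF sum_abs sum_mono])
      fix a assume "a \<in> A"
      then show "\<bar>v a ?x * (real (\<kappa> a ?s) / real N - ?s)\<bar> \<le> v a ?x * (1 / real N)"
        unfolding abs_mult using k[of a] v0[of a ?x] by (intro mult_mono) auto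
    qed
    moreover have "(\<Sum>a\<in>A. v a ?x * (1 / real N)) = tot ?x * (1 / real N)"
      unfolding tot_def by (rule sum_distrib_right[symmetric])
    ultimately have "\<bar>q2 z - ?s\<bar> \<le> (tot ?x * (1 / real N)) / tot ?x"
      using t by (simp only: abs_divide abs_of_pos divide_right_mono less_imp_le)
    then show ?thesis using t by simp
  qed
  have graph: "\<exists>\<psi>\<in>\<phi> ` \<J>. q2 z = \<psi> (fst z)" if z: "z \<in> Z" for z
  proof -
    define Jz where "Jz = restrict (\<lambda>a. \<kappa> a (snd z)) A"
    have "\<kappa> a s \<le> N" for a s using card_mono[of "{..<N}" "{j. j < N \<and> \<rho> a j < s}"] by (auto simp: \<kappa>_def)
    then have Jz: "Jz \<in> \<J>" by (auto simp: Jz_def \<J>_def)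
    have "q2 z = \<phi> Jz (fst z)" unfolding q2eq \<phi>_def Jz_def by (intro arg_cong2[where f="(/)"] sum.cong) auto
    then show ?thesis using Jz by blast
  qed
  show thesis
  proof (rule that[of "\<phi> ` \<J>" q2])
    show "finite (\<phi> ` \<J>)" "\<phi> ` \<J> \<noteq> {}" using J by auto
    show "continuous_map F unit_interval \<psi>" if "\<psi> \<in> \<phi> ` \<J>" for \<psi> using that \<phi>c by auto
  qed (rule q2c near graph; assumption)+
qed

text \<open>
  Every graph is homeomorphic to \<open>F\<close>, and the sum theorem applies.
\<close>
lemma e_dim_le_graphs:
  assumes CW: "CW_structure K E" and F: "compact_space F" "metrizable_space F" "e_dim_le F K"
    and \<Phi>: "finite \<Phi>" "\<Phi> \<noteq> {}" "\<And>\<phi>. \<phi> \<in> \<Phi> \<Longrightarrow> continuous_map F unit_interval \<phi>"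
  shows "e_dim_le (subtopology (prod_topology F unit_interval) (\<Union>\<phi>\<in>\<Phi>. (\<lambda>x. (x, \<phi> x)) ` topspace F)) K"
proof -
  let ?P = "prod_topology F unit_interval"
  have mP: "metrizable_space ?P"
    using F by (simp add: metrizable_space_prod_topology metrizable_space_subtopology metrizable_space_euclidean)
  define \<Gamma> where "\<Gamma> \<phi> = (\<lambda>x. (x, \<phi> x)) ` topspace F" for \<phi> :: "_ \<Rightarrow> real"
  define P' where "P' = (\<Union>\<phi>\<in>\<Phi>. \<Gamma> \<phi>)"
  have \<phi>c: "continuous_map F ?P (\<lambda>x. (x, \<phi> x))" if "\<phi> \<in> \<Phi>" for \<phi>
    using \<Phi>(3)[OF that] by (intro continuous_map_pairedI) auto
  have \<Gamma>c: "compactin ?P (\<Gamma> \<phi>)" if "\<phi> \<in> \<Phi>" for \<phi>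
    unfolding \<Gamma>_def using F(1) by (intro image_compactin[OF _ \<phi>c[OF that]]) (simp add: compact_space_def)
  have "e_dim_le (subtopology ?P P') K"
  proof (rule e_dim_le_countable_union[OF CW, where A="\<lambda>i. \<Gamma> (from_nat_into \<Phi> i)"])
    show "metrizable_space (subtopology ?P P')" using mP metrizable_space_subtopology by blast
    have JJ: "from_nat_into \<Phi> i \<in> \<Phi>" for i using \<Phi>(2) by (rule from_nat_into)
    then have sub: "\<Gamma> (from_nat_into \<Phi> i) \<subseteq> P'" for i unfolding P'_def by blast
    have "range (from_nat_into \<Phi>) = \<Phi>" using \<Phi>(1,2) by (intro range_from_nat_into) (auto simp: countable_finite)
    then have "P' = (\<Union>i. \<Gamma> (from_nat_into \<Phi> i))" unfolding P'_def by (metis image_image)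
    then show "topspace (subtopology ?P P') \<subseteq> (\<Union>i. \<Gamma> (from_nat_into \<Phi> i))" by auto
    show "compactin (subtopology ?P P') (\<Gamma> (from_nat_into \<Phi> i))" for i
      using \<Gamma>c[OF JJ] sub by (simp add: compactin_subtopology)
    show "e_dim_le (subtopology (subtopology ?P P') (\<Gamma> (from_nat_into \<Phi> i))) K" for i
    proof (rule e_dim_le_retract[OF F(3), where p="\<lambda>x. (x, from_nat_into \<Phi> i x)" and q=fst])
      have eq: "subtopology (subtopology ?P P') (\<Gamma> (from_nat_into \<Phi> i)) = subtopology ?P (\<Gamma> (from_nat_into \<Phi> i))"
        using sub by (simp add: subtopology_subtopology Int_absorb1)
      show "continuous_map F (subtopology (subtopology ?P P') (\<Gamma> (from_nat_into \<Phi> i))) (\<lambda>x. (x, from_nat_into \<Phi> i x))"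
        unfolding eq by (rule continuous_map_to_subtopologyI[OF \<phi>c[OF JJ]]) (auto simp: \<Gamma>_def)
      show "continuous_map (subtopology (subtopology ?P P') (\<Gamma> (from_nat_into \<Phi> i))) F fst"
        unfolding eq by (intro continuous_map_from_subtopology continuous_map_fst)
      show "(fst y, from_nat_into \<Phi> i (fst y)) = y" if "y \<in> topspace (subtopology (subtopology ?P P') (\<Gamma> (from_nat_into \<Phi> i)))" for y
        using that by (auto simp: \<Gamma>_def)
    qed
  qed
  then show ?thesis by (simp add: P'_def \<Gamma>_def)
qed

text \<open>
  A partial map on \<open>C\<close> is first extended to a neighbourhood in \<open>F \<times> I\<close>. On the finite union of graphs, the
  extension is restricted to the points that approximate points near \<open>C\<close>, and extended to all graphs.
  Away from \<open>C\<close> the approximation followed by this map is used; near \<open>C\<close>, a vertical interpolation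
  between the identity and the approximation stays in the neighbourhood and joins the two.
\<close>
lemma e_dim_le_light_over:
  assumes CW: "CW_structure K E" and F: "compact_space F" "metrizable_space F" "e_dim_le F K"
    and Z: "closedin (prod_topology F unit_interval) Z"
    and light: "\<And>x a b. x \<in> topspace F \<Longrightarrow> a < b \<Longrightarrow> \<exists>s. a < s \<and> s < b \<and> (x, s) \<notin> Z"
  shows "e_dim_le (subtopology (prod_topology F unit_interval) Z) K"
  unfolding e_dim_le_def
proof (intro allI impI, elim conjE)
  let ?P = "prod_topology F unit_interval"
  fix C f assume C': "closedin (subtopology ?P Z) C" and f': "continuous_map (subtopology (subtopology ?P Z) C) K f"
  have CZ: "C \<subseteq> Z" using closedin_subset[OF C'] by auto
  have ZP: "Z \<subseteq> topspace ?P" using closedin_subset[OF Z] .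
  have C: "closedin ?P C" using closedin_trans_full[OF C' Z] .
  have f: "continuous_map (subtopology ?P C) K f"
    using f' CZ by (simp add: subtopology_subtopology Int_absorb1)
  have cP: "compact_space ?P" using F by (simp add: compact_space_prod_topology compact_space_subtopology)
  have mP: "metrizable_space ?P"
    using F by (simp add: metrizable_space_prod_topology metrizable_space_subtopology metrizable_space_euclidean)
  have nP: "normal_space ?P" using mP metrizable_imp_normal_space by blast
  have sndP: "continuous_map ?P euclideanreal snd"
    using continuous_map_snd[of F unit_interval] by (simp add: continuous_map_in_subtopology)
  have "compactin ?P C" using C cP closedin_compact_space by blast
  then obtain V W g where V: "openin ?P V" "closedin ?P W" "C \<subseteq> V" "V \<subseteq> W"
    "continuous_map (subtopology ?P (C \<union> W)) K g" "\<And>z. z \<in> C \<Longrightarrow> g z = f z"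
    by (rule extend_near_compact[OF CW mP C f _ order_refl]) (rule that; assumption)
  have CWW: "C \<union> W = W" using V by blast
  have gW: "continuous_map (subtopology ?P W) K g" using V(5) unfolding CWW .
  obtain V1 where V1: "openin ?P V1" "C \<subseteq> V1" "?P closure_of V1 \<subseteq> V"
    using normal_space_alt[THEN iffD1, OF nP, rule_format, of C V] C V by blast
  let ?V1 = "?P closure_of V1"
  have V1c: "V1 \<subseteq> ?V1" by (rule closure_of_subset[OF openin_subset[OF V1(1)]])
  obtain e where e: "e > 0" "\<And>x s s'. \<lbrakk>(x, s) \<in> ?V1; s' \<in> {0..1}; \<bar>s - s'\<bar> < e\<rbrakk> \<Longrightarrow> (x, s') \<in> V"
    by (rule vertical_room[OF F(1) closedin_closure_of V(1) V1(3)]) (rule that; assumption)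
  obtain N0 where N0: "inverse (real (Suc N0)) < e" using e(1) reals_Archimedean by blast
  define N where "N = Suc N0"
  have N: "N > 0" "1 / real N < e" using N0 by (simp_all add: N_def inverse_eq_divide)
  obtain \<Phi> q2 where \<Phi>: "finite \<Phi>" "\<Phi> \<noteq> {}" "\<And>\<phi>. \<phi> \<in> \<Phi> \<Longrightarrow> continuous_map F unit_interval \<phi>"
    and q2c: "continuous_map (subtopology ?P Z) euclideanreal q2"
    and near: "\<And>z. z \<in> Z \<Longrightarrow> \<bar>q2 z - snd z\<bar> \<le> 1 / real N"
    and graph: "\<And>z. z \<in> Z \<Longrightarrow> \<exists>\<phi>\<in>\<Phi>. q2 z = \<phi> (fst z)"
    by (rule step_approximation[OF F(1,2) Z light N(1)]) (assumption | rule that; assumption)+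
  define P' where "P' = (\<Union>\<phi>\<in>\<Phi>. (\<lambda>x. (x, \<phi> x)) ` topspace F)"
  have eP': "e_dim_le (subtopology ?P P') K" unfolding P'_def by (rule e_dim_le_graphs[OF CW F \<Phi>])
  have ZF: "fst z \<in> topspace F" "snd z \<in> {0..1}" if "z \<in> Z" for z using that ZP by auto
  have fstZ: "continuous_map (subtopology ?P Z) F fst" by (intro continuous_map_from_subtopology continuous_map_fst)
  have sndZ: "continuous_map (subtopology ?P Z) euclideanreal snd" by (rule continuous_map_from_subtopology[OF sndP])
  define q where "q z = (fst z, q2 z)" for z
  have qP': "q z \<in> P'" and q2I: "q2 z \<in> {0..1}" if z: "z \<in> Z" for z
  proof -
    obtain \<phi> where \<phi>: "\<phi> \<in> \<Phi>" "q2 z = \<phi> (fst z)" using graph[OF z] by blast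
    then show "q z \<in> P'" using ZF(1)[OF z] by (auto simp: q_def P'_def)
    have "\<phi> ` topspace F \<subseteq> {0..1}" using \<Phi>(3)[OF \<phi>(1)] by (simp add: continuous_map_in_subtopology image_subset_iff Pi_iff)
    then show "q2 z \<in> {0..1}" using \<phi>(2) ZF(1)[OF z] by auto
  qed
  have qc: "continuous_map (subtopology ?P Z) ?P q"
    unfolding q_def
  proof (intro continuous_map_pairedI fstZ)
    show "continuous_map (subtopology ?P Z) unit_interval q2"
      by (rule continuous_map_to_subtopologyI[OF q2c]) (use q2I in auto)
  qed
  \<comment> \<open>\<open>w\<close> controls the vertical interpolation: no motion on \<open>C\<close>, the full motion \<open>q\<close> off \<open>V1\<close>\<close>
  obtain w where w: "continuous_map ?P (top_of_set {0..1::real}) w" "w ` C \<subseteq> {0}" "w ` (topspace ?P - V1) \<subseteq> {1}"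
  proof -
    have "closedin ?P (topspace ?P - V1)" "disjnt C (topspace ?P - V1)" "(0::real) \<le> 1"
      using V1(2) closedin_diff[OF closedin_topspace V1(1)] by (auto simp: disjnt_def)
    from Urysohn_lemma[OF nP C this] that show thesis by blast
  qed
  have wI: "w z \<in> {0..1}" if "z \<in> topspace ?P" for z using w(1) that by (auto simp: continuous_map_def Pi_iff)
  define Z1 where "Z1 = Z \<inter> ?V1"
  have clZ1: "closedin ?P Z1" unfolding Z1_def by (rule closedin_Int[OF Z closedin_closure_of])
  have clZ2: "closedin ?P (Z - V1)" by (rule closedin_diff[OF Z V1(1)])
  define qw where "qw z = (fst z, snd z + w z * (q2 z - snd z))" for z
  have qwV: "qw z \<in> V" if "z \<in> Z1" for z
  proof -
    have zz: "z \<in> Z" "(fst z, snd z) \<in> ?V1" using that by (auto simp: Z1_def)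
    have wz: "0 \<le> w z" "w z \<le> 1" using wI[of z] zz(1) ZP by auto
    have b: "0 \<le> snd z" "snd z \<le> 1" "0 \<le> q2 z" "q2 z \<le> 1" using ZF(2) q2I zz(1) by auto
    have "snd z + w z * (q2 z - snd z) = (1 - w z) * snd z + w z * q2 z" by (simp add: algebra_simps)
    moreover have "\<dots> \<le> 1" using b wz by (intro convex_bound_le) auto
    moreover have "0 \<le> (1 - w z) * snd z + w z * q2 z" using b wz by (intro add_nonneg_nonneg mult_nonneg_nonneg) auto
    moreover have "\<bar>w z * (q2 z - snd z)\<bar> \<le> 1 * (1 / real N)"
      unfolding abs_mult using wz near[OF zz(1)] by (intro mult_mono) auto
    ultimately show ?thesis unfolding qw_def using N(2) by (intro e(2)[OF zz(2)]) auto
  qed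
  have qV: "q z \<in> V" if "z \<in> Z1" for z
  proof -
    have zz: "z \<in> Z" "(fst z, snd z) \<in> ?V1" using that by (auto simp: Z1_def)
    show ?thesis unfolding q_def using near[OF zz(1)] N(2) q2I[OF zz(1)]
      by (intro e(2)[OF zz(2)]) (auto simp: abs_minus_commute)
  qed
  have Z1Z: "Z1 \<subseteq> Z" by (auto simp: Z1_def)
  have T: "closedin ?P (q ` Z1)"
  proof -
    have "compactin ?P Z1" using clZ1 cP closedin_compact_space by blast
    then have "compactin (subtopology ?P Z) Z1" using Z1Z by (simp add: compactin_subtopology)
    then have "compactin ?P (q ` Z1)" using qc by (rule image_compactin)
    then show ?thesis by (rule compactin_imp_closedin[OF metrizable_imp_Hausdorff_space[OF mP]])
  qed
  have TP': "q ` Z1 \<subseteq> P'" using qP' Z1Z by blast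
  have "continuous_map (subtopology (subtopology ?P P') (q ` Z1)) K g"
    unfolding subtopology_subtopology
    by (rule continuous_map_from_subtopology_mono[OF gW]) (use qV V(4) in blast)
  moreover have "closedin (subtopology ?P P') (q ` Z1)" using T TP' closedin_subset_topspace by blast
  ultimately obtain h where h: "continuous_map (subtopology ?P P') K h" "\<And>y. y \<in> q ` Z1 \<Longrightarrow> h y = g y"
    using e_dim_leE[OF eP'] by metis
  have "continuous_map (subtopology ?P (Z1 \<union> (Z - V1))) K (\<lambda>z. if z \<in> Z1 then g (qw z) else h (q z))"
  proof (rule continuous_map_paste_closed[OF clZ1 clZ2])
    have wr: "continuous_map (subtopology ?P Z1) euclideanreal w"
      using w(1) by (intro continuous_map_from_subtopology) (simp add: continuous_map_in_subtopology)
    have "continuous_map (subtopology ?P Z1) euclideanreal (\<lambda>z. snd z + w z * (q2 z - snd z))"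
      by (intro continuous_intros wr continuous_map_from_subtopology_mono[OF q2c Z1Z] continuous_map_from_subtopology_mono[OF sndZ Z1Z])
    then have "continuous_map (subtopology ?P Z1) unit_interval (\<lambda>z. snd z + w z * (q2 z - snd z))"
    proof (rule continuous_map_to_subtopologyI)
      have "qw z \<in> topspace ?P" if "z \<in> Z1" for z using qwV[OF that] openin_subset[OF V(1)] by blast
      then show "(\<lambda>z. snd z + w z * (q2 z - snd z)) ` topspace (subtopology ?P Z1) \<subseteq> {0..1}"
        by (force simp: qw_def)
    qed
    then have "continuous_map (subtopology ?P Z1) ?P qw"
      unfolding qw_def by (intro continuous_map_pairedI continuous_map_from_subtopology_mono[OF fstZ Z1Z])
    then have "continuous_map (subtopology ?P Z1) (subtopology ?P W) qw"
      by (rule continuous_map_to_subtopologyI) (use qwV V(4) in auto)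
    from continuous_map_compose[OF this gW]
    show "continuous_map (subtopology ?P Z1) K (\<lambda>z. g (qw z))" by (simp add: o_def)
    have "continuous_map (subtopology ?P (Z - V1)) ?P q" by (rule continuous_map_from_subtopology_mono[OF qc]) auto
    then have "continuous_map (subtopology ?P (Z - V1)) (subtopology ?P P') q"
      by (rule continuous_map_to_subtopologyI) (use qP' in auto)
    from continuous_map_compose[OF this h(1)]
    show "continuous_map (subtopology ?P (Z - V1)) K (\<lambda>z. h (q z))" by (simp add: o_def)
    fix z assume z: "z \<in> Z1" "z \<in> Z - V1"
    then have "w z = 1" using w(3) ZP by blast
    then have "qw z = q z" by (simp add: qw_def q_def)
    then show "g (qw z) = h (q z)" using h(2) z(1) by simp
  qed
  moreover have "Z1 \<union> (Z - V1) = Z" using V1c by (auto simp: Z1_def)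
  ultimately have "continuous_map (subtopology ?P Z) K (\<lambda>z. if z \<in> Z1 then g (qw z) else h (q z))" by simp
  moreover have "(if z \<in> Z1 then g (qw z) else h (q z)) = f z" if "z \<in> C" for z
  proof -
    have "z \<in> Z1" using that CZ V1(2) V1c by (auto simp: Z1_def)
    moreover have "qw z = z" using w(2) that by (auto simp: qw_def)
    ultimately show ?thesis using V(6)[OF that] by simp
  qed
  ultimately show "\<exists>g. continuous_map (subtopology ?P Z) K g \<and> (\<forall>z\<in>C. g z = f z)" by blast
qed

section \<open>Maps to suspensions\<close>

fun level :: "'k suspension \<Rightarrow> real" where
  "level South = 0" | "level North = 1" | "level (Level k t) = t"

text \<open>
  The base coordinate has no meaning at the poles, where it takes a default value.
\<close>
fun base_point :: "'k suspension \<Rightarrow> 'k" where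
  "base_point (Level k t) = k" | "base_point South = undefined" | "base_point North = undefined"

text \<open>
  Exchanging the poles reduces statements about the southern cone to the northern one.
\<close>
fun flip :: "'k suspension \<Rightarrow> 'k suspension" where
  "flip South = North" | "flip North = South" | "flip (Level k t) = Level k (1 - t)"

lemma flip_flip [simp]: "flip (flip x) = x"
  by (cases x) auto

lemma flip_suspension_proj: "flip (suspension_proj p) = suspension_proj (fst p, 1 - snd p)"
  by (cases p) (auto simp: suspension_proj_def)

lemma level_flip [simp]: "level (flip x) = 1 - level x"
  by (cases x) auto

lemma level_suspension_proj: "t \<in> {0..1} \<Longrightarrow> level (suspension_proj (k, t)) = t"
  by (auto simp: suspension_proj_def)

lemma suspension_proj_in:
  "k \<in> topspace K \<Longrightarrow> t \<in> {0..1} \<Longrightarrow> suspension_proj (k, t) \<in> suspension_set K"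
  by (auto simp: suspension_proj_def suspension_set_def)

lemma level_bounds: "x \<in> suspension_set K \<Longrightarrow> 0 \<le> level x \<and> level x \<le> 1"
  by (auto simp: suspension_set_def)

lemma inner_levelD:
  assumes "x \<in> suspension_set K" "0 < level x" "level x < 1"
  shows "x = Level (base_point x) (level x)" "base_point x \<in> topspace K"
    "suspension_proj (base_point x, level x) = x"
  using assms by (auto simp: suspension_set_def suspension_proj_def)

lemma level_eq_1D: "x \<in> suspension_set K \<Longrightarrow> level x = 1 \<Longrightarrow> x = North"
  by (auto simp: suspension_set_def)

lemma openin_unit_interval_prod:
  "openin K U \<Longrightarrow> open V \<Longrightarrow> openin (prod_topology K unit_interval) (U \<times> ({0..1} \<inter> V))"
  by (auto simp: openin_prod_Times_iff openin_open_Int)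

lemma continuous_map_suspension_proj:
  "continuous_map (prod_topology K unit_interval) (suspension_space K) suspension_proj"
  unfolding continuous_map_def
proof (intro conjI allI impI)
  show "suspension_proj \<in> topspace (prod_topology K unit_interval) \<rightarrow> topspace (suspension_space K)"
    using suspension_proj_in by fastforce
qed (simp add: openin_suspension_space)

lemma continuous_map_level: "continuous_map (suspension_space K) euclideanreal level"
  unfolding continuous_map_def
proof (intro conjI allI impI)
  fix U :: "real set" assume U: "openin euclideanreal U"
  have "{p \<in> topspace (prod_topology K unit_interval). suspension_proj p \<in> {x \<in> topspace (suspension_space K). level x \<in> U}}
     = topspace K \<times> ({0..1} \<inter> U)"
    by (auto simp: suspension_proj_def suspension_set_def split: if_splits)
  moreover have "openin (prod_topology K unit_interval) (topspace K \<times> ({0..1} \<inter> U))"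
    using U by (intro openin_unit_interval_prod) auto
  ultimately show "openin (suspension_space K) {x \<in> topspace (suspension_space K). level x \<in> U}"
    by (auto simp: openin_suspension_space simp del: topspace_prod_topology)
qed auto

lemma continuous_map_base_point:
  "continuous_map (subtopology (suspension_space K) {x. 0 < level x \<and> level x < 1}) K base_point"
  unfolding continuous_map_def
proof (intro conjI allI impI)
  show "base_point \<in> topspace (subtopology (suspension_space K) {x. 0 < level x \<and> level x < 1}) \<rightarrow> topspace K"
    using inner_levelD(2) by fastforce
  fix U assume U: "openin K U"
  then have UK: "U \<subseteq> topspace K" using openin_subset by blast
  let ?S = "{x \<in> suspension_set K. 0 < level x \<and> level x < 1 \<and> base_point x \<in> U}"
  have "{p \<in> topspace (prod_topology K unit_interval). suspension_proj p \<in> ?S} = U \<times> ({0..1} \<inter> {0<..<1})"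
    using UK by (auto simp: suspension_proj_def suspension_set_def split: if_splits)
  moreover have "openin (prod_topology K unit_interval) (U \<times> ({0..1} \<inter> {0<..<1}))"
    using U by (intro openin_unit_interval_prod) auto
  ultimately have "openin (suspension_space K) ?S"
    by (auto simp: openin_suspension_space simp del: topspace_prod_topology)
  moreover have "{x \<in> topspace (subtopology (suspension_space K) {x. 0 < level x \<and> level x < 1}). base_point x \<in> U}
     = ?S \<inter> {x. 0 < level x \<and> level x < 1}" by auto
  ultimately show "openin (subtopology (suspension_space K) {x. 0 < level x \<and> level x < 1})
      {x \<in> topspace (subtopology (suspension_space K) {x. 0 < level x \<and> level x < 1}). base_point x \<in> U}"
    by (auto simp: openin_subtopology)
qed

lemma continuous_map_flip: "continuous_map (suspension_space K) (suspension_space K) flip"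
  unfolding continuous_map_def
proof (intro conjI allI impI)
  show "flip \<in> topspace (suspension_space K) \<rightarrow> topspace (suspension_space K)"
    by (auto simp: suspension_set_def)
  fix U assume U: "openin (suspension_space K) U"
  let ?P = "prod_topology K unit_interval"
  have US: "U \<subseteq> suspension_set K" using U openin_subset by fastforce
  have c: "continuous_map ?P ?P (\<lambda>p. (fst p, 1 - snd p))"
  proof (intro continuous_map_pairedI continuous_map_fst)
    have "continuous_map ?P euclideanreal snd"
      using continuous_map_snd[of K unit_interval] by (simp add: continuous_map_in_subtopology)
    then have "continuous_map ?P euclideanreal (\<lambda>p. 1 - snd p)" by (intro continuous_intros)
    then show "continuous_map ?P unit_interval (\<lambda>p. 1 - snd p)"
      by (rule continuous_map_to_subtopologyI) auto
  qed
  have "openin ?P {p \<in> topspace ?P. (fst p, 1 - snd p) \<in> {p \<in> topspace ?P. suspension_proj p \<in> U}}"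
    using U by (intro openin_continuous_map_preimage[OF c]) (simp only: openin_suspension_space)
  moreover have "{p \<in> topspace ?P. (fst p, 1 - snd p) \<in> {p \<in> topspace ?P. suspension_proj p \<in> U}}
    = {p \<in> topspace ?P. suspension_proj p \<in> {x \<in> topspace (suspension_space K). flip x \<in> U}}"
    by (auto simp: flip_suspension_proj suspension_proj_in)
  ultimately show "openin (suspension_space K) {x \<in> topspace (suspension_space K). flip x \<in> U}"
    by (auto simp: openin_suspension_space simp del: topspace_prod_topology)
qed

text \<open>
  In the suspension, points over distinct points of a closed discrete set of \<open>K\<close>, one over each, form a
  closed discrete set. So a compact image has only finitely many of them.
\<close>
lemma compact_inner_levels_in_finite_subcomplex:
  assumes CW: "CW_structure K E" and D: "compact_space D" and h: "continuous_map D (suspension_space K) h"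
  obtains E0 where "finite_subcomplex E E0"
    "base_point ` h ` {z \<in> topspace D. 0 < level (h z) \<and> level (h z) < 1} \<subseteq> (\<Union>c\<in>E0. open_cell c)"
proof (rule in_finite_subcomplex[OF CW])
  let ?D = "{z \<in> topspace D. 0 < level (h z) \<and> level (h z) < 1}"
  have hS: "h z \<in> suspension_set K" if "z \<in> topspace D" for z using h that by (auto simp: continuous_map_def Pi_iff)
  show "base_point ` h ` ?D \<subseteq> topspace K" using hS inner_levelD(2) by fastforce
  fix T assume T: "T \<subseteq> base_point ` h ` ?D" and cl: "\<And>T'. T' \<subseteq> T \<Longrightarrow> closedin K T'"
  have "\<forall>k\<in>T. \<exists>z. z \<in> ?D \<and> base_point (h z) = k" using T by blast
  from bchoice[OF this] obtain z where z: "\<forall>k\<in>T. z k \<in> ?D \<and> base_point (h (z k)) = k" ..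
  define \<tau> where "\<tau> k = level (h (z k))" for k
  have \<tau>: "0 < \<tau> k" "\<tau> k < 1" "h (z k) = Level k (\<tau> k)" "z k \<in> topspace D" if "k \<in> T" for k
    using z that hS[of "z k"] inner_levelD(1)[of "h (z k)" K] unfolding \<tau>_def by auto
  define X where "X T' = (\<lambda>k. Level k (\<tau> k)) ` T'" for T'
  have TK: "T \<subseteq> topspace K" using cl[of T] closedin_subset by blast
  have clX: "closedin (suspension_space K) (X T')" if T': "T' \<subseteq> T" for T'
  proof -
    let ?P = "prod_topology K unit_interval"
    have "openin ?P ((topspace K - T') \<times> ({0..1} \<inter> UNIV) \<union> (\<Union>k\<in>T'. (topspace K - (T' - {k})) \<times> ({0..1} \<inter> (- {\<tau> k}))))"
      (is "openin ?P ?R")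
    proof (intro openin_Un openin_Union)
      show "openin ?P ((topspace K - T') \<times> ({0..1} \<inter> UNIV))"
        by (intro openin_unit_interval_prod openin_diff openin_topspace cl T') simp
      fix S assume "S \<in> (\<lambda>k. (topspace K - (T' - {k})) \<times> ({0..1} \<inter> (- {\<tau> k}))) ` T'"
      then obtain k where "S = (topspace K - (T' - {k})) \<times> ({0..1} \<inter> (- {\<tau> k}))" by blast
      moreover have "T' - {k} \<subseteq> T" using T' by blast
      ultimately show "openin ?P S"
        by (simp only:) (intro openin_unit_interval_prod openin_diff openin_topspace cl open_Compl, auto)
    qed
    moreover have "?R = {p \<in> topspace ?P. suspension_proj p \<in> suspension_set K - X T'}"
    proof (intro set_eqI iffI)
      fix p assume "p \<in> ?R"
      then have p: "fst p \<in> topspace K" "snd p \<in> {0..1}" "fst p \<in> T' \<Longrightarrow> snd p \<noteq> \<tau> (fst p)" by auto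
      then have "suspension_proj p \<notin> X T'" by (auto simp: X_def suspension_proj_def case_prod_unfold split: if_splits)
      moreover have "suspension_proj p \<in> suspension_set K" using suspension_proj_in[of "fst p" K "snd p"] p by simp
      ultimately show "p \<in> {p \<in> topspace ?P. suspension_proj p \<in> suspension_set K - X T'}"
        using p by (auto simp: mem_Times_iff)
    next
      fix p assume p: "p \<in> {p \<in> topspace ?P. suspension_proj p \<in> suspension_set K - X T'}"
      then have pt: "fst p \<in> topspace K" "snd p \<in> {0..1}" by auto
      have "snd p \<noteq> \<tau> (fst p)" if k: "fst p \<in> T'"
      proof
        assume "snd p = \<tau> (fst p)"
        moreover have "0 < \<tau> (fst p)" "\<tau> (fst p) < 1" using \<tau>(1,2) k T' by auto
        ultimately have "suspension_proj p = Level (fst p) (\<tau> (fst p))"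
          by (simp add: suspension_proj_def case_prod_unfold)
        then have "suspension_proj p \<in> X T'" using k by (simp add: X_def)
        then show False using p by simp
      qed
      then show "p \<in> ?R" using pt by (cases "fst p \<in> T'") (auto simp: mem_Times_iff)
    qed
    ultimately have "openin ?P {p \<in> topspace ?P. suspension_proj p \<in> suspension_set K - X T'}" by simp
    then have "openin (suspension_space K) (suspension_set K - X T')"
      unfolding openin_suspension_space by blast
    moreover have "X T' \<subseteq> suspension_set K"
    proof
      fix x assume "x \<in> X T'"
      then obtain k where "k \<in> T'" "x = Level k (\<tau> k)" by (auto simp: X_def)
      then show "x \<in> suspension_set K" using \<tau>(1,2)[of k] T' TK unfolding suspension_set_def by blast
    qed
    ultimately show ?thesis by (simp add: closedin_def)
  qed
  show "finite T"
  proof (cases "T = {}")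
    case False
    define O' where "O' k = {w \<in> topspace D. h w \<in> topspace (suspension_space K) - X (T - {k})}" for k
    have oO: "openin D (O' k)" for k unfolding O'_def
      by (rule openin_continuous_map_preimage[OF h]) (intro openin_diff openin_topspace clX Diff_subset)
    have cov: "topspace D \<subseteq> \<Union> (O' ` T)"
    proof
      fix w assume w: "w \<in> topspace D"
      show "w \<in> \<Union> (O' ` T)"
      proof (cases "h w \<in> X T")
        case True
        then obtain k where k: "k \<in> T" "h w = Level k (\<tau> k)" by (auto simp: X_def)
        then have "h w \<notin> X (T - {k})" by (auto simp: X_def)
        then show ?thesis using w hS k(1) by (auto simp: O'_def)
      next
        case False
        obtain k where "k \<in> T" using \<open>T \<noteq> {}\<close> by blast
        moreover have "h w \<notin> X (T - {k})" using False by (auto simp: X_def)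
        ultimately show ?thesis using w hS by (auto simp: O'_def)
      qed
    qed
    have "compactin D (topspace D)" using D by (simp add: compact_space_def)
    then have "\<exists>\<F>. finite \<F> \<and> \<F> \<subseteq> O' ` T \<and> topspace D \<subseteq> \<Union>\<F>"
      by (rule compactinD) (use oO cov in auto)
    then obtain \<F> where \<F>: "finite \<F>" "\<F> \<subseteq> O' ` T" "topspace D \<subseteq> \<Union>\<F>" by blast
    obtain F where F: "F \<subseteq> T" "finite F" "\<F> = O' ` F" using finite_subset_image[OF \<F>(1,2)] by blast
    have "T \<subseteq> F"
    proof
      fix k assume k: "k \<in> T"
      then have "z k \<in> \<Union> (O' ` F)" using \<tau>(4) \<F>(3) F(3) by blast
      then obtain k' where k': "k' \<in> F" "z k \<in> O' k'" by blast
      then have "Level k (\<tau> k) \<notin> X (T - {k'})" using \<tau>(3)[OF k] by (simp add: O'_def)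
      then have "k = k'" using k by (auto simp: X_def)
      then show "k \<in> F" using k' by simp
    qed
    then show ?thesis using F(2) finite_subset by blast
  qed simp
qed

text \<open>
  Off the pole, a map into the cone is a base coordinate and a level. The base coordinate takes values in
  a finite subcomplex and extends over a neighbourhood \<open>U\<close> of the part off the pole; the level extends by
  the Tietze theorem to be \<open>1\<close> off \<open>U\<close>. The finite subcomplex is essential for continuity at the pole:
  since the subcomplex is compact, the tube lemma shows that a neighbourhood of the pole contains all
  levels close to \<open>1\<close> over it.
\<close>
lemma extend_to_open_cone:
  fixes Z :: "'z topology"
  assumes CW: "CW_structure K E" and Z: "metrizable_space Z" and D: "closedin Z D" "compactin Z D"
    and h: "continuous_map (subtopology Z D) (suspension_space K) h" and pos: "\<And>z. z \<in> D \<Longrightarrow> 0 < level (h z)"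
  obtains g where "continuous_map Z (suspension_space K) g" "\<And>z. z \<in> D \<Longrightarrow> g z = h z"
proof -
  let ?S = "suspension_space K"
  have DZ: "D \<subseteq> topspace Z" using D(1) closedin_subset by blast
  have topD: "topspace (subtopology Z D) = D" using DZ by auto
  have hS: "h z \<in> suspension_set K" if "z \<in> D" for z using h that topD by (auto simp: continuous_map_def Pi_iff)
  have lev: "continuous_map (subtopology Z D) euclideanreal (\<lambda>z. level (h z))"
    using continuous_map_compose[OF h continuous_map_level] by (simp add: o_def)
  have "compact_space (subtopology Z D)" using D(2) by (simp add: compact_space_subtopology)
  then obtain E0 where E0: "finite_subcomplex E E0"
    "base_point ` h ` {z \<in> topspace (subtopology Z D). 0 < level (h z) \<and> level (h z) < 1} \<subseteq> (\<Union>c\<in>E0. open_cell c)"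
    by (rule compact_inner_levels_in_finite_subcomplex[OF CW _ h])
  let ?K0 = "\<Union>c\<in>E0. open_cell c"
  define T where "T = {z \<in> D. level (h z) = 1}"
  have T: "closedin Z T"
  proof -
    have "closedin (subtopology Z D) {z \<in> topspace (subtopology Z D). level (h z) \<in> {1}}"
      by (rule closedin_continuous_map_preimage[OF lev]) simp
    then have "closedin (subtopology Z D) T" unfolding topD T_def singleton_iff .
    then show ?thesis using D(1) closedin_trans_full by blast
  qed
  let ?R = "topspace Z - T"
  have inner: "0 < level (h z) \<and> level (h z) < 1" if "z \<in> D - T" for z
    using pos[of z] level_bounds[OF hS[of z]] that by (auto simp: T_def order_less_le)
  have k: "continuous_map (subtopology Z (D - T)) (subtopology K ?K0) (\<lambda>z. base_point (h z))"
  proof (rule continuous_map_to_subtopologyI)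
    have "continuous_map (subtopology Z (D - T)) ?S h" by (rule continuous_map_from_subtopology_mono[OF h]) auto
    then have "continuous_map (subtopology Z (D - T)) (subtopology ?S {x. 0 < level x \<and> level x < 1}) h"
      by (rule continuous_map_to_subtopologyI) (use inner in auto)
    from continuous_map_compose[OF this continuous_map_base_point]
    show "continuous_map (subtopology Z (D - T)) K (\<lambda>z. base_point (h z))" by (simp add: o_def)
    show "(\<lambda>z. base_point (h z)) ` topspace (subtopology Z (D - T)) \<subseteq> ?K0"
    proof
      fix k assume "k \<in> (\<lambda>z. base_point (h z)) ` topspace (subtopology Z (D - T))"
      then obtain z where z: "z \<in> D - T" "k = base_point (h z)" by auto
      then have "k \<in> base_point ` h ` {z \<in> topspace (subtopology Z D). 0 < level (h z) \<and> level (h z) < 1}"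
        using inner[of z] topD by auto
      then show "k \<in> ?K0" using E0(2) by (meson subsetD)
    qed
  qed
  have "D - T \<subseteq> ?R" using DZ by blast
  then have "continuous_map (subtopology (subtopology Z ?R) (D - T)) (subtopology K ?K0) (\<lambda>z. base_point (h z))"
    using k by (simp add: subtopology_subtopology Int_absorb1)
  moreover have "closedin (subtopology Z ?R) (D - T)"
    using D(1) DZ by (auto simp: closedin_subtopology intro!: exI[of _ D])
  ultimately obtain U \<kappa> where U: "openin (subtopology Z ?R) U" "D - T \<subseteq> U"
    "continuous_map (subtopology (subtopology Z ?R) U) (subtopology K ?K0) \<kappa>" "\<And>z. z \<in> D - T \<Longrightarrow> \<kappa> z = base_point (h z)"
    using nbhd_extensorE[OF subcomplex_nbhd_extensor[OF CW E0(1)] metrizable_space_subtopology[OF Z, of ?R],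
        of "D - T" "\<lambda>z. base_point (h z)" thesis] by blast
  have UR: "U \<subseteq> ?R" using openin_subset[OF U(1)] by auto
  have oU: "openin Z U" using openin_trans_full[OF U(1)] T by blast
  have \<kappa>: "continuous_map (subtopology Z U) K \<kappa>"
    using U(3) UR by (simp add: continuous_map_in_subtopology subtopology_subtopology Int_absorb1)
  have \<kappa>K0: "\<kappa> z \<in> ?K0" if "z \<in> U" for z
    using continuous_map_image_subset_topspace[OF U(3)] UR that unfolding topspace_subtopology by blast
  have clU: "closedin Z (topspace Z - U)" using oU by blast
  define l where "l z = (if z \<in> D then level (h z) else 1)" for z
  have "continuous_map (subtopology Z (D \<union> (topspace Z - U))) euclideanreal l"
    unfolding l_def
    by (rule continuous_map_paste_closed[OF D(1) clU lev]) (use U(2) in \<open>auto simp: T_def\<close>)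
  moreover have "l ` (D \<union> (topspace Z - U)) \<subseteq> {0<..1}"
    using pos level_bounds[OF hS] by (auto simp: l_def)
  moreover have "is_interval {0<..1::real}" by (simp add: is_interval_oc)
  moreover have "closedin Z (D \<union> (topspace Z - U))" using D(1) clU by blast
  ultimately obtain lam where lam: "continuous_map Z euclideanreal lam" "lam ` topspace Z \<subseteq> {0<..1}"
    "\<And>z. z \<in> D \<union> (topspace Z - U) \<Longrightarrow> lam z = l z"
    using Tietze_extension_realinterval[OF metrizable_imp_normal_space[OF Z], of "D \<union> (topspace Z - U)" "{0<..1}" l] by auto
  have lamI: "continuous_map Z unit_interval lam"
    by (rule continuous_map_to_subtopologyI[OF lam(1)]) (use lam(2) in auto)
  have lam1: "lam z = 1" if "z \<in> topspace Z - U" for z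
    using lam(3)[of z] that U(2) by (auto simp: l_def T_def)
  define g where "g z = (if z \<in> U then suspension_proj (\<kappa> z, lam z) else North)" for z
  have pc: "continuous_map (subtopology Z U) ?S (\<lambda>z. suspension_proj (\<kappa> z, lam z))"
  proof -
    have "continuous_map (subtopology Z U) (prod_topology K unit_interval) (\<lambda>z. (\<kappa> z, lam z))"
      by (intro continuous_map_pairedI \<kappa> continuous_map_from_subtopology lamI)
    from continuous_map_compose[OF this continuous_map_suspension_proj] show ?thesis by (simp add: o_def)
  qed
  have UZ: "U \<subseteq> topspace Z" using UR by blast
  have gS: "g z \<in> suspension_set K" if "z \<in> topspace Z" for z
    using pc that UZ by (auto simp: g_def suspension_set_def continuous_map_def Pi_iff)
  have gc: "continuous_map Z ?S g"
    unfolding continuous_map_def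
  proof (intro conjI allI impI)
    show "g \<in> topspace Z \<rightarrow> topspace ?S" using gS by simp
    fix W assume W: "openin ?S W"
    have "openin (subtopology Z U) {z \<in> topspace (subtopology Z U). suspension_proj (\<kappa> z, lam z) \<in> W}"
      by (rule openin_continuous_map_preimage[OF pc W])
    then have "openin Z {z \<in> topspace (subtopology Z U). suspension_proj (\<kappa> z, lam z) \<in> W}"
      using oU openin_trans_full by blast
    moreover have "{z \<in> topspace (subtopology Z U). suspension_proj (\<kappa> z, lam z) \<in> W} = {z \<in> U. g z \<in> W}"
      using UZ by (auto simp: g_def)
    ultimately have o1: "openin Z {z \<in> U. g z \<in> W}" by simp
    show "openin Z {z \<in> topspace Z. g z \<in> W}"
    proof (cases "North \<in> W")
      case False
      then have "{z \<in> topspace Z. g z \<in> W} = {z \<in> U. g z \<in> W}" using UZ by (auto simp: g_def)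
      then show ?thesis using o1 by simp
    next
      case True
      have "openin (prod_topology K unit_interval) {p \<in> topspace (prod_topology K unit_interval). suspension_proj p \<in> W}"
        using W unfolding openin_suspension_space by blast
      moreover have cK0: "compactin K ?K0" by (rule subcomplex_compact[OF CW E0(1)])
      moreover have "?K0 \<times> {1} \<subseteq> {p \<in> topspace (prod_topology K unit_interval). suspension_proj p \<in> W}"
        using compactin_subset_topspace[OF cK0] True by (auto simp: suspension_proj_def)
      ultimately obtain A B where AB: "openin K A" "openin unit_interval B" "?K0 \<subseteq> A" "1 \<in> B"
        "A \<times> B \<subseteq> {p \<in> topspace (prod_topology K unit_interval). suspension_proj p \<in> W}"
        using tube_lemma_left[of K unit_interval "{p \<in> topspace (prod_topology K unit_interval). suspension_proj p \<in> W}" ?K0 1]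
        by (metis (no_types, lifting) atLeastAtMost_iff order_refl topspace_euclidean_subtopology zero_le_one)
      have "{z \<in> topspace Z. g z \<in> W} = {z \<in> U. g z \<in> W} \<union> {z \<in> topspace Z. lam z \<in> B}"
      proof (intro equalityI subsetI)
        fix z assume z: "z \<in> {z \<in> topspace Z. g z \<in> W}"
        show "z \<in> {z \<in> U. g z \<in> W} \<union> {z \<in> topspace Z. lam z \<in> B}"
          using z lam1[of z] AB(4) by (cases "z \<in> U") auto
      next
        fix z assume z: "z \<in> {z \<in> U. g z \<in> W} \<union> {z \<in> topspace Z. lam z \<in> B}"
        show "z \<in> {z \<in> topspace Z. g z \<in> W}"
        proof (cases "z \<in> U \<and> g z \<notin> W")
          case t: True
          then have "(\<kappa> z, lam z) \<in> A \<times> B" using z \<kappa>K0[of z] AB(3) by blast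
          then have "suspension_proj (\<kappa> z, lam z) \<in> W" using AB(5) by blast
          then have "g z \<in> W" using t by (simp add: g_def)
          then show ?thesis using t by simp
        next
          case False
          then show ?thesis using z UZ True by (auto simp: g_def)
        qed
      qed
      moreover have "openin Z {z \<in> topspace Z. lam z \<in> B}" by (rule openin_continuous_map_preimage[OF lamI AB(2)])
      ultimately show ?thesis using o1 by auto
    qed
  qed
  moreover have "g z = h z" if z: "z \<in> D" for z
  proof (cases "z \<in> T")
    case True
    then have "z \<notin> U" using UR by blast
    moreover have "h z = North" using True level_eq_1D[OF hS[OF z]] by (simp add: T_def)
    ultimately show ?thesis by (simp add: g_def)
  next
    case False
    then have zz: "z \<in> D - T" using z by simp
    then have "g z = suspension_proj (base_point (h z), level (h z))"
      using U(2,4) lam(3)[of z] z by (auto simp: g_def l_def)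
    also have "\<dots> = h z" using inner_levelD(3)[OF hS[OF z]] inner[OF zz] by blast
    finally show ?thesis .
  qed
  ultimately show thesis using that by blast
qed

text \<open>
  Enlarge \<open>C1\<close> and \<open>C2\<close> to neighbourhoods with disjoint closures. Since \<open>B\<close> is zero-dimensional, it splits
  into relatively open sets \<open>G\<close> and \<open>G'\<close> away from one neighbourhood each. Then \<open>C1 \<union> G\<close> and \<open>C2 \<union> G'\<close> are
  separated, and separated sets in a metrizable space have disjoint neighbourhoods.
\<close>
lemma partition_missing_zero_dimensional_set:
  assumes Z: "metrizable_space Z" and B: "B \<subseteq> topspace Z" "covering_dim_le (subtopology Z B) 0"
    and C: "closedin Z C1" "closedin Z C2" "disjnt C1 C2"
  obtains U V where "openin Z U" "openin Z V" "C1 \<subseteq> U" "C2 \<subseteq> V" "disjnt U V" "B \<subseteq> U \<union> V"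
proof -
  obtain N S where NS: "openin Z N" "openin Z S" "C1 \<subseteq> N" "C2 \<subseteq> S" "disjnt (Z closure_of N) (Z closure_of S)"
    using normal_space_disjoint_closures[THEN iffD1, OF metrizable_imp_normal_space[OF Z], rule_format, of C1 C2] C
    by blast
  let ?N = "Z closure_of N" and ?S = "Z closure_of S"
  have NN: "N \<subseteq> ?N" by (rule closure_of_subset[OF openin_subset[OF NS(1)]])
  have SS: "S \<subseteq> ?S" by (rule closure_of_subset[OF openin_subset[OF NS(2)]])
  define \<U> where "\<U> = {B - ?N, B - ?S}"
  have oB: "openin (subtopology Z B) (B - Z closure_of X)" for X
  proof -
    have "openin Z (topspace Z - Z closure_of X)" by (intro openin_diff openin_topspace closedin_closure_of)
    moreover have "B - Z closure_of X = (topspace Z - Z closure_of X) \<inter> B" using B(1) by blast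
    ultimately show ?thesis by (auto simp: openin_subtopology)
  qed
  have "finite \<U> \<and> (\<forall>U\<in>\<U>. openin (subtopology Z B) U) \<and> \<Union>\<U> = topspace (subtopology Z B)"
    using oB NS(5) B(1) unfolding \<U>_def by (auto simp: disjnt_iff)
  from B(2)[unfolded covering_dim_le_def, THEN conjunct2, THEN spec, THEN mp, OF this]
  obtain \<V> where \<V>0: "finite \<V> \<and> (\<forall>V\<in>\<V>. openin (subtopology Z B) V) \<and> \<Union>\<V> = topspace (subtopology Z B) \<and>
    (\<forall>V\<in>\<V>. \<exists>U\<in>\<U>. V \<subseteq> U) \<and> (\<forall>x\<in>topspace (subtopology Z B). int (card {V\<in>\<V>. x \<in> V}) \<le> 0 + 1)" ..
  then have \<V>: "finite \<V>" "\<forall>V\<in>\<V>. openin (subtopology Z B) V" "\<Union>\<V> = topspace (subtopology Z B)"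
    "\<forall>V\<in>\<V>. \<exists>U\<in>\<U>. V \<subseteq> U" "\<forall>x\<in>topspace (subtopology Z B). int (card {V\<in>\<V>. x \<in> V}) \<le> 0 + 1" by simp_all
  define \<V>1 where "\<V>1 = {V\<in>\<V>. V \<inter> ?N \<noteq> {}}"
  define G where "G = \<Union>\<V>1"
  define G' where "G' = \<Union>(\<V> - \<V>1)"
  have "G \<union> G' = \<Union>\<V>" unfolding G_def G'_def \<V>1_def by blast
  then have GG: "G \<union> G' = B" using \<V>(3) B(1) by auto
  have GG0: "G \<inter> G' = {}"
  proof (rule ccontr)
    assume "G \<inter> G' \<noteq> {}"
    then obtain x V V' where x: "x \<in> V" "x \<in> V'" "V \<in> \<V>1" "V' \<in> \<V> - \<V>1" by (auto simp: G_def G'_def)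
    then have VV: "V \<noteq> V'" "{V, V'} \<subseteq> {V\<in>\<V>. x \<in> V}" by (auto simp: \<V>1_def)
    have "x \<in> topspace (subtopology Z B)" using x \<V>(3) by (auto simp: \<V>1_def)
    then have "card {V\<in>\<V>. x \<in> V} \<le> 1" using \<V>(5) by force
    moreover have "card {V, V'} \<le> card {V\<in>\<V>. x \<in> V}" using VV(2) \<V>(1) by (intro card_mono) auto
    ultimately show False using VV(1) by simp
  qed
  have GS: "G \<inter> ?S = {}" using \<V>(4) by (force simp: G_def \<V>1_def \<U>_def)
  have GN: "G' \<inter> ?N = {}" by (auto simp: G'_def \<V>1_def)
  have "openin (subtopology Z B) G" "openin (subtopology Z B) G'"
    using \<V>(2) by (auto simp: G_def G'_def \<V>1_def)
  then obtain H H' where H: "openin Z H" "G = H \<inter> B" and H': "openin Z H'" "G' = H' \<inter> B"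
    by (auto simp: openin_subtopology)
  have CZ: "C1 \<subseteq> topspace Z" "C2 \<subseteq> topspace Z" using C closedin_subset by auto
  have away: "X \<inter> Z closure_of Y = {}" if "openin Z O'" "X \<subseteq> O'" "O' \<inter> Y = {}" for X Y O'
    using that openin_Int_closure_of_eq_empty[of Z O' Y] by blast
  have a1: "C1 \<inter> Z closure_of G' = {}" by (rule away[OF NS(1,3)]) (use GN NN in blast)
  have a2: "C2 \<inter> Z closure_of G = {}" by (rule away[OF NS(2,4)]) (use GS SS in blast)
  have a3: "G \<inter> Z closure_of G' = {}" by (rule away[OF H(1)]) (use H(2) H'(2) GG0 in blast)+
  have a4: "G' \<inter> Z closure_of G = {}" by (rule away[OF H'(1)]) (use H(2) H'(2) GG0 in blast)+
  have sub: "C1 \<union> G \<subseteq> topspace Z" "C2 \<union> G' \<subseteq> topspace Z" using CZ GG B(1) by blast+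
  have b: "G \<inter> C2 = {}" "G' \<inter> C1 = {}" "C1 \<inter> C2 = {}"
    using GS NS(4) SS GN NS(3) NN C(3) unfolding disjnt_def by blast+
  have "separatedin Z (C1 \<union> G) (C2 \<union> G')"
    unfolding separatedin_def closure_of_Un closure_of_closedin[OF C(1)] closure_of_closedin[OF C(2)]
    using sub b a1 a2 a3 a4 by blast
  then obtain U V where "openin Z U" "openin Z V" "C1 \<union> G \<subseteq> U" "C2 \<union> G' \<subseteq> V" "disjnt U V"
    using metrizable_space_separation[OF Z] by metis
  then show thesis using that[of U V] GG by blast
qed

text \<open>
  Take a partition \<open>L \<subseteq> A\<close> between the points of \<open>C\<close> sent to the upper and to the lower third. On
  \<open>C \<inter> L\<close> the levels are in the middle third, so the base coordinate extends over \<open>L\<close> by the assumption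
  on \<open>A\<close>, and the level by the Tietze theorem. On either side of \<open>L\<close> the resulting map avoids one pole,
  and \<open>extend_to_open_cone\<close> applies.
\<close>
lemma e_dim_le_suspension:
  fixes Z :: "'z topology"
  assumes CW: "CW_structure K E" and Z: "compact_space Z" "metrizable_space Z" and A: "A \<subseteq> topspace Z"
    and eA: "\<And>L. closedin Z L \<Longrightarrow> L \<subseteq> A \<Longrightarrow> e_dim_le (subtopology Z L) K"
    and dB: "covering_dim_le (subtopology Z (topspace Z - A)) 0"
  shows "e_dim_le Z (suspension_space K)"
  unfolding e_dim_le_def
proof (intro allI impI, elim conjE)
  let ?S = "suspension_space K"
  fix C h assume C: "closedin Z C" and h: "continuous_map (subtopology Z C) ?S h"
  have CZ: "C \<subseteq> topspace Z" using C closedin_subset by blast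
  have topC: "topspace (subtopology Z C) = C" using CZ by auto
  have hS: "h z \<in> suspension_set K" if "z \<in> C" for z using h that topC by (auto simp: continuous_map_def Pi_iff)
  have lev: "continuous_map (subtopology Z C) euclideanreal (\<lambda>z. level (h z))"
    using continuous_map_compose[OF h continuous_map_level] by (simp add: o_def)
  have pre: "closedin Z {z \<in> C. level (h z) \<in> X}" if "closed X" for X
  proof -
    have "closedin (subtopology Z C) {z \<in> topspace (subtopology Z C). level (h z) \<in> X}"
      by (rule closedin_continuous_map_preimage[OF lev]) (use that in simp)
    then show ?thesis unfolding topC using C closedin_trans_full by blast
  qed
  define CN where "CN = {z \<in> C. level (h z) \<in> {2/3..}}"
  define CS where "CS = {z \<in> C. level (h z) \<in> {..1/3}}"
  have "closedin Z CN" "closedin Z CS" unfolding CN_def CS_def by (rule pre, simp)+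
  moreover have "disjnt CN CS" by (auto simp: CN_def CS_def disjnt_iff)
  ultimately obtain U V where UV: "openin Z U" "openin Z V" "CN \<subseteq> U" "CS \<subseteq> V" "disjnt U V" "topspace Z - A \<subseteq> U \<union> V"
    using partition_missing_zero_dimensional_set[OF Z(2) Diff_subset dB] by metis
  define L where "L = topspace Z - (U \<union> V)"
  have L: "closedin Z L" unfolding L_def using UV(1,2) by blast
  have LA: "L \<subseteq> A" using UV(6) by (auto simp: L_def)
  have LZ: "L \<subseteq> topspace Z" by (auto simp: L_def)
  have mid: "1/3 < level (h z) \<and> level (h z) < 2/3" if "z \<in> L \<inter> C" for z
    using that UV(3,4) by (auto simp: L_def CN_def CS_def not_le)
  have clLC: "closedin (subtopology Z L) (L \<inter> C)" using C by (auto simp: closedin_subtopology)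
  have "continuous_map (subtopology Z (L \<inter> C)) (subtopology ?S {x. 0 < level x \<and> level x < 1}) h"
    by (rule continuous_map_to_subtopologyI[OF continuous_map_from_subtopology_mono[OF h]]) (use mid in force)+
  from continuous_map_compose[OF this continuous_map_base_point]
  have "continuous_map (subtopology (subtopology Z L) (L \<inter> C)) K (\<lambda>z. base_point (h z))"
    by (simp add: o_def subtopology_subtopology Int_absorb1)
  then obtain \<psi> where \<psi>: "continuous_map (subtopology Z L) K \<psi>" "\<And>z. z \<in> L \<inter> C \<Longrightarrow> \<psi> z = base_point (h z)"
    using e_dim_leE[OF eA[OF L LA] clLC] by metis
  have "continuous_map (subtopology (subtopology Z L) (L \<inter> C)) euclideanreal (\<lambda>z. level (h z))"
    unfolding subtopology_subtopology by (rule continuous_map_from_subtopology_mono[OF lev]) auto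
  moreover have "(\<lambda>z. level (h z)) ` (L \<inter> C) \<subseteq> {1/3..2/3}" using mid by force
  ultimately obtain \<mu> where \<mu>: "continuous_map (subtopology Z L) euclideanreal \<mu>"
    "\<mu> ` topspace (subtopology Z L) \<subseteq> {1/3..2/3}" "\<And>z. z \<in> L \<inter> C \<Longrightarrow> \<mu> z = level (h z)"
    using Tietze_extension_realinterval[OF metrizable_imp_normal_space[OF metrizable_space_subtopology[OF Z(2)]] clLC,
        of "{1/3..2/3}" "\<lambda>z. level (h z)"] by auto
  have \<mu>I: "\<mu> z \<in> {1/3..2/3}" if "z \<in> L" for z
  proof -
    have "\<mu> z \<in> \<mu> ` topspace (subtopology Z L)" using that LZ by auto
    then show ?thesis using \<mu>(2) by blast
  qed
  have "continuous_map (subtopology Z L) unit_interval \<mu>"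
    by (rule continuous_map_to_subtopologyI[OF \<mu>(1)]) (use \<mu>I in force)
  then have "continuous_map (subtopology Z L) (prod_topology K unit_interval) (\<lambda>z. (\<psi> z, \<mu> z))"
    by (intro continuous_map_pairedI \<psi>(1))
  from continuous_map_compose[OF this continuous_map_suspension_proj]
  have pL: "continuous_map (subtopology Z L) ?S (\<lambda>z. suspension_proj (\<psi> z, \<mu> z))" by (simp add: o_def)
  define k where "k z = (if z \<in> C then h z else suspension_proj (\<psi> z, \<mu> z))" for z
  have kc: "continuous_map (subtopology Z (C \<union> L)) ?S k"
    unfolding k_def
  proof (rule continuous_map_paste_closed[OF C L h pL])
    fix z assume z: "z \<in> C" "z \<in> L"
    then have "suspension_proj (\<psi> z, \<mu> z) = suspension_proj (base_point (h z), level (h z))"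
      using \<psi>(2)[of z] \<mu>(3)[of z] by simp
    also have "\<dots> = h z" using mid[of z] z by (intro inner_levelD(3)[OF hS]) auto
    finally show "h z = suspension_proj (\<psi> z, \<mu> z)" by simp
  qed
  have levL: "1/3 \<le> level (k z) \<and> level (k z) \<le> 2/3" if "z \<in> L" for z
  proof (cases "z \<in> C")
    case True
    then show ?thesis using mid[of z] that by (simp add: k_def)
  next
    case False
    then show ?thesis using \<mu>I[OF that] by (simp add: k_def level_suspension_proj)
  qed
  have levN: "0 < level (k z)" if "z \<in> (C \<union> L) - V" for z
  proof (cases "z \<in> C")
    case True
    then show ?thesis using that UV(4) by (auto simp: k_def CS_def not_le)
  next
    case False
    then have "z \<in> L" using that by blast
    then show ?thesis using levL[of z] by linarith
  qed
  have levS: "0 < level (flip (k z))" if "z \<in> (C \<union> L) - U" for z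
  proof (cases "z \<in> C")
    case True
    then show ?thesis using that UV(3) by (auto simp: k_def CN_def not_le)
  next
    case False
    then have "z \<in> L" using that by blast
    then show ?thesis using levL[of z] by simp
  qed
  have cone: "\<exists>g. continuous_map (subtopology Z (topspace Z - O')) ?S g \<and> (\<forall>z\<in>(C \<union> L) - O'. g z = j z)"
    if O': "openin Z O'" and j: "continuous_map (subtopology Z (C \<union> L)) ?S j"
      and pos: "\<And>z. z \<in> (C \<union> L) - O' \<Longrightarrow> 0 < level (j z)" for O' j
  proof -
    let ?D = "(C \<union> L) - O'" and ?Z = "subtopology Z (topspace Z - O')"
    have D: "closedin Z ?D" using C L O' by blast
    have sub: "?D \<subseteq> topspace Z - O'" using CZ LZ by blast
    have D': "closedin ?Z ?D" using D sub by (rule closedin_subset_topspace)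
    have "compactin Z ?D" using D Z(1) closedin_compact_space by blast
    then have c: "compactin ?Z ?D" using sub by (simp add: compactin_subtopology)
    have "continuous_map (subtopology Z ?D) ?S j" by (rule continuous_map_from_subtopology_mono[OF j]) auto
    then have "continuous_map (subtopology ?Z ?D) ?S j" using sub by (simp add: subtopology_subtopology Int_absorb1)
    then obtain g where "continuous_map ?Z ?S g" "\<And>z. z \<in> ?D \<Longrightarrow> g z = j z"
      by (rule extend_to_open_cone[OF CW metrizable_space_subtopology[OF Z(2)] D' c _ pos]) (assumption | rule that; assumption)+
    then show ?thesis by blast
  qed
  obtain gN where gN: "continuous_map (subtopology Z (topspace Z - V)) ?S gN" "\<And>z. z \<in> (C \<union> L) - V \<Longrightarrow> gN z = k z"
    using cone[OF UV(2) kc levN] by blast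
  have "continuous_map (subtopology Z (C \<union> L)) ?S (\<lambda>z. flip (k z))"
    using continuous_map_compose[OF kc continuous_map_flip] by (simp add: o_def)
  from cone[OF UV(1) this levS] obtain g' where
    g': "continuous_map (subtopology Z (topspace Z - U)) ?S g'" "\<And>z. z \<in> (C \<union> L) - U \<Longrightarrow> g' z = flip (k z)"
    by blast
  have gS: "continuous_map (subtopology Z (topspace Z - U)) ?S (\<lambda>z. flip (g' z))"
    using continuous_map_compose[OF g'(1) continuous_map_flip] by (simp add: o_def)
  let ?g = "\<lambda>z. if z \<in> topspace Z - V then gN z else flip (g' z)"
  have "continuous_map (subtopology Z ((topspace Z - V) \<union> (topspace Z - U))) ?S ?g"
  proof (rule continuous_map_paste_closed[OF _ _ gN(1) gS])
    show "closedin Z (topspace Z - V)" "closedin Z (topspace Z - U)" using UV(1,2) by blast+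
    fix z assume "z \<in> topspace Z - V" "z \<in> topspace Z - U"
    then have "z \<in> L" "z \<in> (C \<union> L) - V" "z \<in> (C \<union> L) - U" by (auto simp: L_def)
    then show "gN z = flip (g' z)" using gN(2) g'(2) by simp
  qed
  moreover have "(topspace Z - V) \<union> (topspace Z - U) = topspace Z" using UV(5) by (auto simp: disjnt_iff)
  ultimately have "continuous_map Z ?S ?g" by simp
  moreover have "?g z = h z" if z: "z \<in> C" for z
  proof (cases "z \<in> V")
    case True
    then have "z \<in> (C \<union> L) - U" using UV(5) z by (auto simp: disjnt_iff)
    then show ?thesis using True g'(2) z by (simp add: k_def)
  next
    case False
    then have "z \<in> (C \<union> L) - V" "z \<in> topspace Z - V" using z CZ by auto
    then show ?thesis using gN(2)[of z] z by (simp add: k_def)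
  qed
  ultimately show "\<exists>g. continuous_map Z ?S g \<and> (\<forall>z\<in>C. g z = h z)" by blast
qed

section \<open>Generic maps to the interval\<close>

text \<open>
  Finitely many balls of radius \<open>1/(n + 1)\<close> cover, for each \<open>n\<close>.
\<close>
lemma compact_metrizable_imp_second_countable:
  assumes "compact_space X" "metrizable_space X"
  shows "second_countable X"
proof -
  obtain M d where Md: "Metric_space M d" "X = Metric_space.mtopology M d"
    using assms(2) by (auto simp: metrizable_space_def)
  interpret Metric_space M d by (rule Md)
  have c: "compactin mtopology M" using assms(1) Md(2) by (simp add: compact_space_def)
  have "\<exists>A. finite A \<and> A \<subseteq> M \<and> M \<subseteq> (\<Union>x\<in>A. mball x (inverse (real (Suc n))))" for n
  proof -
    have "\<exists>\<F>. finite \<F> \<and> \<F> \<subseteq> (\<lambda>x. mball x (inverse (real (Suc n)))) ` M \<and> M \<subseteq> \<Union>\<F>"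
      by (rule compactinD[OF c]) auto
    then obtain \<F> where \<F>: "finite \<F>" "\<F> \<subseteq> (\<lambda>x. mball x (inverse (real (Suc n)))) ` M" "M \<subseteq> \<Union>\<F>" by blast
    obtain A where "A \<subseteq> M" "finite A" "\<F> = (\<lambda>x. mball x (inverse (real (Suc n)))) ` A"
      using finite_subset_image[OF \<F>(1,2)] by blast
    then show ?thesis using \<F>(3) by blast
  qed
  then obtain A where A: "\<And>n. finite (A n)" "\<And>n. A n \<subseteq> M" "\<And>n. M \<subseteq> (\<Union>x\<in>A n. mball x (inverse (real (Suc n))))" by metis
  define \<B> where "\<B> = (\<Union>n. (\<lambda>x. mball x (inverse (real (Suc n)))) ` A n)"
  have "countable \<B>" unfolding \<B>_def using A(1) by (intro countable_UN) (auto intro: countable_finite)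
  moreover have "openin X V" if "V \<in> \<B>" for V using that unfolding \<B>_def Md(2) by auto
  moreover have "\<exists>V\<in>\<B>. x \<in> V \<and> V \<subseteq> U" if U: "openin X U" "x \<in> U" for U x
  proof -
    obtain r where r: "r > 0" "mball x r \<subseteq> U" using U unfolding Md(2) openin_mtopology by blast
    have xM: "x \<in> M" using U openin_subset Md(2) by fastforce
    obtain n where n: "inverse (real (Suc n)) < r / 2" using r(1) reals_Archimedean[of "r/2"] by auto
    obtain y where y: "y \<in> A n" "x \<in> mball y (inverse (real (Suc n)))" using A(3) xM by blast
    have "mball y (inverse (real (Suc n))) \<subseteq> mball x r"
    proof
      fix w assume w: "w \<in> mball y (inverse (real (Suc n)))"
      then have wM: "y \<in> M" "w \<in> M" "d y w < inverse (real (Suc n))" by (simp_all only: in_mball)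
      have "d y x < inverse (real (Suc n))" using y(2) by (simp only: in_mball)
      moreover have "d x w \<le> d x y + d y w" using xM wM by (intro triangle) auto
      ultimately have "d x w < r" using wM n commute[of x y] by linarith
      then show "w \<in> mball x r" using xM wM by simp
    qed
    then show ?thesis using y r(2) unfolding \<B>_def by blast
  qed
  ultimately show ?thesis unfolding second_countable_def by blast
qed

lemma compactum_star_space:
  assumes "compactum X" shows "compact_space (star_space X)" "metrizable_space (star_space X)"
  using assms unfolding compactum_def star_space_def
  by (simp_all add: compact_space_prod_topology compact_space_subtopology metrizable_space_prod_topology
      metrizable_space_subtopology metrizable_space_euclidean)

lemma topspace_star_space: "topspace (star_space X) = topspace X \<times> {0..1}"
  by (simp add: star_space_def)

lemma continuous_map_star_map:
  assumes "continuous_map X Y f" shows "continuous_map (star_space X) Y (star_map f)"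
  using continuous_map_compose[OF continuous_map_fst assms]
  by (simp add: star_space_def star_map_def o_def case_prod_unfold)

lemma mspace_maps_to_interval:
  assumes "compact_space Z"
  shows "g \<in> mspace (maps_to_interval Z) \<longleftrightarrow> g \<in> extensional (topspace Z) \<and> continuous_map Z unit_interval g"
proof -
  have "compactin Z (topspace Z)" using assms by (simp add: compact_space_def)
  then show ?thesis
    unfolding maps_to_interval_def by (subst compactin_mspace_cfunspace)
      (auto simp: mtopology_of_submetric continuous_map_in_subtopology)
qed

lemma mdist_maps_to_interval:
  assumes "f \<in> mspace (maps_to_interval Z)" "g \<in> mspace (maps_to_interval Z)" "mdist (maps_to_interval Z) f g < e" "z \<in> topspace Z"
  shows "\<bar>f z - g z\<bar> < e"
proof -
  have "mdist (submetric euclidean_metric {0..1}) (f z) (g z) \<le> mdist (maps_to_interval Z) f g"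
    using assms unfolding maps_to_interval_def by (intro mdist_cfunspace_imp_mdist_le[OF _ _ order_refl])
  then show ?thesis using assms(3) by (simp add: dist_real_def)
qed

lemma mdist_maps_to_interval_le:
  assumes "0 \<le> e" "\<And>z. z \<in> topspace Z \<Longrightarrow> \<bar>f z - g z\<bar> \<le> e"
  shows "mdist (maps_to_interval Z) f g \<le> e"
  unfolding maps_to_interval_def using assms by (intro mdist_cfunspace_le) (auto simp: dist_real_def)

lemma mcomplete_maps_to_interval: "mcomplete_of (maps_to_interval Z)"
proof -
  let ?I = "submetric euclidean_metric {0..1::real}"
  interpret I: Metric_space "mspace ?I" "mdist ?I" by (rule Metric_space_mspace_mdist)
  have "compact_space (mtopology_of ?I)"
    by (simp add: mtopology_of_submetric compact_space_subtopology del: mspace_submetric mdist_submetric)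
  then have "I.mcomplete" unfolding mtopology_of_def by (rule I.compact_space_imp_mcomplete)
  from I.mcomplete_cfunspace[OF this, of Z] show ?thesis
    unfolding maps_to_interval_def I.Self_def metric_collapse .
qed

lemma nowhere_dense_in_metricI:
  assumes "S \<subseteq> mspace m"
    and "\<And>g e. \<lbrakk>g \<in> mspace m; 0 < e\<rbrakk> \<Longrightarrow> \<exists>g1\<in>mspace m. \<exists>r>0. mdist m g g1 < e \<and> (\<forall>g2\<in>S. r \<le> mdist m g1 g2)"
  shows "nowhere_dense_in (mtopology_of m) S"
proof -
  interpret M: Metric_space "mspace m" "mdist m" by (rule Metric_space_mspace_mdist)
  have mt: "mtopology_of m = M.mtopology" by (simp add: mtopology_of_def)
  have "M.mtopology interior_of (M.mtopology closure_of S) = {}"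
  proof (rule ccontr)
    assume "M.mtopology interior_of (M.mtopology closure_of S) \<noteq> {}"
    then obtain g where g: "g \<in> M.mtopology interior_of (M.mtopology closure_of S)" by blast
    have "openin M.mtopology (M.mtopology interior_of (M.mtopology closure_of S))" by simp
    then obtain e where e: "e > 0" "M.mball g e \<subseteq> M.mtopology interior_of (M.mtopology closure_of S)"
      using g unfolding M.openin_mtopology by blast
    have gm: "g \<in> mspace m" using g interior_of_subset_topspace by fastforce
    obtain g1 r where g1: "g1 \<in> mspace m" "r > 0" "mdist m g g1 < e" "\<forall>g2\<in>S. r \<le> mdist m g1 g2"
      using assms(2)[OF gm e(1)] by blast
    have "g1 \<in> M.mball g e" using gm g1 by simp
    then have "g1 \<in> M.mtopology interior_of (M.mtopology closure_of S)" using e(2) by blast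
    then have "g1 \<in> M.mtopology closure_of S" by (rule subsetD[OF interior_of_subset])
    then obtain g2 where "g2 \<in> S" "g2 \<in> M.mball g1 r" using g1(2) unfolding M.metric_closure_of by blast
    then show False using g1(4) by fastforce
  qed
  then show ?thesis using assms(1) unfolding nowhere_dense_in_def mt by simp
qed

definition nowhere_constant :: "'a topology \<Rightarrow> ('a \<times> real \<Rightarrow> real) \<Rightarrow> bool" where
  "nowhere_constant X g \<longleftrightarrow>
    (\<forall>x\<in>topspace X. \<forall>a b. 0 \<le> a \<and> a < b \<and> b \<le> 1 \<longrightarrow> (\<exists>s\<in>{a..b}. g (x, s) \<noteq> g (x, a)))"

definition constant_somewhere :: "'a topology \<Rightarrow> real \<Rightarrow> real \<Rightarrow> ('a \<times> real \<Rightarrow> real) set" where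
  "constant_somewhere X a b =
    {g \<in> mspace (maps_to_interval (star_space X)). \<exists>x\<in>topspace X. \<forall>s\<in>{a..b}. g (x, s) = g (x, a)}"

text \<open>
  Choose \<open>s > a\<close> so close to \<open>a\<close> that \<open>g (x, a)\<close> and \<open>g (x, s)\<close> are close for all \<open>x\<close> at once, and add a
  small multiple of a function of the height that is \<open>0\<close> at \<open>a\<close> and \<open>1\<close> at \<open>s\<close>. This separates the two
  values by a fixed amount, for all \<open>x\<close> and all nearby maps. The convex combination keeps the values in
  \<open>I\<close>.
\<close>
lemma constant_somewhere_nowhere_dense:
  assumes X: "compactum X" and ab: "0 \<le> a" "a < b" "b \<le> 1"
  shows "nowhere_dense_in (mtopology_of (maps_to_interval (star_space X))) (constant_somewhere X a b)"
proof (rule nowhere_dense_in_metricI)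
  let ?S = "star_space X" let ?M = "maps_to_interval ?S"
  show "constant_somewhere X a b \<subseteq> mspace ?M" by (auto simp: constant_somewhere_def)
  fix g and e :: real assume g: "g \<in> mspace ?M" and e: "0 < e"
  \<comment> \<open>The weight of the perturbation: less than \<open>e\<close>, and at most \<open>1/2\<close> for a convex combination.\<close>
  define c where "c = min (e/2) (1/2)"
  have c: "0 < c" "c \<le> 1/2" "c < e" using e by (auto simp: c_def)
  have gc: "continuous_map ?S unit_interval g" using g mspace_maps_to_interval[OF compactum_star_space(1)[OF X]] by blast
  have gr: "continuous_map ?S euclideanreal g" using gc by (simp add: continuous_map_in_subtopology)
  have gI: "g z \<in> {0..1}" if "z \<in> topspace ?S" for z using gc that by (auto simp: continuous_map_def Pi_iff)
  have sndS: "continuous_map ?S euclideanreal snd"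
    unfolding star_space_def using continuous_map_snd[of X unit_interval] by (simp add: continuous_map_in_subtopology)
  have ca: "continuous_map ?S ?S (\<lambda>z. (fst z, a))"
    unfolding star_space_def using ab by (intro continuous_map_pairedI continuous_map_fst) auto
  have ga: "continuous_map ?S euclideanreal (\<lambda>z. g (fst z, a))"
    using continuous_map_compose[OF ca gr] by (simp add: o_def)
  define W where "W = {z \<in> topspace ?S. \<bar>g z - g (fst z, a)\<bar> \<in> {..<c/2}}"
  have "openin ?S W" unfolding W_def
    by (rule openin_continuous_map_preimage[of _ euclideanreal]) (intro continuous_intros gr ga, simp)
  moreover have "compactin X (topspace X)" using X by (simp add: compactum_def compact_space_def)
  moreover have "topspace X \<times> {a} \<subseteq> W" using ab c(1) by (auto simp: W_def topspace_star_space)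
  ultimately obtain U V where UV: "openin X U" "openin unit_interval V" "topspace X \<subseteq> U" "a \<in> V" "U \<times> V \<subseteq> W"
    using tube_lemma_left[of X unit_interval W "topspace X" a] ab unfolding star_space_def by auto
  obtain V' where V': "open V'" "V = {0..1} \<inter> V'" using UV(2) by (auto simp: openin_open)
  obtain r where r: "r > 0" "ball a r \<subseteq> V'" using V' UV(4) by (metis IntD2 open_contains_ball)
  define s where "s = min b (a + r/2)"
  have s: "a < s" "s \<le> b" "s \<le> 1" "0 \<le> s" "\<bar>s - a\<bar> < r" using ab r(1) by (auto simp: s_def)
  have sV: "s \<in> V" using s r(2) V'(2) by (auto simp: dist_real_def)
  have small: "\<bar>g (x, s) - g (x, a)\<bar> < c/2" if "x \<in> topspace X" for x
  proof -
    have "(x, s) \<in> W" using that UV(3,5) sV by blast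
    then show ?thesis by (simp add: W_def)
  qed
  define p where "p t = min 1 (\<bar>t - a\<bar> / (s - a))" for t
  have p: "p a = 0" "p s = 1" "0 \<le> p t" "p t \<le> 1" for t using s by (auto simp: p_def)
  define g1 where "g1 = restrict (\<lambda>z. (1 - c) * g z + c * p (snd z)) (topspace ?S)"
  have g1v: "g1 z = (1 - c) * g z + c * p (snd z)" if "z \<in> topspace ?S" for z using that by (simp add: g1_def)
  have pc: "continuous_map ?S euclideanreal (\<lambda>z. p (snd z))"
    unfolding p_def using s by (intro continuous_intros sndS) auto
  have "continuous_map ?S euclideanreal (\<lambda>z. (1 - c) * g z + c * p (snd z))"
    by (intro continuous_intros gr pc)
  then have "continuous_map ?S euclideanreal g1" by (rule continuous_map_eq) (simp add: g1_def)
  moreover have "g1 ` topspace ?S \<subseteq> {0..1}"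
  proof clarify
    fix x t assume "(x, t) \<in> topspace ?S"
    then have "0 \<le> g (x, t)" "g (x, t) \<le> 1" "g1 (x, t) = (1 - c) * g (x, t) + c * p t" using gI g1v by auto
    moreover have "(1 - c) * g (x, t) + c * p t \<le> 1" using calculation p(4) c by (intro convex_bound_le) auto
    moreover have "0 \<le> (1 - c) * g (x, t) + c * p t" using calculation p(3) c by (intro add_nonneg_nonneg mult_nonneg_nonneg) auto
    ultimately show "g1 (x, t) \<in> {0..1}" by simp
  qed
  ultimately have "continuous_map ?S unit_interval g1" by (rule continuous_map_to_subtopologyI)
  then have g1M: "g1 \<in> mspace ?M"
    using mspace_maps_to_interval[OF compactum_star_space(1)[OF X]] by (simp add: g1_def)
  have "mdist ?M g g1 \<le> c"
  proof (rule mdist_maps_to_interval_le)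
    fix z assume z: "z \<in> topspace ?S"
    have "g z - g1 z = c * (g z - p (snd z))" using g1v[OF z] by (simp add: algebra_simps)
    moreover have "\<bar>g z - p (snd z)\<bar> \<le> 1" using gI[OF z] p(3,4)[of "snd z"] by (auto simp: abs_le_iff)
    ultimately show "\<bar>g z - g1 z\<bar> \<le> c" using c(1) by (simp add: abs_mult mult_left_le)
  qed (use c in simp)
  \<comment> \<open>The values of \<open>g1\<close> at the heights \<open>a\<close> and \<open>s\<close> differ by at least \<open>c/2\<close>; either moves by less than \<open>c/8\<close>.\<close>
  moreover have "c/8 \<le> mdist ?M g1 g2" if g2: "g2 \<in> constant_somewhere X a b" for g2
  proof (rule ccontr)
    assume "\<not> c/8 \<le> mdist ?M g1 g2"
    then have lt: "mdist ?M g1 g2 < c/8" by simp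
    obtain x where x: "x \<in> topspace X" "\<forall>s\<in>{a..b}. g2 (x, s) = g2 (x, a)" and g2M: "g2 \<in> mspace ?M"
      using g2 by (auto simp: constant_somewhere_def)
    have z: "(x, a) \<in> topspace ?S" "(x, s) \<in> topspace ?S" using x ab s by (auto simp: topspace_star_space)
    have "g2 (x, s) = g2 (x, a)" using bspec[OF x(2), of s] s by simp
    moreover have "\<bar>g1 (x, a) - g2 (x, a)\<bar> < c/8" "\<bar>g1 (x, s) - g2 (x, s)\<bar> < c/8"
      using mdist_maps_to_interval[OF g1M g2M lt] z by auto
    moreover have "g1 (x, s) - g1 (x, a) = (1 - c) * (g (x, s) - g (x, a)) + c"
      using g1v[OF z(1)] g1v[OF z(2)] p(1,2) by (simp add: algebra_simps)
    moreover have "\<bar>(1 - c) * (g (x, s) - g (x, a))\<bar> \<le> 1 * (c/2)"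
      unfolding abs_mult using c small[OF x(1)] by (intro mult_mono) auto
    ultimately show False using c(1) by linarith
  qed
  ultimately show "\<exists>g1\<in>mspace ?M. \<exists>r>0. mdist ?M g g1 < e \<and> (\<forall>g2\<in>constant_somewhere X a b. r \<le> mdist ?M g1 g2)"
    using g1M c by (intro bexI[of _ g1] exI[of _ "c/8"]) auto
qed

definition rational_pairs :: "(real \<times> real) set" where
  "rational_pairs = {(a, b). a \<in> \<rat> \<and> b \<in> \<rat> \<and> 0 \<le> a \<and> a < b \<and> b \<le> 1}"

lemma countable_rational_pairs: "countable rational_pairs"
  by (rule countable_subset[of _ "\<rat> \<times> \<rat>"]) (auto simp: rational_pairs_def countable_rat)

lemma not_nowhere_constant:
  assumes "g \<in> mspace (maps_to_interval (star_space X))" "\<not> nowhere_constant X g"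
  shows "g \<in> (\<Union>(a, b)\<in>rational_pairs. constant_somewhere X a b)"
proof -
  obtain x a b where x: "x \<in> topspace X" "0 \<le> a" "a < b" "b \<le> 1" "\<And>s. s \<in> {a..b} \<Longrightarrow> g (x, s) = g (x, a)"
    using assms(2) unfolding nowhere_constant_def by blast
  obtain a' where a': "a' \<in> \<rat>" "a < a'" "a' < b" using Rats_dense_in_real[OF x(3)] by blast
  obtain b' where b': "b' \<in> \<rat>" "a' < b'" "b' < b" using Rats_dense_in_real[OF a'(3)] by blast
  have "g (x, s) = g (x, a')" if "s \<in> {a'..b'}" for s
    using x(5)[of s] x(5)[of a'] that a' b' by auto
  then have "\<forall>s\<in>{a'..b'}. g (x, s) = g (x, a')" by blast
  then have "g \<in> constant_somewhere X a' b'" using assms(1) x(1) unfolding constant_somewhere_def by blast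
  moreover have "(a', b') \<in> rational_pairs" using a' b' x by (auto simp: rational_pairs_def)
  ultimately show ?thesis by blast
qed

text \<open>
  The form in which nowhere constancy is used: level sets on vertical intervals have no interior. The
  interval \<open>(a, b)\<close> may reach beyond \<open>I\<close>.
\<close>
lemma nowhere_constant_gap:
  assumes g: "nowhere_constant X g" and x: "x \<in> topspace X" and ab: "a < b"
  obtains s where "a < s" "s < b" "\<not> (s \<in> {0..1} \<and> g (x, s) = t)"
proof (cases "0 < b \<and> a < 1")
  case False
  show thesis by (rule that[of "(a + b)/2"]) (use False ab in auto)
next
  case True
  define a' where "a' = max a 0"
  define b' where "b' = min b 1"
  have ab': "a' < b'" "0 \<le> a'" "a \<le> a'" "b' \<le> 1" "b' \<le> b" using True ab by (auto simp: a'_def b'_def)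
  define p where "p = a' + (b' - a')/3"
  define q where "q = a' + 2*(b' - a')/3"
  have pq: "a' < p" "p < q" "q < b'" using ab' by (auto simp: p_def q_def field_simps)
  then have "0 \<le> p \<and> p < q \<and> q \<le> 1" using ab' by auto
  then obtain s where s: "s \<in> {p..q}" "g (x, s) \<noteq> g (x, p)" using g x unfolding nowhere_constant_def by blast
  show thesis
  proof (cases "g (x, p) = t")
    case True
    then show thesis using s pq ab' by (intro that[of s]) auto
  next
    case False
    then show thesis using pq ab' by (intro that[of p]) auto
  qed
qed

lemma first_category_in_subset:
  assumes "countable \<N>" "\<And>N. N \<in> \<N> \<Longrightarrow> nowhere_dense_in X N" "S \<subseteq> \<Union>\<N>"
  shows "first_category_in X S"
  unfolding first_category_in_def
proof (intro exI conjI ballI)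
  show "countable ((\<lambda>N. S \<inter> N) ` \<N>)" using assms(1) by blast
  fix N' assume "N' \<in> (\<lambda>N. S \<inter> N) ` \<N>"
  then obtain N where N: "N \<in> \<N>" "N' = S \<inter> N" by blast
  then have "X closure_of N' \<subseteq> X closure_of N" by (intro closure_of_mono) auto
  then have "X interior_of (X closure_of N') \<subseteq> X interior_of (X closure_of N)" by (rule interior_of_mono)
  then show "nowhere_dense_in X N'" using assms(2)[OF N(1)] N(2) unfolding nowhere_dense_in_def by blast
qed (use assms(3) in blast)

text \<open>
  A fiber of \<open>(f\<^sub>*, g)\<close> is a closed subset of the product of a fiber of \<open>f\<close> with \<open>I\<close>, with vertical sections
  without interior.
\<close>
lemma e_dim_le_fiber_of_light:
  assumes CW: "CW_structure K E" and X: "compactum X" and Y: "Hausdorff_space Y" and f: "continuous_map X Y f"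
    and g: "continuous_map (star_space X) unit_interval g" "nowhere_constant X g"
    and y: "y \<in> topspace Y" and e: "e_dim_le (fiber X f y) K"
  shows "e_dim_le (fiber (star_space X) (\<lambda>z. (star_map f z, g z)) (y, t)) K"
proof -
  let ?F = "fiber X f y"
  define F0 where "F0 = {x \<in> topspace X. f x = y}"
  define Z where "Z = {z \<in> topspace (star_space X). (star_map f z, g z) = (y, t)}"
  have Xc: "compact_space X" "metrizable_space X" using X by (auto simp: compactum_def)
  have F0: "closedin X F0"
  proof -
    have "closedin X {x \<in> topspace X. f x \<in> {y}}"
      by (rule closedin_continuous_map_preimage[OF f]) (rule closedin_Hausdorff_singleton[OF Y y])
    then show ?thesis by (simp add: F0_def)
  qed
  have Feq: "?F = subtopology X F0" by (simp add: F0_def)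
  have Fc: "compact_space ?F" "metrizable_space ?F"
    unfolding Feq using closedin_compact_space[OF Xc(1) F0] Xc(2)
    by (simp_all add: compact_space_subtopology metrizable_space_subtopology)
  have topF: "topspace ?F = F0" by (auto simp: F0_def)
  let ?P = "prod_topology ?F unit_interval"
  have P: "?P = subtopology (star_space X) (F0 \<times> {0..1})"
    unfolding Feq star_space_def subtopology_Times by (simp add: subtopology_subtopology)
  have ZP: "Z \<subseteq> F0 \<times> {0..1}" by (auto simp: Z_def F0_def topspace_star_space star_map_def)
  have gP: "continuous_map ?P euclideanreal g"
    unfolding P by (rule continuous_map_from_subtopology) (use g(1) in \<open>simp add: continuous_map_in_subtopology\<close>)
  have "closedin ?P {z \<in> topspace ?P. g z \<in> {t}}" by (rule closedin_continuous_map_preimage[OF gP]) simp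
  moreover have "{z \<in> topspace ?P. g z \<in> {t}} = Z"
    unfolding topspace_prod_topology topF by (auto simp: Z_def F0_def topspace_star_space star_map_def)
  ultimately have Z: "closedin ?P Z" by simp
  have "e_dim_le (subtopology ?P Z) K"
  proof (rule e_dim_le_light_over[OF CW Fc e Z])
    fix x a b assume x: "x \<in> topspace ?F" and ab: "a < (b::real)"
    then have "x \<in> topspace X" by simp
    from nowhere_constant_gap[OF g(2) this ab, of t] obtain s where s: "a < s" "s < b" "\<not> (s \<in> {0..1} \<and> g (x, s) = t)" .
    then have "(x, s) \<notin> Z" by (auto simp: Z_def topspace_star_space)
    then show "\<exists>s. a < s \<and> s < b \<and> (x, s) \<notin> Z" using s by blast
  qed
  moreover have "subtopology ?P Z = subtopology (star_space X) Z"
    unfolding P using ZP by (simp add: subtopology_subtopology Int_absorb1)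
  ultimately show ?thesis by (simp add: Z_def)
qed

lemma prop0_imp_prop3:
  assumes X: "compactum X" and Y: "compactum Y" and f: "continuous_map X Y f" and K: "CW_complex K" and p: "prop0 X Y f K"
  shows "prop3 X Y f K"
  unfolding prop3_def almost_every_map_def
proof (rule first_category_in_subset)
  let ?S = "star_space X"
  obtain E where CW: "CW_structure K E" using K by (auto simp: CW_complex_def)
  have HY: "Hausdorff_space Y" using Y by (simp add: compactum_def metrizable_imp_Hausdorff_space)
  show "countable ((\<lambda>(a, b). constant_somewhere X a b) ` rational_pairs)" using countable_rational_pairs by blast
  show "nowhere_dense_in (mtopology_of (maps_to_interval ?S)) N" if "N \<in> (\<lambda>(a, b). constant_somewhere X a b) ` rational_pairs" for N
    using that constant_somewhere_nowhere_dense[OF X] by (auto simp: rational_pairs_def)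
  show "{g \<in> mspace (maps_to_interval ?S). \<not> e_dim_map_le ?S (prod_topology Y unit_interval) (\<lambda>z. (star_map f z, g z)) K}
    \<subseteq> \<Union> ((\<lambda>(a, b). constant_somewhere X a b) ` rational_pairs)"
  proof clarify
    fix g assume g: "g \<in> mspace (maps_to_interval ?S)"
      and n: "\<not> e_dim_map_le ?S (prod_topology Y unit_interval) (\<lambda>z. (star_map f z, g z)) K"
    have gc: "continuous_map ?S unit_interval g" using g mspace_maps_to_interval[OF compactum_star_space(1)[OF X]] by blast
    have "\<not> nowhere_constant X g"
    proof
      assume l: "nowhere_constant X g"
      have "e_dim_map_le ?S (prod_topology Y unit_interval) (\<lambda>z. (star_map f z, g z)) K"
        unfolding e_dim_map_le_def
      proof
        fix w assume w: "w \<in> topspace (prod_topology Y unit_interval)"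
        then obtain y t where yt: "w = (y, t)" "y \<in> topspace Y" by auto
        have "e_dim_le (fiber X f y) K" using p yt(2) unfolding prop0_def e_dim_map_le_def by blast
        then show "e_dim_le (fiber ?S (\<lambda>z. (star_map f z, g z)) w) K"
          unfolding yt(1) by (rule e_dim_le_fiber_of_light[OF CW X HY f gc l yt(2)])
      qed
      then show False using n by blast
    qed
    then show "g \<in> \<Union> ((\<lambda>(a, b). constant_somewhere X a b) ` rational_pairs)"
      using not_nowhere_constant[OF g] by blast
  qed
qed

lemma first_category_in_nowhere_denseD:
  assumes "first_category_in X S"
  obtains \<N> where "countable \<N>" "\<And>N. N \<in> \<N> \<Longrightarrow> nowhere_dense_in X N" "S = \<Union>\<N>"
  using assms unfolding first_category_in_def by blast

text \<open>
  Both properties hold on residual sets, and the metric space of maps is complete.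
\<close>
lemma generic_map_exists:
  assumes X: "compactum X" and p: "prop3 X Y f K"
    and W: "openin (mtopology_of (maps_to_interval (star_space X))) W" "W \<noteq> {}"
  obtains g where "g \<in> W" "nowhere_constant X g"
    "e_dim_map_le (star_space X) (prod_topology Y unit_interval) (\<lambda>z. (star_map f z, g z)) K"
proof -
  let ?M = "maps_to_interval (star_space X)"
  let ?T = "mtopology_of ?M"
  let ?bad = "{g \<in> mspace ?M. \<not> e_dim_map_le (star_space X) (prod_topology Y unit_interval) (\<lambda>z. (star_map f z, g z)) K}"
  interpret M: Metric_space "mspace ?M" "mdist ?M" by (rule Metric_space_mspace_mdist)
  have mt: "?T = M.mtopology" by (simp add: mtopology_of_def)
  have "first_category_in ?T ?bad" using p unfolding prop3_def almost_every_map_def .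
  then obtain \<N> where N: "countable \<N>" "\<And>N. N \<in> \<N> \<Longrightarrow> nowhere_dense_in ?T N" "?bad = \<Union>\<N>"
    by (rule first_category_in_nowhere_denseD) (rule that; assumption)
  define \<N>' where "\<N>' = \<N> \<union> (\<lambda>(a, b). constant_somewhere X a b) ` rational_pairs"
  have N': "nowhere_dense_in ?T N" if "N \<in> \<N>'" for N
    using that N(2) constant_somewhere_nowhere_dense[OF X] by (auto simp: \<N>'_def rational_pairs_def)
  have "countable \<N>'" unfolding \<N>'_def using N(1) countable_rational_pairs by blast
  have "M.mtopology interior_of \<Union>((\<lambda>N. M.mtopology closure_of N) ` \<N>') = {}"
  proof (rule M.metric_Baire_category_alt)
    show "M.mcomplete" using mcomplete_maps_to_interval[of "star_space X"] by (simp add: mcomplete_of_def)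
    show "countable ((\<lambda>N. M.mtopology closure_of N) ` \<N>')" using \<open>countable \<N>'\<close> by blast
    show "closedin M.mtopology T \<and> M.mtopology interior_of T = {}" if "T \<in> (\<lambda>N. M.mtopology closure_of N) ` \<N>'" for T
      using that N' unfolding nowhere_dense_in_def mt by auto
  qed
  moreover have "openin M.mtopology W" using W(1) mt by simp
  ultimately have "\<not> W \<subseteq> \<Union>((\<lambda>N. M.mtopology closure_of N) ` \<N>')"
    using W(2) interior_of_maximal by blast
  then obtain g where g: "g \<in> W" "g \<notin> \<Union>((\<lambda>N. M.mtopology closure_of N) ` \<N>')" by blast
  have gM: "g \<in> mspace ?M" using g(1) \<open>openin M.mtopology W\<close> openin_subset by fastforce
  have gN: "g \<notin> N" if "N \<in> \<N>'" for N
  proof -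
    have "N \<subseteq> topspace M.mtopology" using N'[OF that] unfolding nowhere_dense_in_def mt by blast
    then have "N \<subseteq> M.mtopology closure_of N" by (rule closure_of_subset)
    then show ?thesis using g(2) that by blast
  qed
  have "nowhere_constant X g"
    using not_nowhere_constant[OF gM] gN unfolding \<N>'_def by blast
  moreover have "g \<notin> ?bad" using gN N(3) unfolding \<N>'_def by blast
  ultimately show thesis using that g(1) gM by blast
qed

section \<open>A compact zero-dimensional set meeting every vertical interval\<close>

text \<open>
  A Cantor set of real sequences, so that it carries the product topology of the sequence space.
\<close>
definition binary_sequences :: "(nat \<Rightarrow> real) set" where
  "binary_sequences = PiE UNIV (\<lambda>_. {0, 1})"

lemma binary_sequencesD: "c \<in> binary_sequences \<Longrightarrow> c i = 0 \<or> c i = 1"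
  by (auto simp: binary_sequences_def PiE_iff)

lemma compact_binary_sequences: "compact binary_sequences"
proof -
  have "compactin (product_topology (\<lambda>_. euclidean) UNIV) (PiE UNIV (\<lambda>i::nat. {0, 1::real}))"
    by (subst compactin_PiE) (auto intro: finite_imp_compact)
  then show ?thesis by (simp add: euclidean_product_topology binary_sequences_def)
qed

lemma binary_series:
  fixes w :: "nat \<Rightarrow> real"
  assumes "summable w" "\<And>j. 0 \<le> w j"
  shows "continuous_on binary_sequences (\<lambda>c. \<Sum>j. w j * c (e j))"
    "c \<in> binary_sequences \<Longrightarrow> summable (\<lambda>j. w j * c (e j))"
proof -
  have le: "norm (w j * c (e j)) \<le> w j" if "c \<in> binary_sequences" for c j
    using binary_sequencesD[OF that, of "e j"] assms(2)[of j] by auto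
  have "uniform_limit binary_sequences (\<lambda>n c. \<Sum>j<n. w j * c (e j)) (\<lambda>c. \<Sum>j. w j * c (e j)) sequentially"
    by (rule Weierstrass_m_test[OF le assms(1)])
  moreover have "continuous_on binary_sequences (\<lambda>c. \<Sum>j<n. w j * c (e j))" for n
    by (intro continuous_on_sum continuous_on_mult continuous_on_const continuous_on_coordinate)
  ultimately show "continuous_on binary_sequences (\<lambda>c. \<Sum>j. w j * c (e j))"
    by (intro uniform_limit_theorem[OF always_eventually]) auto
  show "summable (\<lambda>j. w j * c (e j))" if "c \<in> binary_sequences"
    by (rule summable_comparison_test'[OF assms(1) le[OF that]])
qed

lemma quarter_sums: "(\<lambda>j. (1/4::real) ^ Suc j) sums (1/3)"
  using sums_mult[OF geometric_sums[of "1/4::real"], of "1/4"] by simp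

text \<open>
  Base \<open>4\<close> with digits \<open>0\<close> and \<open>1\<close>: each weight exceeds the sum of all later ones, hence injectivity.
\<close>
definition cantor_number :: "(nat \<Rightarrow> real) \<Rightarrow> real" where
  "cantor_number c = (\<Sum>j. (1/4) ^ Suc j * c j)"

lemma continuous_on_cantor_number: "continuous_on binary_sequences cantor_number"
  unfolding cantor_number_def
  by (rule binary_series(1)[where e="\<lambda>j. j"]) (use quarter_sums in \<open>auto simp: sums_iff\<close>)

lemma summable_cantor_number: "c \<in> binary_sequences \<Longrightarrow> summable (\<lambda>j. (1/4) ^ Suc j * c j)"
  by (rule binary_series(2)[where e="\<lambda>j. j"]) (use quarter_sums in \<open>auto simp: sums_iff\<close>)

lemma cantor_number_bounds:
  assumes "c \<in> binary_sequences" shows "0 \<le> cantor_number c" "cantor_number c \<le> 1/3"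
proof -
  have b: "0 \<le> c j" "c j \<le> 1" for j using binary_sequencesD[OF assms, of j] by auto
  show "0 \<le> cantor_number c" unfolding cantor_number_def
    by (rule suminf_nonneg[OF summable_cantor_number[OF assms]]) (simp add: b)
  have "cantor_number c \<le> (\<Sum>j. (1/4) ^ Suc j)" unfolding cantor_number_def
    using b quarter_sums by (intro suminf_le summable_cantor_number[OF assms]) (auto simp: sums_iff intro: mult_left_le)
  also have "\<dots> = 1/3" using quarter_sums by (simp add: sums_iff)
  finally show "cantor_number c \<le> 1/3" .
qed

lemma inj_on_cantor_number: "inj_on cantor_number binary_sequences"
proof (rule inj_onI, rule ccontr)
  fix c c' assume c: "c \<in> binary_sequences" "c' \<in> binary_sequences" and eq: "cantor_number c = cantor_number c'" and ne: "c \<noteq> c'"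
  define i where "i = (LEAST i. c i \<noteq> c' i)"
  have "\<exists>i. c i \<noteq> c' i" using ne by blast
  then have i: "c i \<noteq> c' i" unfolding i_def by (rule LeastI_ex)
  have below: "c j = c' j" if "j < i" for j using not_less_Least[OF that[unfolded i_def]] by blast
  define w where "w j = (1/4::real) ^ Suc j" for j
  define t where "t j = w j * (c j - c' j)" for j
  have tle: "norm (t j) \<le> w j" for j
    using binary_sequencesD[OF c(1), of j] binary_sequencesD[OF c(2), of j] by (auto simp: t_def w_def)
  have sw: "summable w" unfolding w_def by (rule sums_summable[OF quarter_sums])
  have st: "summable t" by (rule summable_comparison_test'[OF sw tle])
  have "(\<Sum>j. t j) = cantor_number c - cantor_number c'"
    using suminf_diff[OF summable_cantor_number[OF c(1)] summable_cantor_number[OF c(2)]]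
    by (simp add: cantor_number_def t_def w_def right_diff_distrib)
  then have "0 = (\<Sum>j. t j)" using eq by simp
  also have "\<dots> = (\<Sum>j. t (j + Suc i)) + (\<Sum>j<Suc i. t j)" by (rule suminf_split_initial_segment[OF st])
  also have "(\<Sum>j<Suc i. t j) = t i" using below by (simp add: t_def)
  finally have "\<bar>t i\<bar> = \<bar>\<Sum>j. t (j + Suc i)\<bar>" by linarith
  also have "\<dots> \<le> (\<Sum>j. w (j + Suc i))"
  proof -
    have s1: "summable (\<lambda>j. w (j + Suc i))" using sw by (simp only: summable_iff_shift)
    then have "summable (\<lambda>j. norm (t (j + Suc i)))" using tle by (intro summable_comparison_test'[OF s1]) simp
    then have "norm (\<Sum>j. t (j + Suc i)) \<le> (\<Sum>j. norm (t (j + Suc i)))" by (rule summable_norm)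
    also have "\<dots> \<le> (\<Sum>j. w (j + Suc i))" by (intro suminf_le tle \<open>summable (\<lambda>j. norm (t (j + Suc i)))\<close> s1)
    finally show ?thesis by simp
  qed
  also have "\<dots> = w i * (1/3)"
  proof -
    have "(\<lambda>j. w i * (1/4) ^ Suc j) sums (w i * (1/3))" by (rule sums_mult[OF quarter_sums])
    moreover have "w i * (1/4) ^ Suc j = w (j + Suc i)" for j by (simp add: w_def power_add)
    ultimately show ?thesis by (simp add: sums_iff)
  qed
  finally have "\<bar>t i\<bar> \<le> w i * (1/3)" .
  moreover have "\<bar>t i\<bar> = w i"
    using i binary_sequencesD[OF c(1), of i] binary_sequencesD[OF c(2), of i] by (auto simp: t_def w_def)
  moreover have "w i > 0" by (simp add: w_def)
  ultimately show False by simp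
qed

text \<open>
  If the image contained an interval, the coordinates of the inverse would be continuous functions on it
  with two values, hence constant, and the inverse would be constant.
\<close>
lemma cantor_number_gaps:
  assumes ab: "a < (b::real)" shows "\<exists>s. a < s \<and> s < b \<and> s \<notin> cantor_number ` binary_sequences"
proof (rule ccontr)
  assume "\<not> ?thesis"
  then have sub: "{a<..<b} \<subseteq> cantor_number ` binary_sequences" by auto
  define g where "g = the_inv_into binary_sequences cantor_number"
  have gf: "\<forall>c\<in>binary_sequences. g (cantor_number c) = c"
    unfolding g_def using inj_on_cantor_number by (simp add: the_inv_into_f_f)
  have gc: "continuous_on (cantor_number ` binary_sequences) g"
    by (rule continuous_on_inv[OF continuous_on_cantor_number compact_binary_sequences gf])
  have const: "g s i = g t i" if st: "s \<in> {a<..<b}" "t \<in> {a<..<b}" for s t i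
  proof -
    have "continuous_on {a<..<b} (\<lambda>s. g s i)"
      by (rule continuous_on_product_then_coordinatewise[OF continuous_on_subset[OF gc sub]])
    then have con: "connected ((\<lambda>s. g s i) ` {a<..<b})" by (rule connected_continuous_image) simp
    have "g s i \<in> {0, 1}" if "s \<in> {a<..<b}" for s
    proof -
      obtain c where "c \<in> binary_sequences" "s = cantor_number c" using sub \<open>s \<in> {a<..<b}\<close> by blast
      then show ?thesis using gf binary_sequencesD[of c i] by auto
    qed
    then have "(\<lambda>s. g s i) ` {a<..<b} \<subseteq> {0, 1}" by blast
    then have "finite ((\<lambda>s. g s i) ` {a<..<b})" by (rule finite_subset) simp
    then obtain x where "(\<lambda>s. g s i) ` {a<..<b} = {x} \<or> (\<lambda>s. g s i) ` {a<..<b} = {}"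
      using con connected_finite_iff_sing by blast
    then show ?thesis using st by (metis (no_types, lifting) empty_iff image_eqI singletonD)
  qed
  define s where "s = a + (b - a)/3"
  define t where "t = a + 2*(b - a)/3"
  have st: "s \<in> {a<..<b}" "t \<in> {a<..<b}" "s \<noteq> t" using ab by (auto simp: s_def t_def field_simps)
  obtain c c' where c: "c \<in> binary_sequences" "s = cantor_number c" "c' \<in> binary_sequences" "t = cantor_number c'"
    using sub st by blast
  have "c i = c' i" for i using const[OF st(1,2), of i] gf c by simp
  then have "c = c'" by blast
  then show False using c st by simp
qed

text \<open>
  The digits are those of \<open>\<lfloor>2 ^ n * x\<rfloor>\<close>; the partial sums are these integers divided by \<open>2 ^ n\<close>.
\<close>
lemma binary_expansion_exists:
  fixes x :: real
  assumes x: "0 \<le> x" "x < 1"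
  obtains b where "\<And>j. b j \<in> {0, 1::real}" "(\<lambda>j. (1/2) ^ Suc j * b j) sums x"
proof -
  define m where "m n = \<lfloor>2 ^ n * x\<rfloor>" for n :: nat
  define b where "b j = real_of_int (m (Suc j) mod 2)" for j
  have step: "real_of_int (m (Suc n)) = 2 * real_of_int (m n) + b n" for n
  proof -
    have "m n = \<lfloor>2 ^ Suc n * x / real_of_int 2\<rfloor>" by (simp add: m_def)
    also have "\<dots> = m (Suc n) div 2" by (subst floor_divide_real_eq_div) (simp_all add: m_def)
    finally have "m n = m (Suc n) div 2" .
    then have "m (Suc n) = 2 * m n + m (Suc n) mod 2" by simp
    then show ?thesis unfolding b_def by linarith
  qed
  have part: "(\<Sum>j<n. (1/2) ^ Suc j * b j) = real_of_int (m n) / 2 ^ n" for n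
  proof (induction n)
    case 0
    have "m 0 = 0" using x by (simp add: m_def floor_eq_iff)
    then show ?case by simp
  next
    case (Suc n)
    then have "(\<Sum>j<Suc n. (1/2) ^ Suc j * b j) = real_of_int (m n) / 2 ^ n + b n / 2 ^ Suc n"
      by (simp add: power_one_over divide_simps)
    also have "\<dots> = (2 * real_of_int (m n) + b n) / 2 ^ Suc n" by (simp add: add_divide_distrib)
    finally show ?case by (simp only: step)
  qed
  have "(\<lambda>n. real_of_int (m n) / 2 ^ n) \<longlonglongrightarrow> x"
  proof (rule tendsto_sandwich[of "\<lambda>n. x - (1/2) ^ n" _ _ "\<lambda>n. x"])
    have "real_of_int (m n) \<le> 2 ^ n * x" "2 ^ n * x - 1 \<le> real_of_int (m n)" for n unfolding m_def by linarith+
    then have *: "real_of_int (m n) / 2 ^ n \<le> 2 ^ n * x / 2 ^ n" "(2 ^ n * x - 1) / 2 ^ n \<le> real_of_int (m n) / 2 ^ n" for n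
      by (intro divide_right_mono; simp)+
    have "real_of_int (m n) / 2 ^ n \<le> x" "x - (1/2) ^ n \<le> real_of_int (m n) / 2 ^ n" for n
      using *[of n] by (simp_all add: diff_divide_distrib power_one_over)
    then show "\<forall>\<^sub>F n in sequentially. x - (1/2) ^ n \<le> real_of_int (m n) / 2 ^ n"
      "\<forall>\<^sub>F n in sequentially. real_of_int (m n) / 2 ^ n \<le> x" by auto
    have "(\<lambda>n. x - (1/2) ^ n) \<longlonglongrightarrow> x - 0"
      by (intro tendsto_diff tendsto_const LIMSEQ_realpow_zero) auto
    then show "(\<lambda>n. x - (1/2) ^ n) \<longlonglongrightarrow> x" by simp
  qed simp
  then have "(\<lambda>j. (1/2) ^ Suc j * b j) sums x" unfolding sums_def part .
  moreover have "b j \<in> {0, 1}" for j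
  proof -
    have "m (Suc j) mod 2 = 0 \<or> m (Suc j) mod 2 = 1" by presburger
    then show ?thesis by (auto simp: b_def)
  qed
  ultimately show thesis using that by blast
qed

text \<open>
  Truncated distances to the points of a countable dense set.
\<close>
lemma compactum_separating_functions:
  assumes Y: "compactum Y"
  obtains u :: "nat \<Rightarrow> 'a \<Rightarrow> real" where "\<And>k. continuous_map Y euclideanreal (u k)"
    "\<And>k y. y \<in> topspace Y \<Longrightarrow> 0 \<le> u k y \<and> u k y < 1"
    "\<And>y y'. y \<in> topspace Y \<Longrightarrow> y' \<in> topspace Y \<Longrightarrow> \<forall>k. u k y = u k y' \<Longrightarrow> y = y'"
proof (cases "topspace Y = {}")
  case True
  then show thesis using that[of "\<lambda>_ _. 0"] by simp
next
  case False
  obtain M d where Md: "Metric_space M d" "Y = Metric_space.mtopology M d"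
    using Y by (auto simp: compactum_def metrizable_space_def)
  interpret Metric_space M d by (rule Md)
  have topY: "topspace Y = M" by (simp add: Md(2))
  have "second_countable Y" using Y compact_metrizable_imp_second_countable by (auto simp: compactum_def)
  then have "separable_space Y" by (rule second_countable_imp_separable_space)
  then obtain C where C: "countable C" "C \<subseteq> topspace Y" "Y closure_of C = topspace Y"
    unfolding separable_space_def by blast
  have "C \<noteq> {}" using C(3) False by (metis closure_of_empty)
  define q where "q = from_nat_into C"
  have qC: "range q = C" unfolding q_def using \<open>C \<noteq> {}\<close> C(1) by (rule range_from_nat_into)
  then have qM: "q k \<in> M" for k using C(2) topY by auto
  \<comment> \<open>Truncation keeps the values below \<open>1\<close>, where binary expansions are available.\<close>
  define u where "u k y = min (1/2) (d y (q k))" for k y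
  have dc: "continuous_map Y euclideanreal (\<lambda>y. d y (q k))" for k
  proof -
    obtain s where s: "continuous_map (subtopology mtopology M) euclideanreal s" "\<And>z. z \<in> M \<Longrightarrow> 0 \<le> s z"
      "\<And>z c. z \<in> M \<Longrightarrow> s z < c \<Longrightarrow> \<exists>p\<in>{q k}. d z p + dist (0::real) 0 < c"
      "\<And>z p. z \<in> M \<Longrightarrow> p \<in> {q k} \<Longrightarrow> s z \<le> d z p + dist (0::real) 0"
      using graph_distance[of M "{q k}" "\<lambda>_. 0::real"] qM by auto
    have "s z = d z (q k)" if "z \<in> M" for z
      using s(3)[OF that, of "d z (q k)"] s(4)[OF that, of "q k"] by force
    moreover have "continuous_map Y euclideanreal s" using s(1) Md(2) by (metis subtopology_topspace topspace_mtopology)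
    ultimately show ?thesis using topY continuous_map_eq by metis
  qed
  show thesis
  proof (rule that[of u])
    show "continuous_map Y euclideanreal (u k)" for k unfolding u_def by (intro continuous_intros dc)
    show "0 \<le> u k y \<and> u k y < 1" for k y by (auto simp: u_def)
    fix y y' assume y: "y \<in> topspace Y" "y' \<in> topspace Y" and eq: "\<forall>k. u k y = u k y'"
    show "y = y'"
    proof (rule ccontr)
      assume "y \<noteq> y'"
      then have D: "0 < d y y'" using y topY by simp
      define r where "r = min (1/4) (d y y' / 3)"
      have r: "0 < r" "r \<le> 1/4" "r \<le> d y y' / 3" using D by (auto simp: r_def)
      have "y \<in> mtopology closure_of C" using C(3) y Md(2) by simp
      then obtain p where p: "p \<in> C" "p \<in> mball y r" using r(1) unfolding metric_closure_of by blast
      then obtain k where k: "p = q k" using qC by blast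
      have dp: "d y (q k) < r" using p(2) k by simp
      have "d y' y \<le> d y' (q k) + d (q k) y" using y topY qM by (intro triangle) auto
      then have "2 * r < d y' (q k) + r" using dp r commute[of y' y] commute[of y "q k"] by linarith
      then have "r < u k y'" using r by (auto simp: u_def)
      moreover have "u k y < r" using dp r by (auto simp: u_def)
      ultimately show False using spec[OF eq, of k] by simp
    qed
  qed
qed

text \<open>
  A binary sequence codes the point of \<open>Y\<close> whose values under the separating functions have the binary
  expansions stored in the sequence, the digits of the \<open>k\<close>th value at the positions \<open>(k, j)\<close>. Every point
  has a code, a code determines the point, and the relation is closed. The set \<open>B\<close> is the relation with
  codes replaced by the numbers \<open>1/3 + cantor_number c\<close>, which lie in the middle third of \<open>I\<close>. Transposed, \<open>B\<close>
  is the graph of a continuous map from a compact subset of a Cantor set onto \<open>Y\<close>.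
\<close>
lemma cantor_relation:
  assumes Y: "compactum Y"
  obtains B where "closedin (prod_topology Y unit_interval) B"
    "\<And>y. y \<in> topspace Y \<Longrightarrow> \<exists>t. (y, t) \<in> B"
    "\<And>y t. (y, t) \<in> B \<Longrightarrow> 1/3 \<le> t \<and> t \<le> 2/3"
    "\<And>y y' t. (y, t) \<in> B \<Longrightarrow> (y', t) \<in> B \<Longrightarrow> y = y'"
    "\<And>a b. a < b \<Longrightarrow> \<exists>s. a < s \<and> s < b \<and> s \<notin> snd ` B"
proof -
  obtain u :: "nat \<Rightarrow> 'a \<Rightarrow> real" where u: "\<And>k. continuous_map Y euclideanreal (u k)"
    "\<And>k y. y \<in> topspace Y \<Longrightarrow> 0 \<le> u k y \<and> u k y < 1"
    "\<And>y y'. y \<in> topspace Y \<Longrightarrow> y' \<in> topspace Y \<Longrightarrow> \<forall>k. u k y = u k y' \<Longrightarrow> y = y'"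
    by (rule compactum_separating_functions[OF Y]) (rule that; assumption)
  have half: "summable (\<lambda>j. (1/2::real) ^ Suc j)" by (simp add: summable_geometric)
  define v where "v k c = (\<Sum>j. (1/2) ^ Suc j * c (prod_encode (k, j)))" for k and c :: "nat \<Rightarrow> real"
  have vc: "continuous_on binary_sequences (v k)" for k
    unfolding v_def by (rule binary_series(1)[OF half]) simp
  let ?Q = "prod_topology Y (top_of_set binary_sequences)"
  have cQ: "compact_space ?Q" using Y compact_binary_sequences
    by (simp add: compactum_def compact_space_prod_topology compact_space_subtopology)
  define R where "R = {p \<in> topspace ?Q. \<forall>k. u k (fst p) = v k (snd p)}"
  have Rc: "closedin ?Q {p \<in> topspace ?Q. u k (fst p) - v k (snd p) \<in> {0}}" for k
  proof (rule closedin_continuous_map_preimage)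
    have "continuous_map ?Q euclideanreal (\<lambda>p. u k (fst p))"
      using continuous_map_compose[OF continuous_map_fst u(1)] by (simp add: o_def)
    moreover have "continuous_map (top_of_set binary_sequences) euclideanreal (v k)" using vc by simp
    from continuous_map_compose[OF continuous_map_snd this, of Y]
    have "continuous_map ?Q euclideanreal (\<lambda>p. v k (snd p))" by (simp add: o_def)
    ultimately show "continuous_map ?Q euclideanreal (\<lambda>p. u k (fst p) - v k (snd p))" by (rule continuous_map_diff)
  qed simp
  have "closedin ?Q (\<Inter>k. {p \<in> topspace ?Q. u k (fst p) - v k (snd p) \<in> {0}})" by (intro closedin_INT Rc) simp
  moreover have "(\<Inter>k. {p \<in> topspace ?Q. u k (fst p) - v k (snd p) \<in> {0}}) = R" by (auto simp: R_def)
  ultimately have "compactin ?Q R" using cQ closedin_compact_space by metis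
  define G where "G p = (fst p, 1/3 + cantor_number (snd p))" for p :: "'a \<times> (nat \<Rightarrow> real)"
  have Gc: "continuous_map ?Q (prod_topology Y unit_interval) G"
    unfolding G_def
  proof (intro continuous_map_pairedI continuous_map_fst)
    have "continuous_map (top_of_set binary_sequences) euclideanreal cantor_number" using continuous_on_cantor_number by simp
    from continuous_map_compose[OF continuous_map_snd this, of Y]
    have "continuous_map ?Q euclideanreal (\<lambda>p. cantor_number (snd p))" by (simp add: o_def)
    then have "continuous_map ?Q euclideanreal (\<lambda>p. 1/3 + cantor_number (snd p))" by (intro continuous_intros)
    then show "continuous_map ?Q unit_interval (\<lambda>p. 1/3 + cantor_number (snd p))"
    proof (rule continuous_map_to_subtopologyI)
      show "(\<lambda>p. 1/3 + cantor_number (snd p)) ` topspace ?Q \<subseteq> {0..1}"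
      proof
        fix t assume "t \<in> (\<lambda>p. 1/3 + cantor_number (snd p)) ` topspace ?Q"
        then obtain p where "snd p \<in> binary_sequences" "t = 1/3 + cantor_number (snd p)" by auto
        then show "t \<in> {0..1}" using cantor_number_bounds[of "snd p"] by simp
      qed
    qed
  qed
  have HP: "Hausdorff_space (prod_topology Y unit_interval)"
    using Y by (intro metrizable_imp_Hausdorff_space)
      (simp add: compactum_def metrizable_space_prod_topology metrizable_space_subtopology metrizable_space_euclidean)
  have BI: "\<exists>c\<in>binary_sequences. t = 1/3 + cantor_number c \<and> y \<in> topspace Y \<and> (\<forall>k. u k y = v k c)" if "(y, t) \<in> G ` R" for y t
    using that by (auto simp: G_def R_def)
  show thesis
  proof (rule that[of "G ` R"])
    show "closedin (prod_topology Y unit_interval) (G ` R)"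
      by (rule compactin_imp_closedin[OF HP image_compactin[OF \<open>compactin ?Q R\<close> Gc]])
    show "1/3 \<le> t \<and> t \<le> 2/3" if "(y, t) \<in> G ` R" for y t
      using BI[OF that] cantor_number_bounds by force
    show "y = y'" if yt: "(y, t) \<in> G ` R" "(y', t) \<in> G ` R" for y y' t
    proof -
      obtain c where c: "c \<in> binary_sequences" "t = 1/3 + cantor_number c" "y \<in> topspace Y" "\<forall>k. u k y = v k c"
        using BI[OF yt(1)] by blast
      obtain c' where c': "c' \<in> binary_sequences" "t = 1/3 + cantor_number c'" "y' \<in> topspace Y" "\<forall>k. u k y' = v k c'"
        using BI[OF yt(2)] by blast
      have "c = c'" using inj_onD[OF inj_on_cantor_number _ c(1) c'(1)] c(2) c'(2) by simp
      then show ?thesis using u(3)[OF c(3) c'(3)] c(4) c'(4) by simp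
    qed
    show "\<exists>s. a < s \<and> s < b \<and> s \<notin> snd ` G ` R" if "a < b" for a b :: real
    proof -
      have "a - 1/3 < b - 1/3" using that by simp
      from cantor_number_gaps[OF this] obtain s where s: "a - 1/3 < s" "s < b - 1/3" "s \<notin> cantor_number ` binary_sequences" by blast
      have "s + 1/3 \<notin> snd ` G ` R"
      proof
        assume "s + 1/3 \<in> snd ` G ` R"
        then obtain p where "p \<in> G ` R" "s + 1/3 = snd p" by blast
        then have "(fst p, s + 1/3) \<in> G ` R" by simp
        from BI[OF this] show False using s(3) by auto
      qed
      then show ?thesis using s by (intro exI[of _ "s + 1/3"]) auto
    qed
    show "\<exists>t. (y, t) \<in> G ` R" if y: "y \<in> topspace Y" for y
    proof -
      have "\<forall>k. \<exists>b. (\<forall>j. b j \<in> {0, 1::real}) \<and> (\<lambda>j. (1/2) ^ Suc j * b j) sums u k y"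
      proof
        fix k
        have "0 \<le> u k y" "u k y < 1" using u(2)[OF y, of k] by auto
        then show "\<exists>b. (\<forall>j. b j \<in> {0, 1::real}) \<and> (\<lambda>j. (1/2) ^ Suc j * b j) sums u k y"
          by (rule binary_expansion_exists) blast
      qed
      from choice[OF this] obtain b where b: "\<forall>k. (\<forall>j. b k j \<in> {0, 1::real}) \<and> (\<lambda>j. (1/2) ^ Suc j * b k j) sums u k y" ..
      define c where "c i = (case prod_decode i of (k, j) \<Rightarrow> b k j)" for i
      have "b k j \<in> {0, 1}" for k j using b by blast
      then have "c i \<in> {0, 1}" for i unfolding c_def case_prod_unfold .
      then have "c \<in> binary_sequences" by (simp add: binary_sequences_def PiE_iff)
      moreover have "u k y = v k c" for k
        using b by (simp add: v_def c_def sums_iff)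
      ultimately have "(y, c) \<in> R" using y by (simp add: R_def)
      then have "G (y, c) \<in> G ` R" by (rule imageI)
      then show ?thesis by (auto simp: G_def)
    qed
  qed
qed

section \<open>The implications\<close>

text \<open>
  By the Lindelof property, countably many sets that are open and closed refine a given cover. They are
  made disjoint and then united according to the member of the cover that contains them.
\<close>
lemma covering_dim_le_0_clopen_base:
  assumes T: "second_countable T"
    and base: "\<And>x W. \<lbrakk>openin T W; x \<in> W\<rbrakk> \<Longrightarrow> \<exists>C. openin T C \<and> closedin T C \<and> x \<in> C \<and> C \<subseteq> W"
  shows "covering_dim_le T 0"
  unfolding covering_dim_le_def
proof (intro conjI allI impI)
  fix \<U> assume \<U>: "finite \<U> \<and> (\<forall>U\<in>\<U>. openin T U) \<and> \<Union>\<U> = topspace T"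
  define \<C> where "\<C> = {C. openin T C \<and> closedin T C \<and> (\<exists>U\<in>\<U>. C \<subseteq> U)}"
  have cov: "\<Union>\<C> = topspace T"
  proof
    show "\<Union>\<C> \<subseteq> topspace T" using openin_subset by (auto simp: \<C>_def)
    show "topspace T \<subseteq> \<Union>\<C>"
    proof
      fix x assume "x \<in> topspace T"
      then obtain U where U: "U \<in> \<U>" "x \<in> U" using \<U> by blast
      then obtain C where "openin T C" "closedin T C" "x \<in> C" "C \<subseteq> U" using base[of U x] \<U> by blast
      then show "x \<in> \<Union>\<C>" using U(1) by (auto simp: \<C>_def)
    qed
  qed
  have "\<exists>\<V>. countable \<V> \<and> \<V> \<subseteq> \<C> \<and> \<Union>\<V> = topspace T"
    by (rule Lindelof_spaceD[OF second_countable_imp_Lindelof_space[OF T] _ cov]) (simp add: \<C>_def)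
  then obtain \<C>' where \<C>': "countable \<C>'" "\<C>' \<subseteq> \<C>" "\<Union>\<C>' = topspace T" by (elim exE conjE) (rule that)
  show "\<exists>\<V>. finite \<V> \<and> (\<forall>V\<in>\<V>. openin T V) \<and> \<Union>\<V> = topspace T \<and> (\<forall>V\<in>\<V>. \<exists>U\<in>\<U>. V \<subseteq> U) \<and>
      (\<forall>x\<in>topspace T. int (card {V\<in>\<V>. x \<in> V}) \<le> 0 + 1)"
  proof (cases "\<C>' = {}")
    case True
    then show ?thesis using \<C>'(3) by (intro exI[of _ "{}"]) auto
  next
    case False
    define c where "c = from_nat_into \<C>'"
    have rc: "range c = \<C>'" unfolding c_def by (rule range_from_nat_into[OF False \<C>'(1)])
    then have cC: "c n \<in> \<C>" for n using \<C>'(2) by blast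
    define D where "D n = c n - (\<Union>m\<in>{..<n}. c m)" for n :: nat
    have oD: "openin T (D n)" for n
      unfolding D_def using cC by (intro openin_diff closedin_Union) (auto simp: \<C>_def)
    have dis: "m = n" if "x \<in> D m" "x \<in> D n" for x m n
      using that by (cases m n rule: linorder_cases) (auto simp: D_def)
    have covD: "\<exists>n. x \<in> D n" if "x \<in> topspace T" for x
    proof -
      have "\<exists>n. x \<in> c n" using that \<C>'(3) rc by blast
      then have "x \<in> c (LEAST n. x \<in> c n)" by (rule LeastI_ex)
      moreover have "x \<notin> c m" if "m < (LEAST n. x \<in> c n)" for m using not_less_Least[OF that] .
      ultimately show ?thesis unfolding D_def by blast
    qed
    have "\<forall>n. \<exists>U. U \<in> \<U> \<and> c n \<subseteq> U" using cC unfolding \<C>_def by blast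
    then obtain u where u: "\<And>n. u n \<in> \<U>" "\<And>n. c n \<subseteq> u n" by metis
    define V where "V U = (\<Union>n\<in>{n. u n = U}. D n)" for U
    have VU: "V U \<subseteq> U" for U using u(2) by (auto simp: V_def D_def)
    have uniq: "U = U'" if xV: "x \<in> V U" "x \<in> V U'" for x U U'
    proof -
      obtain m where m: "u m = U" "x \<in> D m" using xV(1) unfolding V_def by blast
      obtain n where n: "u n = U'" "x \<in> D n" using xV(2) unfolding V_def by blast
      show ?thesis using dis[OF m(2) n(2)] m(1) n(1) by simp
    qed
    show ?thesis
    proof (intro exI[of _ "V ` \<U>"] conjI ballI)
      show "finite (V ` \<U>)" by (rule finite_imageI[OF conjunct1[OF \<U>]])
      show "openin T W" if "W \<in> V ` \<U>" for W using that oD by (auto simp: V_def)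
      show "\<Union> (V ` \<U>) = topspace T"
      proof
        show "\<Union> (V ` \<U>) \<subseteq> topspace T" using VU \<U> by blast
        show "topspace T \<subseteq> \<Union> (V ` \<U>)"
        proof
          fix x assume "x \<in> topspace T"
          then obtain n where "x \<in> D n" using covD by blast
          then have "x \<in> V (u n)" by (auto simp: V_def)
          then show "x \<in> \<Union> (V ` \<U>)" using u(1) by blast
        qed
      qed
      show "\<exists>U\<in>\<U>. W \<subseteq> U" if "W \<in> V ` \<U>" for W using that VU by blast
      fix x assume "x \<in> topspace T"
      have "\<exists>W0. {W \<in> V ` \<U>. x \<in> W} \<subseteq> {W0}"
      proof (cases "\<exists>U\<in>\<U>. x \<in> V U")
        case True
        then obtain U where "x \<in> V U" by blast
        then have "{W \<in> V ` \<U>. x \<in> W} \<subseteq> {V U}" using uniq by blast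
        then show ?thesis by blast
      qed blast
      then obtain W0 where "{W \<in> V ` \<U>. x \<in> W} \<subseteq> {W0}" by blast
      then have "card {W \<in> V ` \<U>. x \<in> W} \<le> card {W0}" by (intro card_mono) auto
      then show "int (card {W \<in> V ` \<U>. x \<in> W}) \<le> 0 + 1" by simp
    qed
  qed
qed simp

lemma covering_dim_le_0_iff: "covering_dim T \<le> 0 \<longleftrightarrow> covering_dim_le T 0"
proof
  have "covering_dim T \<le> 0 \<longleftrightarrow> (\<exists>m\<le>0. covering_dim_le T m)"
    using covering_dim_le_iff[of T 0] by (simp add: zero_ereal_def)
  moreover assume "covering_dim T \<le> 0"
  ultimately obtain m where m: "m \<le> 0" "covering_dim_le T m" by blast
  show "covering_dim_le T 0"
    unfolding covering_dim_le_def
  proof (intro conjI allI impI)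
    fix \<U> assume "finite \<U> \<and> (\<forall>U\<in>\<U>. openin T U) \<and> \<Union>\<U> = topspace T"
    from m(2)[unfolded covering_dim_le_def, THEN conjunct2, THEN spec, THEN mp, OF this]
    obtain \<V> where \<V>: "finite \<V> \<and> (\<forall>V\<in>\<V>. openin T V) \<and> \<Union>\<V> = topspace T \<and> (\<forall>V\<in>\<V>. \<exists>U\<in>\<U>. V \<subseteq> U) \<and>
      (\<forall>x\<in>topspace T. int (card {V\<in>\<V>. x \<in> V}) \<le> m + 1)" ..
    have "m + 1 \<le> 0 + 1" using m(1) by simp
    then have "\<forall>x\<in>topspace T. int (card {V\<in>\<V>. x \<in> V}) \<le> 0 + 1" using \<V> by (meson order_trans)
    then show "\<exists>\<V>. finite \<V> \<and> (\<forall>V\<in>\<V>. openin T V) \<and> \<Union>\<V> = topspace T \<and> (\<forall>V\<in>\<V>. \<exists>U\<in>\<U>. V \<subseteq> U) \<and>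
      (\<forall>x\<in>topspace T. int (card {V\<in>\<V>. x \<in> V}) \<le> 0 + 1)" using \<V> by (intro exI[of _ \<V>]) simp
  qed simp
next
  assume "covering_dim_le T 0"
  then show "covering_dim T \<le> 0" using covering_dim_le_iff[of T 0] by (auto simp: zero_ereal_def)
qed

lemma dim_map_le_0_iff:
  "dim_map Z W h \<le> 0 \<longleftrightarrow> (\<forall>w\<in>topspace W. covering_dim_le (fiber Z h w) 0)"
  unfolding dim_map_def SUP_le_iff covering_dim_le_0_iff ..

text \<open>
  Closed subsets of a fiber of \<open>f\<^sub>*\<close> that lie in \<open>A\<close> are closed in \<open>A\<close>, so they inherit the bound from
  \<open>A\<close>; the theorem on suspensions applies to the fiber.
\<close>
lemma prop2_imp_prop1:
  assumes X: "compactum X" and Y: "compactum Y" and f: "continuous_map X Y f" and K: "CW_complex K"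
    and p: "prop2 X Y f K"
  shows "prop1 X Y f K"
  unfolding prop1_def e_dim_map_le_def
proof
  let ?S = "star_space X"
  fix y assume y: "y \<in> topspace Y"
  obtain E where CW: "CW_structure K E" using K by (auto simp: CW_complex_def)
  obtain A where A: "sigma_compact_in ?S A" "e_dim_le (subtopology ?S A) K"
    "dim_map (subtopology ?S (topspace ?S - A)) Y (star_map f) \<le> 0"
    using p by (auto simp: prop2_def prop2_set_def)
  have S: "compact_space ?S" "metrizable_space ?S" using compactum_star_space[OF X] by auto
  have HY: "Hausdorff_space Y" using Y by (simp add: compactum_def metrizable_imp_Hausdorff_space)
  define Z0 where "Z0 = {z \<in> topspace ?S. star_map f z = y}"
  have Z0: "closedin ?S Z0"
  proof -
    have "closedin ?S {z \<in> topspace ?S. star_map f z \<in> {y}}"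
      by (rule closedin_continuous_map_preimage[OF continuous_map_star_map[OF f]]) (rule closedin_Hausdorff_singleton[OF HY y])
    then show ?thesis by (simp add: Z0_def)
  qed
  let ?Z = "subtopology ?S Z0"
  have topZ: "topspace ?Z = Z0" using closedin_subset[OF Z0] by auto
  have cZ: "compact_space ?Z" using closedin_compact_space[OF S(1) Z0] by (simp add: compact_space_subtopology)
  have "e_dim_le ?Z (suspension_space K)"
  proof (rule e_dim_le_suspension[OF CW cZ metrizable_space_subtopology[OF S(2)], where A="A \<inter> Z0"])
    show "A \<inter> Z0 \<subseteq> topspace ?Z" using topZ by simp
    fix L assume L: "closedin ?Z L" "L \<subseteq> A \<inter> Z0"
    have "closedin ?S L" by (rule closedin_trans_full[OF L(1) Z0])
    then have "closedin (subtopology ?S A) L" using L(2) by (intro closedin_subset_topspace) auto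
    from e_dim_le_closed_subset[OF A(2) this]
    show "e_dim_le (subtopology ?Z L) K" using L(2) by (simp add: subtopology_subtopology Int_absorb1)
  next
    have "covering_dim_le (fiber (subtopology ?S (topspace ?S - A)) (star_map f) y) 0"
      using A(3) y unfolding dim_map_le_0_iff by blast
    moreover have "fiber (subtopology ?S (topspace ?S - A)) (star_map f) y = subtopology ?Z (topspace ?Z - A \<inter> Z0)"
      unfolding topZ subtopology_subtopology by (rule arg_cong[where f="subtopology ?S"]) (auto simp: Z0_def)
    ultimately show "covering_dim_le (subtopology ?Z (topspace ?Z - A \<inter> Z0)) 0" by simp
  qed
  then show "e_dim_le (fiber ?S (star_map f) y) (suspension_space K)" by (simp add: Z0_def)
qed

text \<open>
  A Urysohn function for the two sets has a ball of radius \<open>1/3\<close> consisting of maps that separate them,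
  and a generic map can be chosen in this ball.
\<close>
lemma generic_separating_map:
  assumes X: "compactum X" and p: "prop3 X Y f K"
    and U: "openin (star_space X) U" and V: "openin (star_space X) V" and UV: "star_space X closure_of U \<subseteq> V"
  obtains g where "continuous_map (star_space X) unit_interval g" "nowhere_constant X g"
    "e_dim_map_le (star_space X) (prod_topology Y unit_interval) (\<lambda>z. (star_map f z, g z)) K"
    "\<And>z. z \<in> U \<Longrightarrow> g z < 1/3" "\<And>z. z \<in> topspace (star_space X) - V \<Longrightarrow> 2/3 < g z"
proof -
  let ?S = "star_space X" let ?M = "maps_to_interval ?S"
  interpret M: Metric_space "mspace ?M" "mdist ?M" by (rule Metric_space_mspace_mdist)
  have mt: "mtopology_of ?M = M.mtopology" by (simp add: mtopology_of_def)
  have S: "compact_space ?S" "metrizable_space ?S" using compactum_star_space[OF X] by auto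
  have dj: "disjnt (?S closure_of U) (topspace ?S - V)" using UV by (auto simp: disjnt_iff)
  have cl: "closedin ?S (topspace ?S - V)" by (rule closedin_diff[OF closedin_topspace V])
  obtain h where h: "continuous_map ?S (top_of_set {0..1::real}) h" "h ` (?S closure_of U) \<subseteq> {0}" "h ` (topspace ?S - V) \<subseteq> {1}"
    by (rule Urysohn_lemma[OF metrizable_imp_normal_space[OF S(2)] closedin_closure_of cl dj zero_le_one]) (rule that; assumption)
  define h' where "h' = restrict h (topspace ?S)"
  have "continuous_map ?S unit_interval h'" by (rule continuous_map_eq[OF h(1)]) (simp add: h'_def)
  then have h'M: "h' \<in> mspace ?M" using mspace_maps_to_interval[OF S(1)] by (simp add: h'_def)
  have "h' \<in> M.mball h' (1/3)" using h'M by simp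
  then have ne: "M.mball h' (1/3) \<noteq> {}" by blast
  have op: "openin (mtopology_of ?M) (M.mball h' (1/3))" unfolding mt by (rule M.openin_mball)
  obtain g where g: "g \<in> M.mball h' (1/3)" "nowhere_constant X g"
    "e_dim_map_le ?S (prod_topology Y unit_interval) (\<lambda>z. (star_map f z, g z)) K"
    by (rule generic_map_exists[OF X p op ne]) (rule that; assumption)
  have gM: "g \<in> mspace ?M" "mdist ?M h' g < 1/3" using g(1) by (simp_all only: M.in_mball)
  have near: "\<bar>h' z - g z\<bar> < 1/3" if "z \<in> topspace ?S" for z
    by (rule mdist_maps_to_interval[OF h'M gM that])
  show thesis
  proof (rule that[of g])
    show "continuous_map ?S unit_interval g" using gM(1) mspace_maps_to_interval[OF S(1)] by blast
    show "g z < 1/3" if z: "z \<in> U" for z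
    proof -
      have zS: "z \<in> topspace ?S" "z \<in> ?S closure_of U"
        using openin_subset[OF U] closure_of_subset[OF openin_subset[OF U]] z by blast+
      then have "h' z = 0" using h(2) by (auto simp: h'_def)
      then show ?thesis using near[OF zS(1)] by simp
    qed
    show "2/3 < g z" if z: "z \<in> topspace ?S - V" for z
    proof -
      have "h' z = 1" using h(3) z by (auto simp: h'_def)
      then have "\<bar>1 - g z\<bar> < 1/3" using near[of z] z by simp
      then show ?thesis by linarith
    qed
  qed (use g in blast)+
qed

text \<open>
  On a vertical interval, the heights avoided by the level set are dense, and cutting at two such heights
  gives sets that are open and closed.
\<close>
lemma light_fiber_zero_dimensional:
  assumes X: "compactum X" and g: "nowhere_constant X g" and C: "C \<subseteq> topspace (star_space X)" "\<And>z. z \<in> C \<Longrightarrow> g z = c"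
  shows "covering_dim_le (fiber (subtopology (star_space X) C) fst x) 0"
proof (rule covering_dim_le_0_clopen_base)
  let ?S = "star_space X"
  define T where "T = {z \<in> C. fst z = x}"
  have T: "fiber (subtopology ?S C) fst x = subtopology ?S T"
    unfolding subtopology_subtopology using C(1) by (intro arg_cong[where f="subtopology ?S"]) (auto simp: T_def)
  have TS: "T \<subseteq> topspace ?S" using C(1) by (auto simp: T_def)
  have "second_countable ?S" using compact_metrizable_imp_second_countable compactum_star_space[OF X] by blast
  then show "second_countable (fiber (subtopology ?S C) fst x)" unfolding T by (rule second_countable_subtopology)
  have snd_T: "continuous_map (subtopology ?S T) euclideanreal snd"
    using continuous_map_snd[of X unit_interval]
    by (intro continuous_map_from_subtopology) (simp add: star_space_def continuous_map_in_subtopology)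
  fix z W assume W: "openin (fiber (subtopology ?S C) fst x) W" "z \<in> W"
  then obtain W' where W': "openin ?S W'" "W = W' \<inter> T" unfolding T by (auto simp: openin_subtopology)
  then have zT: "z \<in> T" "z \<in> W'" using W(2) by auto
  obtain s where z: "z = (x, s)" using zT(1) by (cases z) (auto simp: T_def)
  have xX: "x \<in> topspace X" using zT(1) TS z by (auto simp: topspace_star_space)
  have "\<exists>U V. openin X U \<and> openin unit_interval V \<and> x \<in> U \<and> s \<in> V \<and> U \<times> V \<subseteq> W'"
    using W'(1) zT(2) z unfolding star_space_def openin_prod_topology_alt by blast
  then obtain U V where UV: "openin X U" "openin unit_interval V" "x \<in> U" "s \<in> V" "U \<times> V \<subseteq> W'" by blast
  obtain V' where V': "open V'" "V = {0..1} \<inter> V'" using UV(2) by (auto simp: openin_open)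
  obtain e where e: "e > 0" "ball s e \<subseteq> V'" using V' UV(4) by (metis IntD2 open_contains_ball)
  have se: "s - e < s" "s < s + e" using e(1) by auto
  obtain r where r: "s - e < r" "r < s" "\<not> (r \<in> {0..1} \<and> g (x, r) = c)" by (rule nowhere_constant_gap[OF g xX se(1)])
  obtain r' where r': "s < r'" "r' < s + e" "\<not> (r' \<in> {0..1} \<and> g (x, r') = c)" by (rule nowhere_constant_gap[OF g xX se(2)])
  have avoid: "snd z' \<noteq> r \<and> snd z' \<noteq> r'" if z': "z' \<in> T" for z'
  proof -
    have "z' = (x, snd z')" "snd z' \<in> {0..1}" "g z' = c"
      using z' TS C(2) by (auto simp: T_def topspace_star_space prod_eq_iff)
    then show ?thesis using r(3) r'(3) by metis
  qed
  have topT: "topspace (subtopology ?S T) = T" using TS by auto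
  define C0 where "C0 = {z' \<in> T. snd z' \<in> {r<..<r'}}"
  have "openin (subtopology ?S T) {z' \<in> topspace (subtopology ?S T). snd z' \<in> {r<..<r'}}"
    by (rule openin_continuous_map_preimage[OF snd_T]) simp
  then have o: "openin (subtopology ?S T) C0" unfolding topT C0_def .
  have "closedin (subtopology ?S T) {z' \<in> topspace (subtopology ?S T). snd z' \<in> {r..r'}}"
    by (rule closedin_continuous_map_preimage[OF snd_T]) simp
  moreover have "{z' \<in> T. snd z' \<in> {r..r'}} = C0" using avoid by (auto simp: C0_def order_less_le)
  ultimately have cl: "closedin (subtopology ?S T) C0" unfolding topT by simp
  have "z \<in> C0" using zT(1) z r(2) r'(1) by (simp add: C0_def)
  moreover have "C0 \<subseteq> W"
  proof
    fix z' assume z': "z' \<in> C0"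
    then have z'T: "z' \<in> T" and "snd z' \<in> ball s e" using r(1) r'(2) by (auto simp: C0_def dist_real_def)
    moreover have "z' = (x, snd z')" "snd z' \<in> {0..1}" using z'T TS by (auto simp: T_def topspace_star_space prod_eq_iff)
    ultimately have "z' \<in> U \<times> V" using UV(3) V'(2) e(2) by (metis IntI SigmaI subsetD)
    then show "z' \<in> W" using UV(5) W'(2) z'T by blast
  qed
  ultimately show "\<exists>C'. openin (fiber (subtopology ?S C) fst x) C' \<and> closedin (fiber (subtopology ?S C) fst x) C' \<and> z \<in> C' \<and> C' \<subseteq> W"
    unfolding T using o cl by blast
qed

text \<open>
  The maps \<open>G i\<close> are generic and separate the pairs of basic open sets \<open>U, V\<close> with \<open>closure U \<subseteq> V\<close>; \<open>A i\<close> is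
  the preimage of the zero-dimensional compact set \<open>B\<close> under \<open>(f\<^sub>*, G i)\<close>. A single map would not do: the
  complement of one \<open>A i\<close> contains whole fibers of \<open>G i\<close>, and only the family cuts it into small sets.
\<close>
lemma prop3_imp_prop2':
  assumes X: "compactum X" and Y: "compactum Y" and f: "continuous_map X Y f" and K: "CW_complex K"
    and p: "prop3 X Y f K"
  shows "prop2' X Y f K"
proof -
  let ?S = "star_space X" let ?YI = "prod_topology Y unit_interval"
  obtain E where CW: "CW_structure K E" using K by (auto simp: CW_complex_def)
  have S: "compact_space ?S" "metrizable_space ?S" using compactum_star_space[OF X] by auto
  have sc: "second_countable ?S" by (rule compact_metrizable_imp_second_countable[OF S])
  then obtain \<B>0 where \<B>0: "countable \<B>0" "\<forall>V\<in>\<B>0. openin ?S V"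
    "\<forall>U x. openin ?S U \<and> x \<in> U \<longrightarrow> (\<exists>V\<in>\<B>0. x \<in> V \<and> V \<subseteq> U)" unfolding second_countable_def by blast
  \<comment> \<open>The pair of empty sets keeps the family nonempty, so that it can be enumerated.\<close>
  define \<P> where "\<P> = {(U, V). U \<in> insert {} \<B>0 \<and> V \<in> insert {} \<B>0 \<and> ?S closure_of U \<subseteq> V}"
  have "\<P> \<subseteq> insert {} \<B>0 \<times> insert {} \<B>0" by (auto simp: \<P>_def)
  then have cP: "countable \<P>" by (rule countable_subset) (use \<B>0(1) in simp)
  have "({}, {}) \<in> \<P>" by (simp add: \<P>_def)
  then have neP: "\<P> \<noteq> {}" by blast
  have "\<forall>q\<in>\<P>. \<exists>g. continuous_map ?S unit_interval g \<and> nowhere_constant X g \<and>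
      e_dim_map_le ?S ?YI (\<lambda>z. (star_map f z, g z)) K \<and>
      (\<forall>z\<in>fst q. g z < 1/3) \<and> (\<forall>z\<in>topspace ?S - snd q. 2/3 < g z)"
  proof
    fix q assume "q \<in> \<P>"
    then obtain U V where q: "q = (U, V)" "U \<in> insert {} \<B>0" "V \<in> insert {} \<B>0" "?S closure_of U \<subseteq> V" by (auto simp: \<P>_def)
    then have "openin ?S U" "openin ?S V" using \<B>0(2) by auto
    then obtain g where "continuous_map ?S unit_interval g" "nowhere_constant X g"
      "e_dim_map_le ?S ?YI (\<lambda>z. (star_map f z, g z)) K"
      "\<And>z. z \<in> U \<Longrightarrow> g z < 1/3" "\<And>z. z \<in> topspace ?S - V \<Longrightarrow> 2/3 < g z"
      by (rule generic_separating_map[OF X p _ _ q(4)]) (rule that; assumption)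
    then show "\<exists>g. continuous_map ?S unit_interval g \<and> nowhere_constant X g \<and>
      e_dim_map_le ?S ?YI (\<lambda>z. (star_map f z, g z)) K \<and>
      (\<forall>z\<in>fst q. g z < 1/3) \<and> (\<forall>z\<in>topspace ?S - snd q. 2/3 < g z)" using q(1) by (intro exI[of _ g]) simp
  qed
  from bchoice[OF this] obtain gg where gg: "\<forall>q\<in>\<P>. continuous_map ?S unit_interval (gg q) \<and> nowhere_constant X (gg q) \<and>
      e_dim_map_le ?S ?YI (\<lambda>z. (star_map f z, gg q z)) K \<and>
      (\<forall>z\<in>fst q. gg q z < 1/3) \<and> (\<forall>z\<in>topspace ?S - snd q. 2/3 < gg q z)" ..
  define pr where "pr = from_nat_into \<P>"
  have prP: "range pr = \<P>" unfolding pr_def by (rule range_from_nat_into[OF neP cP])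
  define G where "G i = gg (pr i)" for i :: nat
  have pri: "pr i \<in> \<P>" for i using prP by blast
  note ggi = bspec[OF gg pri, folded G_def]
  have G: "continuous_map ?S unit_interval (G i)" "nowhere_constant X (G i)"
      "e_dim_map_le ?S ?YI (\<lambda>z. (star_map f z, G i z)) K"
      "\<And>z. z \<in> fst (pr i) \<Longrightarrow> G i z < 1/3" "\<And>z. z \<in> topspace ?S - snd (pr i) \<Longrightarrow> 2/3 < G i z" for i
    using ggi[of i] by simp_all
  have Gr: "continuous_map ?S euclideanreal (G i)" for i using G(1) by (simp add: continuous_map_in_subtopology)
  have sf: "continuous_map ?S Y (star_map f)" by (rule continuous_map_star_map[OF f])
  have sfY: "star_map f z \<in> topspace Y" if "z \<in> topspace ?S" for z using sf that by (auto simp: continuous_map_def Pi_iff)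
  obtain B where B: "closedin ?YI B" "\<And>y. y \<in> topspace Y \<Longrightarrow> \<exists>t. (y, t) \<in> B"
    "\<And>y t. (y, t) \<in> B \<Longrightarrow> 1/3 \<le> t \<and> t \<le> 2/3" "\<And>y y' t. (y, t) \<in> B \<Longrightarrow> (y', t) \<in> B \<Longrightarrow> y = y'"
    "\<And>a b. a < b \<Longrightarrow> \<exists>s. a < s \<and> s < b \<and> s \<notin> snd ` B"
    by (rule cantor_relation[OF Y]) (rule that; assumption)
  define A where "A i = {z \<in> topspace ?S. (star_map f z, G i z) \<in> B}" for i
  have AS: "A i \<subseteq> topspace ?S" for i by (auto simp: A_def)
  have clA: "closedin ?S (A i)" for i
    unfolding A_def by (rule closedin_continuous_map_preimage[OF _ B(1)]) (intro continuous_map_pairedI sf G(1))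
  have cA: "compactin ?S (A i)" for i by (rule closedin_compact_space[OF S(1) clA])
  have eA: "e_dim_le (subtopology ?S (A i)) K" for i
  proof (rule e_dim_le_map_to_line[OF CW])
    have topA: "topspace (subtopology ?S (A i)) = A i" using AS by auto
    show "metrizable_space (subtopology ?S (A i))" by (rule metrizable_space_subtopology[OF S(2)])
    show "compact_space (subtopology ?S (A i))" using cA by (simp add: compact_space_subtopology)
    show "continuous_map (subtopology ?S (A i)) euclideanreal (G i)" by (rule continuous_map_from_subtopology[OF Gr])
    have im: "G i ` A i \<subseteq> snd ` B" by (force simp: A_def)
    show "\<exists>c. a < c \<and> c < b \<and> c \<notin> G i ` topspace (subtopology ?S (A i))" if "a < b" for a b
      using B(5)[OF that] im topA by blast
    fix c assume "c \<in> G i ` topspace (subtopology ?S (A i))"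
    then obtain z0 where z0: "z0 \<in> A i" "c = G i z0" unfolding topA by blast
    define y0 where "y0 = star_map f z0"
    have yc: "(y0, c) \<in> B" using z0 by (simp add: A_def y0_def)
    then have "(y0, c) \<in> topspace ?YI" using closedin_subset[OF B(1)] by blast
    then have e: "e_dim_le (fiber ?S (\<lambda>z. (star_map f z, G i z)) (y0, c)) K"
      using G(3)[of i] unfolding e_dim_map_le_def by (rule bspec[rotated])
    have eq: "A i \<inter> {z \<in> A i. G i z = c} = {z \<in> topspace ?S. (star_map f z, G i z) = (y0, c)}"
      using B(4) yc by (auto simp: A_def)
    show "e_dim_le (subtopology (subtopology ?S (A i)) {z \<in> topspace (subtopology ?S (A i)). G i z = c}) K"
      unfolding topA subtopology_subtopology eq by (rule e)
  qed
  have eU: "e_dim_le (subtopology ?S (\<Union>i. A i)) K"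
  proof (rule e_dim_le_countable_union[OF CW metrizable_space_subtopology[OF S(2)]])
    show "topspace (subtopology ?S (\<Union>i. A i)) \<subseteq> (\<Union>i. A i)" by auto
    have sub: "A i \<subseteq> (\<Union>i. A i)" for i by blast
    show "compactin (subtopology ?S (\<Union>i. A i)) (A i)" for i using cA sub by (simp add: compactin_subtopology)
    show "e_dim_le (subtopology (subtopology ?S (\<Union>i. A i)) (A i)) K" for i
      using eA[of i] sub[of i] by (simp add: subtopology_subtopology Int_absorb1)
  qed
  have sig: "sigma_compact_in ?S (\<Union>i. A i)"
    unfolding sigma_compact_in_def using cA by (intro exI[of _ "range A"]) auto
  have dim: "dim_map (subtopology ?S (topspace ?S - (\<Union>i. A i))) Y (star_map f) \<le> 0"
    unfolding dim_map_le_0_iff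
  proof
    fix y assume y: "y \<in> topspace Y"
    obtain t where t: "(y, t) \<in> B" using B(2)[OF y] by blast
    define T where "T = {z \<in> topspace ?S - (\<Union>i. A i). star_map f z = y}"
    have T: "fiber (subtopology ?S (topspace ?S - (\<Union>i. A i))) (star_map f) y = subtopology ?S T"
      unfolding subtopology_subtopology by (intro arg_cong[where f="subtopology ?S"]) (auto simp: T_def)
    have topT: "topspace (subtopology ?S T) = T" by (auto simp: T_def)
    show "covering_dim_le (fiber (subtopology ?S (topspace ?S - (\<Union>i. A i))) (star_map f) y) 0"
      unfolding T
    proof (rule covering_dim_le_0_clopen_base[OF second_countable_subtopology[OF sc]])
      fix z W assume W: "openin (subtopology ?S T) W" "z \<in> W"
      then obtain W' where W': "openin ?S W'" "W = W' \<inter> T" by (auto simp: openin_subtopology)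
      have zz: "z \<in> W'" "z \<in> T" "z \<in> topspace ?S" using W(2) W' openin_subset[OF W'(1)] by auto
      obtain V where V: "V \<in> \<B>0" "z \<in> V" "V \<subseteq> W'"
        using \<B>0(3)[rule_format, of W' z] W'(1) zz(1) by blast
      have "closedin ?S {z}" using closedin_Hausdorff_singleton[OF metrizable_imp_Hausdorff_space[OF S(2)] zz(3)] .
      moreover have "openin ?S V" "{z} \<subseteq> V" using V \<B>0(2) by auto
      ultimately obtain N where N: "openin ?S N" "{z} \<subseteq> N" "?S closure_of N \<subseteq> V"
        using normal_space_alt[THEN iffD1, OF metrizable_imp_normal_space[OF S(2)], rule_format, of "{z}" V] by blast
      have "z \<in> N" using N(2) by simp
      from \<B>0(3)[rule_format, OF conjI[OF N(1) this]]
      obtain U where U: "U \<in> \<B>0" "z \<in> U" "U \<subseteq> N" by blast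
      have "?S closure_of U \<subseteq> V" using closure_of_mono[OF U(3)] N(3) by (rule order_trans)
      then have "(U, V) \<in> \<P>" using U(1) V(1) by (simp add: \<P>_def)
      then obtain i where i: "pr i = (U, V)" using prP by (metis rangeE)
      have ne: "G i z' \<noteq> t" if "z' \<in> T" for z' using that t by (auto simp: T_def A_def)
      define C where "C = {z' \<in> T. G i z' \<in> {..<t}}"
      have GT: "continuous_map (subtopology ?S T) euclideanreal (G i)" by (rule continuous_map_from_subtopology[OF Gr])
      have "openin (subtopology ?S T) {z' \<in> topspace (subtopology ?S T). G i z' \<in> {..<t}}"
        by (rule openin_continuous_map_preimage[OF GT]) simp
      then have o: "openin (subtopology ?S T) C" unfolding topT C_def .
      have "closedin (subtopology ?S T) {z' \<in> topspace (subtopology ?S T). G i z' \<in> {..t}}"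
        by (rule closedin_continuous_map_preimage[OF GT]) simp
      moreover have "{z' \<in> T. G i z' \<in> {..t}} = C" using ne by (auto simp: C_def order_less_le)
      ultimately have cl: "closedin (subtopology ?S T) C" unfolding topT by simp
      have "G i z < 1/3" using G(4)[of z i] U(2) i by simp
      then have zC: "z \<in> C" using zz(2) B(3)[OF t] by (simp add: C_def)
      have "C \<subseteq> W"
      proof
        fix z' assume z': "z' \<in> C"
        have "z' \<in> V"
        proof (rule ccontr)
          assume "z' \<notin> V"
          then have "2/3 < G i z'" using G(5)[of z' i] z' i by (simp add: C_def T_def)
          then show False using z' B(3)[OF t] by (simp add: C_def)
        qed
        then show "z' \<in> W" using V(3) W'(2) z' by (auto simp: C_def)
      qed
      then show "\<exists>C. openin (subtopology ?S T) C \<and> closedin (subtopology ?S T) C \<and> z \<in> C \<and> C \<subseteq> W"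
        using o cl zC by blast
    qed
  qed
  have comp: "\<exists>y \<in> topspace Y. \<exists>h. zero_dimensional_map (subtopology ?S C) (fiber X f y) h"
    if C: "C \<in> connected_components_of (subtopology ?S (A i))" for C i
  proof -
    have conn: "connectedin (subtopology ?S (A i)) C" using C by (rule connectedin_connected_components_of)
    have CA: "C \<subseteq> A i" using connectedin_subset_topspace[OF conn] by auto
    have CS: "C \<subseteq> topspace ?S" using CA AS by blast
    obtain z0 where z0: "z0 \<in> C" using nonempty_connected_components_of[OF C] by blast
    have "connectedin euclideanreal (G i ` C)"
      by (rule connectedin_continuous_map_image[OF continuous_map_from_subtopology[OF Gr] conn])
    then have cG: "connected (G i ` C)" by simp
    have sub: "G i ` C \<subseteq> snd ` B" using CA by (force simp: A_def)
    have notless: "\<not> G i z < G i z'" if "z \<in> C" "z' \<in> C" for z z'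
    proof
      assume "G i z < G i z'"
      from B(5)[OF this] obtain s where s: "G i z < s" "s < G i z'" "s \<notin> snd ` B" by blast
      have "{G i z..G i z'} \<subseteq> G i ` C" using connected_contains_Icc[OF cG] that by blast
      then have "s \<in> G i ` C" using s by auto
      then show False using s(3) sub by blast
    qed
    have const: "G i z = G i z0" if "z \<in> C" for z using notless[OF that z0] notless[OF z0 that] by simp
    define y0 where "y0 = star_map f z0"
    have y0: "y0 \<in> topspace Y" unfolding y0_def using sfY[of z0] z0 CS by blast
    have sy: "star_map f z = y0" if "z \<in> C" for z
    proof -
      have "(star_map f z, G i z) \<in> B" "(y0, G i z0) \<in> B" using CA that z0 by (auto simp: A_def y0_def)
      then show ?thesis using B(4) const[OF that] by simp
    qed
    have "zero_dimensional_map (subtopology ?S C) (fiber X f y0) fst"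
      unfolding zero_dimensional_map_def dim_map_le_0_iff
    proof (intro conjI ballI)
      show "continuous_map (subtopology ?S C) (fiber X f y0) fst"
      proof (rule continuous_map_to_subtopologyI)
        show "continuous_map (subtopology ?S C) X fst"
          unfolding star_space_def by (rule continuous_map_from_subtopology[OF continuous_map_fst])
        show "fst ` topspace (subtopology ?S C) \<subseteq> {z \<in> topspace X. f z = y0}"
          using sy by (force simp: topspace_star_space star_map_def)
      qed
      show "covering_dim_le (fiber (subtopology ?S C) fst x) 0" for x
        by (rule light_fiber_zero_dimensional[OF X G(2) CS const])
    qed
    then show ?thesis using y0 by blast
  qed
  show ?thesis
    unfolding prop2'_def prop2_set_def
    using sig eU dim cA comp by (intro exI[of _ "\<Union>i. A i"] conjI exI[of _ A] allI ballI) auto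
qed

theorem theorem1p9:
  fixes X :: "'a topology" and Y :: "'b topology" and f :: "'a \<Rightarrow> 'b" and K :: "'k topology"
  assumes "compactum X" and "compactum Y" and "continuous_map X Y f" and "CW_complex K"
  shows "(prop0 X Y f K \<longrightarrow> prop3 X Y f K) \<and>
         (prop3 X Y f K \<longrightarrow> prop2' X Y f K) \<and>
         (prop2' X Y f K \<longrightarrow> prop2 X Y f K) \<and>
         (prop2 X Y f K \<longrightarrow> prop1 X Y f K)"
proof (intro conjI impI)
  show "prop3 X Y f K" if "prop0 X Y f K" using prop0_imp_prop3[OF assms that] .
  show "prop2' X Y f K" if "prop3 X Y f K" using prop3_imp_prop2'[OF assms that] .
  show "prop2 X Y f K" if p: "prop2' X Y f K"
  proof -
    obtain A where "prop2_set X Y f K A" using p unfolding prop2'_def by (elim exE conjE) (rule that)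
    then show ?thesis unfolding prop2_def by (rule exI)
  qed
  show "prop1 X Y f K" if "prop2 X Y f K" using prop2_imp_prop1[OF assms that] .
qed

end
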